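(* Let $0<\alpha<2$, let $h:(0,\infty)\to(0,\infty)$ be slowly varying at infinity, and for each $n$ let $A=A_n=(a_{jk})$ be an $n\times n$ real symmetric or Hermitian band random matrix (aperiodic or periodic) of band width $d_n$, whose entries inside the band have the heavy tail $G(x)=\Pr(|a_{jk}|>x)=h(x)/x^{\alpha}$. Let $N_n$ be the number of independent entries in the band, and let $b_n>0$ be normalization constants such that $\lim_{n\to\infty}N_n G(b_n x)=x^{-\alpha}$ for all $x>0$. Then the random point configuration composed of the positive eigenvalues of $b_n^{-1}A$ converges in distribution on the cylinder sets, as $n\to\infty$, to the inhomogeneous Poisson random point process on $(0,+\infty)$ with intensity $\rho(x)=\frac{\alpha}{x^{1+\alpha}}$. That is, for every $k\ge 1$, all $0<x_1<y_1<x_2<y_2<\cdots<x_k<y_k\le+\infty$, with $I_j=(x_j,y_j)$, $\#(I_j)=\#\{1\le i\le n:\lambda_i\in I_j\}$, where $\lambda_1\ge\cdots\ge\lambda_n$ are the eigenvalues of $b_n^{-1}A$, and $\mu_j=\int_{I_j}\rho(x)\,dx$, the counting variables $\#(I_1),\dots,\#(I_k)$ are independent in the limit $n\to\infty$ and have a joint Poisson distribution with parameters $\mu_j$: for all nonnegative integers $s_1,\dots,s_k$ $$\lim_{n\to\infty}\Pr\bigl(\#(I_j)=s_j,\ j=1,\dots,k\bigr)=\prod_{j=1}^k\frac{\mu_j^{s_j}}{s_j!}e^{-\mu_j}.$$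
   Context: A function $h:(0,\infty)\to(0,\infty)$ is slowly varying at infinity (in the sense of Karamata) if $\lim_{x\to\infty}h(tx)/h(x)=1$ for all $t>0$. Band matrices. Let $0\le d_n\le n-1$ be integers. An aperiodic real symmetric band random matrix of band width $d_n$ is a real symmetric $n\times n$ matrix $A=(a_{jk})$ with $a_{jk}=0$ unless $|j-k|\le d_n$, and such that $\{a_{jk}: j\le k,\ |j-k|\le d_n\}$ are i.i.d. real random variables. An aperiodic Hermitian band random matrix of band width $d_n$ is a Hermitian $n\times n$ matrix with $a_{jk}=0$ unless $|j-k|\le d_n$, such that $\{a_{jk}: j<k,\ |j-k|\le d_n\}$ are i.i.d. complex random variables and the diagonal entries are i.i.d. real random variables independent of the off-diagonal ones. The periodic versions are obtained by replacing $|j-k|$ by $|j-k|_1=\min(|j-k|,\,n-|j-k|)$ throughout. The case $d_n=n-1$ is the (full) Wigner ensemble. The distribution of the entries does not depend on $n$, and all entries in the band (diagonal ones included) satisfy $\Pr(|a_{jk}|>x)=G(x)=h(x)/x^\alpha$ for $x>0$. $N_n=\#\{1\le i\le j\le n: |i-j|\le d_n\}$ in the aperiodic case and $N_n=\#\{1\le i\le j\le n:|i-j|_1\le d_n\}$ in the periodic case. One admissible choice of normalization is $b_n=\inf\{t: G(t-0)\ge \frac1{N_n}\ge G(t+0)\}$.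
   Formalization: The band width is additionally assumed to satisfy d_n → ∞; for bounded d_n the claim fails (e.g. d_n = 0 with negative heavy-tailed diagonal entries gives no positive eigenvalues). *)

theory Defs
  imports
    "HOL-Probability.Probability"
    "Jordan_Normal_Form.Char_Poly"
    "Jordan_Normal_Form.Schur_Decomposition"
begin

definition slowly_varying :: "(real \<Rightarrow> real) \<Rightarrow> bool" where
  "slowly_varying h \<longleftrightarrow>
     (\<forall>x>0. h x > 0) \<and> (\<forall>t>0. ((\<lambda>x. h (t * x) / h x) \<longlongrightarrow> 1) at_top)"

datatype band_type = Aperiodic | Periodic

text \<open>Matrix indices run over \<open>0, \<dots>, n - 1\<close>; only differences of indices matter below.\<close>

fun band_dist :: "band_type \<Rightarrow> nat \<Rightarrow> nat \<Rightarrow> nat \<Rightarrow> nat" where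
  "band_dist Aperiodic n j k = nat \<bar>int j - int k\<bar>"
| "band_dist Periodic n j k = min (nat \<bar>int j - int k\<bar>) (n - nat \<bar>int j - int k\<bar>)"

definition band_indices :: "band_type \<Rightarrow> nat \<Rightarrow> nat \<Rightarrow> (nat \<times> nat) set" where
  "band_indices p n d = {(j, k). j \<le> k \<and> k < n \<and> band_dist p n j k \<le> d}"

definition band_matrix :: "band_type \<Rightarrow> nat \<Rightarrow> nat \<Rightarrow> complex mat \<Rightarrow> bool" where
  "band_matrix p n d A \<longleftrightarrow>
     A \<in> carrier_mat n n \<and> (\<forall>j<n. \<forall>k<n. band_dist p n j k > d \<longrightarrow> A $$ (j, k) = 0)"

text \<open>
  Real matrices are represented as complex matrices with entries in \<open>\<real>\<close>. The measure \<open>D\<close>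
  on \<open>\<complex>\<close> is the common law of the entries; it is a parameter so that the same law can be
  used for all matrix sizes.
\<close>

definition real_symmetric_band_ensemble ::
    "band_type \<Rightarrow> nat \<Rightarrow> nat \<Rightarrow> complex measure \<Rightarrow> 'w measure \<Rightarrow> ('w \<Rightarrow> complex mat) \<Rightarrow> bool" where
  "real_symmetric_band_ensemble p n d D M A \<longleftrightarrow>
     prob_space M \<and>
     (\<forall>\<omega>\<in>space M. band_matrix p n d (A \<omega>) \<and>
        (\<forall>j<n. \<forall>k<n. A \<omega> $$ (j, k) \<in> \<real>) \<and> transpose_mat (A \<omega>) = A \<omega>) \<and>
     prob_space.indep_vars M (\<lambda>_. borel) (\<lambda>(j, k) \<omega>. A \<omega> $$ (j, k)) (band_indices p n d) \<and>
     (\<forall>(j, k)\<in>band_indices p n d. distr M borel (\<lambda>\<omega>. A \<omega> $$ (j, k)) = D)"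

text \<open>
  \<open>D\<close> is the law of the off-diagonal entries and \<open>D\<^sub>0\<close> that of the diagonal entries, which
  are real because the matrix is self-adjoint.
\<close>

definition hermitian_band_ensemble ::
    "band_type \<Rightarrow> nat \<Rightarrow> nat \<Rightarrow> complex measure \<Rightarrow> complex measure \<Rightarrow>
     'w measure \<Rightarrow> ('w \<Rightarrow> complex mat) \<Rightarrow> bool" where
  "hermitian_band_ensemble p n d D D\<^sub>0 M A \<longleftrightarrow>
     prob_space M \<and>
     (\<forall>\<omega>\<in>space M. band_matrix p n d (A \<omega>) \<and> mat_adjoint (A \<omega>) = A \<omega>) \<and>
     prob_space.indep_vars M (\<lambda>_. borel) (\<lambda>(j, k) \<omega>. A \<omega> $$ (j, k)) (band_indices p n d) \<and>
     (\<forall>(j, k)\<in>band_indices p n d.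
        distr M borel (\<lambda>\<omega>. A \<omega> $$ (j, k)) = (if j = k then D\<^sub>0 else D))"

text \<open>
  Used only for matrices with real spectrum, so that \<open>Re\<close> loses nothing: the eigenvalues with
  algebraic multiplicity, in decreasing order.
\<close>

definition real_eigenvalues :: "complex mat \<Rightarrow> real list" where
  "real_eigenvalues A = rev (sorted_list_of_multiset (image_mset Re (proots (char_poly A))))"

definition eigenvalue_count :: "complex mat \<Rightarrow> real set \<Rightarrow> nat" where
  "eigenvalue_count A I = card {i. i < length (real_eigenvalues A) \<and> real_eigenvalues A ! i \<in> I}"

end

theory Submission
  imports Defs
begin

text \<open>Write \<open>B = b\<^sub>n\<^sup>-\<^sup>1 A\<close>. Since \<open>N\<^sub>n G(b\<^sub>n t) \<rightarrow> t\<^sup>-\<^sup>\<alpha>\<close>, the expected number of independent entries of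
\<open>B\<close> of modulus above a fixed level stays bounded, and with probability tending to \<open>1\<close> these entries are
off the diagonal and no two of them share a row. The matrix \<open>L\<close> of these large entries is then a weighted
matching: each pair \<open>j < k\<close> with a large entry \<open>z\<close> contributes the block with eigenvalues
\<open>\<plusminus>\<bar>z\<bar>\<close>. The remaining matrix has small norm, so the positive eigenvalues of \<open>B\<close> follow the moduli of
its large entries above the diagonal. The number of these moduli in disjoint intervals is multinomial
and converges to independent Poisson variables.\<close>

text \<open>The deterministic part is \<open>dominant_matching\<close>: if \<open>B\<close> has no diagonal entry above \<open>\<epsilon>\<close>, at
most one entry above \<open>\<epsilon>\<close> in each row, and absolute row sums of the entries up to \<open>\<epsilon>\<close> of at
most \<open>\<delta>\<close>, then the number of eigenvalues above \<open>t\<close> equals the number of entries above the diagonal of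
modulus above \<open>t\<close>, up to a shift of \<open>t\<close> by \<open>\<delta>\<close>. It follows from a variational count
(\<open>eigenvalue_count_greater_le\<close>, \<open>eigenvalue_count_less_le\<close>), which rests on the unitary
diagonalization of Hermitian matrices. The same count gives Weyl's perturbation bound, and through it
the measurability of eigenvalue counts.\<close>

text \<open>The condition \<open>\<alpha> < 2\<close> enters in the bound on the row sums. For \<open>q < \<alpha>\<close> and \<open>q \<le> 1\<close> a truncated entry of
\<open>B\<close> has mean \<open>O(b\<^sub>n\<^sup>-\<^sup>q)\<close>, and \<open>b\<^sub>n\<close> is at least \<open>N\<^sub>n\<close> to a power close to \<open>1 / \<alpha>\<close>. As \<open>\<alpha> < 2\<close>, the number
\<open>q\<close> can be chosen so that the mean of a whole truncated row is \<open>O(n\<^sup>-\<^sup>\<kappa>)\<close> with \<open>\<kappa> > 0\<close>. No centring is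
needed. A Chernoff bound with parameter \<open>2 ln n / \<delta>\<close> then makes each row sum smaller than
\<open>\<delta>\<close> with probability \<open>1 - O(n\<^sup>-\<^sup>2)\<close>, provided that \<open>\<epsilon>\<close> is small compared with \<open>\<delta>\<close>, and a union
bound over the \<open>n\<close> rows suffices. The condition \<open>d\<^sub>n \<rightarrow> \<infinity>\<close> makes the \<open>n\<close> diagonal entries a
vanishing fraction of all \<open>N\<^sub>n\<close>; otherwise large diagonal entries, each of which produces a single
eigenvalue with the sign of the entry, would be visible in the limit.\<close>

section \<open>Unitary diagonalization of Hermitian matrices\<close>

text \<open>The conjugate transpose, given by its entries.\<close>

definition ctranspose :: "complex mat \<Rightarrow> complex mat" where
  "ctranspose U = mat (dim_col U) (dim_row U) (\<lambda>(i, j). cnj (U $$ (j, i)))"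

lemma ctranspose_carrier [simp]: "U \<in> carrier_mat n m \<Longrightarrow> ctranspose U \<in> carrier_mat m n"
  by (auto simp: ctranspose_def)

lemma ctranspose_index [simp]:
  "U \<in> carrier_mat n m \<Longrightarrow> i < m \<Longrightarrow> j < n \<Longrightarrow> ctranspose U $$ (i, j) = cnj (U $$ (j, i))"
  by (auto simp: ctranspose_def)

lemma index_mult_mat_sum:
  assumes "P \<in> carrier_mat n m" "Q \<in> carrier_mat m l" "i < n" "j < l"
  shows "(P * Q) $$ (i, j) = (\<Sum>k<m. P $$ (i, k) * Q $$ (k, j))"
  using assms by (auto simp: scalar_prod_def lessThan_atLeast0 intro!: sum.cong)

lemma ctranspose_mult:
  assumes "P \<in> carrier_mat n m" "Q \<in> carrier_mat m l"
  shows "ctranspose (P * Q) = ctranspose Q * ctranspose P"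
proof (rule eq_matI)
  have PQ: "P * Q \<in> carrier_mat n l" using assms by auto
  fix i j assume "i < dim_row (ctranspose Q * ctranspose P)" "j < dim_col (ctranspose Q * ctranspose P)"
  hence ij: "i < l" "j < n" using assms by (auto simp: ctranspose_def)
  have "ctranspose (P * Q) $$ (i, j) = cnj (\<Sum>k<m. P $$ (j, k) * Q $$ (k, i))"
    using ctranspose_index[OF PQ ij] index_mult_mat_sum[OF assms ij(2,1)] by simp
  also have "\<dots> = (\<Sum>k<m. ctranspose Q $$ (i, k) * ctranspose P $$ (k, j))"
    using assms ij by (simp add: mult.commute)
  also have "\<dots> = (ctranspose Q * ctranspose P) $$ (i, j)"
    using assms ij by (intro index_mult_mat_sum[symmetric]) auto
  finally show "ctranspose (P * Q) $$ (i, j) = (ctranspose Q * ctranspose P) $$ (i, j)" .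
qed (use assms in \<open>auto simp: ctranspose_def\<close>)

lemma cmod_sq: "complex_of_real ((cmod z)\<^sup>2) = z * cnj z"
  by (metis complex_norm_square of_real_power)

text \<open>A Householder reflection \<open>1 - c w w\<^sup>*\<close> that exchanges the first basis vector and the unit vector
\<open>v\<close>, with \<open>w = v - e\<^sub>0\<close>. The first coordinate of \<open>v\<close> has to be real.\<close>

lemma householder:
  fixes v :: "nat \<Rightarrow> complex"
  assumes n: "n > 0" and v1: "(\<Sum>i<n. (cmod (v i))\<^sup>2) = 1" and v0: "v 0 \<in> \<real>"
  shows "\<exists>H \<in> carrier_mat n n. ctranspose H = H \<and> H * H = 1\<^sub>m n \<and> (\<forall>i<n. H $$ (i, 0) = v i)"
proof -
  define w where "w i = v i - (if i = 0 then 1 else 0)" for i :: nat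
  define s where "s = (\<Sum>i<n. (cmod (w i))\<^sup>2)"
  \<comment> \<open>for \<open>s = 0\<close> the vector \<open>w\<close> vanishes and the reflection is the identity\<close>
  define c :: complex where "c = (if s = 0 then 0 else of_real (2 / s))"
  define H where "H = mat n n (\<lambda>(i, j). (if i = j then 1 else 0) - c * w i * cnj (w j))"
  obtain r where r: "v 0 = of_real r" using v0 by (auto elim: Reals_cases)
  have s_eq: "s = 2 - 2 * r"
  proof -
    obtain m where m: "n = Suc m" using n by (cases n) auto
    have r1: "cmod (of_real r - 1) = \<bar>r - 1\<bar>"
      by (metis norm_of_real of_real_1 of_real_diff)
    have "s = (r - 1)\<^sup>2 + (\<Sum>i<m. (cmod (v (Suc i)))\<^sup>2)"
      unfolding s_def m sum.lessThan_Suc_shift w_def r by (simp add: r1)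
    moreover have "1 = r\<^sup>2 + (\<Sum>i<m. (cmod (v (Suc i)))\<^sup>2)"
      using v1 unfolding m sum.lessThan_Suc_shift r by simp
    ultimately show ?thesis by (simp add: power2_eq_square algebra_simps)
  qed
  have ww: "(\<Sum>k<n. cnj (w k) * w k) = of_real s"
    unfolding s_def of_real_sum cmod_sq by (simp add: mult.commute)
  have cc: "cnj c = c" by (simp add: c_def)
  have w0: "w i = 0" if "s = 0" "i < n" for i
    using that unfolding s_def by (subst (asm) sum_nonneg_eq_0_iff) auto
  have Hc: "H \<in> carrier_mat n n" by (simp add: H_def)
  moreover have "ctranspose H = H"
    by (rule eq_matI) (auto simp: H_def ctranspose_def cc)
  moreover have "H * H = 1\<^sub>m n"
  proof (rule eq_matI)
    fix i j assume "i < dim_row (1\<^sub>m n :: complex mat)" "j < dim_col (1\<^sub>m n :: complex mat)"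
    hence ij: "i < n" "j < n" by auto
    have "(H * H) $$ (i, j) = (\<Sum>k<n. H $$ (i, k) * H $$ (k, j))"
      using index_mult_mat_sum[OF Hc Hc ij] .
    also have "\<dots> = (\<Sum>k<n. (if i = k then if k = j then 1 else 0 else 0)
        - (if i = k then c * w k * cnj (w j) else 0) - (if k = j then c * w i * cnj (w k) else 0)
        + c * c * w i * cnj (w j) * (cnj (w k) * w k))"
      using ij by (intro sum.cong) (auto simp: H_def algebra_simps)
    also have "\<dots> = (if i = j then 1 else 0) - 2 * (c * w i * cnj (w j)) + c * c * w i * cnj (w j) * of_real s"
      using ij by (simp add: sum.distrib sum_subtractf flip: sum_distrib_left ww)
    also have "\<dots> = (if i = j then 1 else 0)"
      by (auto simp: c_def w0[OF _ ij(1)])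
    finally show "(H * H) $$ (i, j) = 1\<^sub>m n $$ (i, j)" using ij by simp
  qed (use Hc in auto)
  moreover have "H $$ (i, 0) = v i" if i: "i < n" for i
  proof (cases "s = 0")
    case True
    with w0[OF True i] show ?thesis using i by (auto simp: H_def c_def w_def split: if_splits)
  next
    case False
    have "c * cnj (w 0) = -1"
    proof -
      have "of_real 2 * (of_real (r - 1)) = - complex_of_real s"
        unfolding s_eq by (simp add: algebra_simps)
      thus ?thesis using False by (simp add: c_def w_def r field_simps)
    qed
    hence "c * w i * cnj (w 0) = - w i" by (metis mult.commute mult.left_commute mult_minus1)
    thus ?thesis using i by (simp add: H_def w_def)
  qed
  ultimately show ?thesis by blast
qed

text \<open>Induction on the dimension: conjugating with the reflection that takes \<open>e\<^sub>0\<close> to a unit eigenvector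
splits off a \<open>1 \<times> 1\<close> block, because the conjugated matrix is again Hermitian.\<close>

theorem hermitian_diagonalization:
  "A \<in> carrier_mat n n \<Longrightarrow> ctranspose A = A \<Longrightarrow>
    \<exists>U (l :: nat \<Rightarrow> real). U \<in> carrier_mat n n \<and> ctranspose U * U = 1\<^sub>m n \<and>
      A * U = U * mat n n (\<lambda>(i, j). if i = j then of_real (l i) else 0)"
proof (induction n arbitrary: A)
  case 0
  show ?case by (intro exI[of _ "1\<^sub>m 0"] exI[of _ "\<lambda>_. 0"] conjI eq_matI) (use 0 in \<open>auto simp: ctranspose_def\<close>)
next
  case (Suc m)
  let ?n = "Suc m"
  note A = Suc.prems(1)
  have "degree (char_poly A) = ?n" using degree_monic_char_poly[OF A] by simp
  hence "\<not> constant (poly (char_poly A))" by (simp add: constant_degree)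
  then obtain e where e: "poly (char_poly A) e = 0" using fundamental_theorem_of_algebra by blast
  then obtain v0 where v0: "eigenvector A v0 e"
    using eigenvalue_root_char_poly[OF A] unfolding eigenvalue_def by blast
  hence v0c: "v0 \<in> carrier_vec ?n" "v0 \<noteq> 0\<^sub>v ?n" "A *\<^sub>v v0 = e \<cdot>\<^sub>v v0"
    using A by (auto simp: eigenvector_def)
  have v0e: "(\<Sum>k<?n. A $$ (i, k) * v0 $ k) = e * v0 $ i" if "i < ?n" for i
  proof -
    have "(A *\<^sub>v v0) $ i = e * v0 $ i" using that v0c by simp
    thus ?thesis using that A v0c(1)
      by (simp add: scalar_prod_def lessThan_atLeast0 del: sum.op_ivl_Suc)
  qed
  define N where "N = (\<Sum>k<?n. (cmod (v0 $ k))\<^sup>2)"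
  have "N > 0"
  proof -
    obtain k where k: "k < ?n" "v0 $ k \<noteq> 0"
      using v0c by (metis carrier_vecD eq_vecI index_zero_vec)
    have "0 < (cmod (v0 $ k))\<^sup>2" using k by simp
    also have "\<dots> \<le> N" unfolding N_def using k by (intro member_le_sum) auto
    finally show ?thesis .
  qed
  \<comment> \<open>normalization to a unit vector, with a phase that makes the first coordinate real\<close>
  define c :: complex where
    "c = (if v0 $ 0 = 0 then 1 else cnj (v0 $ 0) / cmod (v0 $ 0)) / of_real (sqrt N)"
  have cN: "(cmod c)\<^sup>2 = 1 / N"
    using \<open>N > 0\<close> by (auto simp: c_def norm_divide power_divide)
  define v where "v k = c * v0 $ k" for k
  have v1: "(\<Sum>i<?n. (cmod (v i))\<^sup>2) = 1"
    unfolding v_def norm_mult power_mult_distrib cN using \<open>N > 0\<close>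
    by (simp del: sum.lessThan_Suc flip: sum_divide_distrib N_def)
  have "v 0 = of_real (cmod (v0 $ 0) / sqrt N)"
    by (auto simp: v_def c_def divide_simps power2_eq_square mult.commute
      simp flip: of_real_mult complex_norm_square)
  hence vR: "v 0 \<in> \<real>" by (metis Reals_of_real)
  from householder[OF _ v1 vR] obtain H where H: "H \<in> carrier_mat ?n ?n" "ctranspose H = H"
    "H * H = 1\<^sub>m ?n" "\<And>i. i < ?n \<Longrightarrow> H $$ (i, 0) = v i" by blast
  have AH: "A * H \<in> carrier_mat ?n ?n" using A H by auto
  define A' where "A' = H * (A * H)"
  have A'c: "A' \<in> carrier_mat ?n ?n" using AH H by (auto simp: A'_def)
  have A'h: "ctranspose A' = A'"
    unfolding A'_def using A H(1,2) Suc.prems(2)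
    by (simp add: ctranspose_mult[OF H(1) AH] ctranspose_mult[OF A H(1)] assoc_mult_mat[of _ ?n ?n _ ?n _ ?n])
  have AH0: "(A * H) $$ (i, 0) = e * H $$ (i, 0)" if "i < ?n" for i
  proof -
    have "(A * H) $$ (i, 0) = (\<Sum>k<?n. A $$ (i, k) * (c * v0 $ k))"
      using that by (subst index_mult_mat_sum[OF A H(1)]) (auto simp: H(4) v_def)
    also have "\<dots> = c * (\<Sum>k<?n. A $$ (i, k) * v0 $ k)"
      unfolding sum_distrib_left by (intro sum.cong) auto
    also have "\<dots> = e * H $$ (i, 0)" using that by (simp only: v0e[OF that] H(4) v_def) simp
    finally show ?thesis .
  qed
  have A'0: "A' $$ (i, 0) = (if i = 0 then e else 0)" if "i < ?n" for i
  proof -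
    have "A' $$ (i, 0) = (\<Sum>k<?n. H $$ (i, k) * (e * H $$ (k, 0)))"
      unfolding A'_def using that by (subst index_mult_mat_sum[OF H(1) AH]) (auto simp: AH0)
    also have "\<dots> = e * (\<Sum>k<?n. H $$ (i, k) * H $$ (k, 0))"
      unfolding sum_distrib_left by (intro sum.cong) auto
    also have "(\<Sum>k<?n. H $$ (i, k) * H $$ (k, 0)) = (H * H) $$ (i, 0)"
      using that by (intro index_mult_mat_sum[OF H(1) H(1), symmetric]) auto
    finally show ?thesis using that by (simp add: H(3))
  qed
  have A'sym: "A' $$ (i, j) = cnj (A' $$ (j, i))" if "i < ?n" "j < ?n" for i j
    using ctranspose_index[OF A'c that] A'h by simp
  have "e = cnj e" using A'0[of 0] A'sym[of 0 0] by simp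
  then obtain r where r: "e = of_real r" by (metis Reals_cases Reals_cnj_iff)
  have A'0': "A' $$ (0, j) = (if j = 0 then e else 0)" if "j < ?n" for j
    using A'sym[of 0 j] A'0[OF that] that \<open>e = cnj e\<close> by auto
  define A3 where "A3 = mat m m (\<lambda>(i, j). A' $$ (Suc i, Suc j))"
  have "A3 \<in> carrier_mat m m" "ctranspose A3 = A3"
    subgoal by (simp add: A3_def)
    subgoal
    proof (rule eq_matI)
      fix i j assume "i < dim_row A3" "j < dim_col A3"
      thus "ctranspose A3 $$ (i, j) = A3 $$ (i, j)"
        using A'sym[of "Suc i" "Suc j"] by (simp add: A3_def ctranspose_def)
    qed (simp_all add: A3_def ctranspose_def)
    done
  from Suc.IH[OF this] obtain U3 l3 where U3: "U3 \<in> carrier_mat m m" "ctranspose U3 * U3 = 1\<^sub>m m"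
    and l3: "A3 * U3 = U3 * mat m m (\<lambda>(i, j). if i = j then complex_of_real (l3 i) else 0)" by blast
  define l where "l i = (if i = 0 then r else l3 (i - 1))" for i
  define U1 where "U1 = mat ?n ?n (\<lambda>(i, j). if i = 0 then if j = 0 then 1 else 0
     else if j = 0 then 0 else U3 $$ (i - 1, j - 1))"
  let ?D = "mat ?n ?n (\<lambda>(i, j). if i = j then complex_of_real (l i) else 0)"
  have U1c: "U1 \<in> carrier_mat ?n ?n" by (simp add: U1_def)
  have U1u: "ctranspose U1 * U1 = 1\<^sub>m ?n"
  proof (rule eq_matI)
    fix i j assume "i < dim_row (1\<^sub>m ?n :: complex mat)" "j < dim_col (1\<^sub>m ?n :: complex mat)"
    hence ij: "i < ?n" "j < ?n" by auto
    have *: "(\<Sum>k<m. cnj (U3 $$ (k, i')) * U3 $$ (k, j')) = (if i' = j' then 1 else 0)"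
      if "i' < m" "j' < m" for i' j'
    proof -
      have "(ctranspose U3 * U3) $$ (i', j') = (if i' = j' then 1 else 0)" using that U3 by simp
      thus ?thesis using that U3 by (subst (asm) index_mult_mat_sum[of _ m m _ m]) auto
    qed
    have "(ctranspose U1 * U1) $$ (i, j) = (\<Sum>k<?n. cnj (U1 $$ (k, i)) * U1 $$ (k, j))"
      using ij U1c by (subst index_mult_mat_sum[of _ ?n ?n _ ?n]) auto
    also have "\<dots> = 1\<^sub>m ?n $$ (i, j)"
      using ij *[of "i - 1" "j - 1"] unfolding sum.lessThan_Suc_shift
      by (cases i; cases j) (auto simp: U1_def)
    finally show "(ctranspose U1 * U1) $$ (i, j) = 1\<^sub>m ?n $$ (i, j)" .
  qed (use U1c in \<open>auto simp: ctranspose_def\<close>)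
  have U1d: "A' * U1 = U1 * ?D"
  proof (rule eq_matI)
    fix i j assume "i < dim_row (U1 * ?D)" "j < dim_col (U1 * ?D)"
    hence ij: "i < ?n" "j < ?n" using U1c by auto
    have *: "(\<Sum>k<m. A' $$ (Suc i', Suc k) * U3 $$ (k, j')) = U3 $$ (i', j') * of_real (l3 j')"
      if "i' < m" "j' < m" for i' j'
    proof -
      have "(\<Sum>k<m. A' $$ (Suc i', Suc k) * U3 $$ (k, j')) = (A3 * U3) $$ (i', j')"
        using that U3 by (subst index_mult_mat_sum[of _ m m _ m]) (auto simp: A3_def)
      also have "\<dots> = (\<Sum>k<m. U3 $$ (i', k) * (if k = j' then of_real (l3 k) else 0))"
        unfolding l3 using that U3 by (subst index_mult_mat_sum[of _ m m _ m]) auto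
      also have "\<dots> = U3 $$ (i', j') * of_real (l3 j')"
        using that by (simp add: if_distrib[of "\<lambda>x. _ * x"] cong: if_cong)
      finally show ?thesis .
    qed
    have "(A' * U1) $$ (i, j) = (\<Sum>k<?n. A' $$ (i, k) * U1 $$ (k, j))"
      using ij U1c A'c by (subst index_mult_mat_sum[of _ ?n ?n _ ?n]) auto
    also have "\<dots> = U1 $$ (i, j) * of_real (l j)"
      unfolding sum.lessThan_Suc_shift using ij *[of "i - 1" "j - 1"] A'0[OF ij(1)] A'0'
      by (cases i; cases j) (auto simp: U1_def l_def r)
    also have "\<dots> = (\<Sum>k<?n. U1 $$ (i, k) * (if k = j then of_real (l k) else 0))"
      using ij by (simp add: if_distrib[of "\<lambda>x. _ * x"] cong: if_cong del: sum.lessThan_Suc)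
    also have "\<dots> = (U1 * ?D) $$ (i, j)"
      using ij U1c by (subst index_mult_mat_sum[of _ ?n ?n _ ?n]) auto
    finally show "(A' * U1) $$ (i, j) = (U1 * ?D) $$ (i, j)" .
  qed (use U1c A'c in auto)
  define U where "U = H * U1"
  have Dc: "?D \<in> carrier_mat ?n ?n" by simp
  have Uc: "U \<in> carrier_mat ?n ?n" using H U1c by (auto simp: U_def)
  have "ctranspose U * U = ctranspose U1 * (H * (H * U1))"
    unfolding U_def using H(1,2) U1c
    by (simp add: ctranspose_mult[OF H(1) U1c] assoc_mult_mat[of _ ?n ?n _ ?n _ ?n])
  also have "H * (H * U1) = U1"
    using H U1c by (simp flip: assoc_mult_mat[of _ ?n ?n _ ?n _ ?n])
  finally have 1: "ctranspose U * U = 1\<^sub>m ?n" using U1u by simp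
  have "H * (A' * U1) = (H * H) * (A * (H * U1))"
    unfolding A'_def using H(1) A U1c by (simp add: assoc_mult_mat[of _ ?n ?n _ ?n _ ?n])
  hence "A * U = H * (A' * U1)" using H(3) A Uc by (simp add: U_def)
  also have "\<dots> = U * ?D" unfolding U1d U_def
    using H(1) U1c Dc by (simp add: assoc_mult_mat[of _ ?n ?n _ ?n _ ?n])
  finally show ?case using 1 Uc by blast
qed

section \<open>Eigenvalue counts and the quadratic form\<close>

text \<open>Hermitian matrices of size \<open>n\<close>, in terms of their entries.\<close>

definition hermitian_mat :: "nat \<Rightarrow> complex mat \<Rightarrow> bool" where
  "hermitian_mat n A \<longleftrightarrow> A \<in> carrier_mat n n \<and> (\<forall>i<n. \<forall>j<n. A $$ (j, i) = cnj (A $$ (i, j)))"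

text \<open>The quadratic form \<open>v\<^sup>* A v\<close> (its real part, which is all of it for Hermitian \<open>A\<close>) and the squared
Euclidean norm. Vectors are functions on \<open>nat\<close>, of which only the values below \<open>n\<close> matter.\<close>

definition herm_form :: "nat \<Rightarrow> complex mat \<Rightarrow> (nat \<Rightarrow> complex) \<Rightarrow> real" where
  "herm_form n A v = (\<Sum>i<n. \<Sum>j<n. Re (cnj (v i) * A $$ (i, j) * v j))"

definition sq_norm_upto :: "nat \<Rightarrow> (nat \<Rightarrow> complex) \<Rightarrow> real" where
  "sq_norm_upto n v = (\<Sum>i<n. (cmod (v i))\<^sup>2)"

lemma eigenvalue_count_mset:
  "eigenvalue_count A I = size {#x \<in># image_mset Re (proots (char_poly A)). x \<in> I#}"
proof -
  have "eigenvalue_count A I = length (filter (\<lambda>x. x \<in> I) (real_eigenvalues A))"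
    unfolding eigenvalue_count_def length_filter_conv_card by simp
  also have "\<dots> = size (mset (filter (\<lambda>x. x \<in> I) (real_eigenvalues A)))" by (simp only: size_mset)
  also have "\<dots> = size {#x \<in># mset (real_eigenvalues A). x \<in> I#}" by (simp only: mset_filter)
  also have "mset (real_eigenvalues A) = image_mset Re (proots (char_poly A))"
    by (simp add: real_eigenvalues_def)
  finally show ?thesis .
qed

lemma size_mset_filter_upt: "size {#k \<in># mset [0..<n]. P k#} = card {k. k < n \<and> P k}"
proof -
  have "size {#k \<in># mset [0..<n]. P k#} = length (filter P [0..<n])"
    by (metis mset_filter size_mset)
  also have "\<dots> = card {k. k < n \<and> P k}"
    unfolding length_filter_conv_card by (intro arg_cong[of _ _ card]) auto
  finally show ?thesis .
qed

text \<open>Spectral theorem in coordinates: \<open>\<Sum>i<n. U i k * v i\<close> is the \<open>k\<close>-th coordinate of \<open>v\<close> in an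
orthonormal eigenbasis.\<close>

lemma hermitian_form_diagonalization:
  assumes A: "hermitian_mat n A"
  obtains U and l :: "nat \<Rightarrow> real" where
    "\<And>I. eigenvalue_count A I = card {k. k < n \<and> l k \<in> I}"
    "\<And>v. herm_form n A v = (\<Sum>k<n. l k * (cmod (\<Sum>i<n. U i k * v i))\<^sup>2)"
    "\<And>v. sq_norm_upto n v = (\<Sum>k<n. (cmod (\<Sum>i<n. U i k * v i))\<^sup>2)"
proof -
  have Ac: "A \<in> carrier_mat n n" using A by (simp add: hermitian_mat_def)
  have Ah: "ctranspose A = A"
  proof (rule eq_matI)
    fix i j assume "i < dim_row A" "j < dim_col A"
    hence "i < n" "j < n" using Ac by auto
    thus "ctranspose A $$ (i, j) = A $$ (i, j)"
      using A Ac by (metis complex_cnj_cnj ctranspose_index hermitian_mat_def)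
  qed (use Ac in \<open>auto simp: ctranspose_def\<close>)
  obtain U l where U: "U \<in> carrier_mat n n" "ctranspose U * U = 1\<^sub>m n"
    and AU: "A * U = U * mat n n (\<lambda>(i, j). if i = j then complex_of_real (l i) else 0)"
    using hermitian_diagonalization[OF Ac Ah] by blast
  define D where "D = mat n n (\<lambda>(i, j). if i = j then complex_of_real (l i) else 0)"
  have Uc: "ctranspose U \<in> carrier_mat n n" using U by simp
  have Dc: "D \<in> carrier_mat n n" by (simp add: D_def)
  have UU: "U * ctranspose U = 1\<^sub>m n" using mat_mult_left_right_inverse[OF Uc U(1) U(2)] .
  have "A = A * (U * ctranspose U)" using UU Ac by simp
  also have "\<dots> = U * D * ctranspose U" using AU Ac U Uc unfolding D_def[symmetric]
    by (metis assoc_mult_mat)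
  finally have "similar_mat_wit A D U (ctranspose U)"
    using U Uc UU Ac Dc by (intro similar_mat_witI[of _ _ n])
  hence "similar_mat A D" unfolding similar_mat_def by blast
  hence "char_poly A = char_poly D" by (rule char_poly_similar)
  also have "\<dots> = (\<Prod>a\<leftarrow>diag_mat D. [:- a, 1:])"
    by (rule char_poly_upper_triangular[OF Dc]) (auto simp: D_def)
  also have "diag_mat D = map (\<lambda>i. complex_of_real (l i)) [0..<n]"
    by (auto simp: diag_mat_def D_def)
  finally have cp: "char_poly A = (\<Prod>i\<leftarrow>[0..<n]. [:- complex_of_real (l i), 1:])"
    by (simp add: o_def)
  have "proots (\<Prod>i\<leftarrow>xs. [:- complex_of_real (l i), 1:]) = image_mset (\<lambda>i. complex_of_real (l i)) (mset xs)" for xs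
  proof (induction xs)
    case (Cons a xs)
    have "(\<Prod>i\<leftarrow>xs. [:- complex_of_real (l i), 1:]) \<noteq> 0" by (auto simp: prod_list_zero_iff)
    thus ?case using Cons by (simp add: proots_mult del: mult_pCons_left)
  qed simp
  hence "image_mset Re (proots (char_poly A)) = image_mset l (mset [0..<n])"
    unfolding cp by (simp add: image_mset.compositionality o_def)
  hence 1: "eigenvalue_count A I = card {k. k < n \<and> l k \<in> I}" for I
    unfolding eigenvalue_count_mset
    by (simp add: filter_mset_image_mset size_mset_filter_upt)
  \<comment> \<open>the \<open>k\<close>-th coordinate of \<open>v\<close> in the eigenbasis\<close>
  define y where "y v k = (\<Sum>i<n. cnj (U $$ (i, k)) * v i)" for v k
  have v: "v i = (\<Sum>k<n. U $$ (i, k) * y v k)" if "i < n" for v i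
  proof -
    have "(\<Sum>k<n. U $$ (i, k) * y v k) = (\<Sum>k<n. \<Sum>j<n. U $$ (i, k) * (cnj (U $$ (j, k)) * v j))"
      unfolding y_def sum_distrib_left ..
    also have "\<dots> = (\<Sum>j<n. (\<Sum>k<n. U $$ (i, k) * ctranspose U $$ (k, j)) * v j)"
      using U(1) that by (subst sum.swap) (auto simp: sum_distrib_right mult.assoc intro!: sum.cong)
    also have "\<dots> = (\<Sum>j<n. (if i = j then v j else 0))"
      by (intro sum.cong refl, subst index_mult_mat_sum[OF U(1) Uc that, symmetric]) (auto simp: UU that)
    also have "\<dots> = v i" using that by simp
    finally show ?thesis by simp
  qed
  have Av: "(\<Sum>j<n. A $$ (i, j) * v j) = (\<Sum>k<n. U $$ (i, k) * (l k * y v k))" if "i < n" for v i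
  proof -
    have "(\<Sum>j<n. A $$ (i, j) * v j) = (\<Sum>j<n. \<Sum>k<n. A $$ (i, j) * (U $$ (j, k) * y v k))"
      unfolding sum_distrib_left[symmetric] by (intro sum.cong refl) (simp flip: v)
    also have "\<dots> = (\<Sum>k<n. (\<Sum>j<n. A $$ (i, j) * U $$ (j, k)) * y v k)"
      by (subst sum.swap) (auto simp: sum_distrib_right mult.assoc intro!: sum.cong)
    also have "\<dots> = (\<Sum>k<n. (U * D) $$ (i, k) * y v k)"
      by (intro sum.cong refl, subst index_mult_mat_sum[OF Ac U(1) that, symmetric]) (auto simp: AU D_def)
    also have "\<dots> = (\<Sum>k<n. (\<Sum>j<n. if j = k then U $$ (i, j) * l j else 0) * y v k)"
      by (intro sum.cong refl, subst index_mult_mat_sum[OF U(1) Dc that]) (auto simp: D_def mult_delta_right)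
    also have "\<dots> = (\<Sum>k<n. U $$ (i, k) * (l k * y v k))" by (intro sum.cong) auto
    finally show ?thesis .
  qed
  have main: "(\<Sum>i<n. cnj (v i) * (\<Sum>k<n. U $$ (i, k) * (c k * y v k))) =
      of_real (\<Sum>k<n. c k * (cmod (y v k))\<^sup>2)" for v and c :: "nat \<Rightarrow> real"
  proof -
    have "(\<Sum>i<n. cnj (v i) * (\<Sum>k<n. U $$ (i, k) * (c k * y v k))) =
        (\<Sum>k<n. c k * y v k * cnj (y v k))"
    proof -
      have "cnj (y v k) = (\<Sum>i<n. U $$ (i, k) * cnj (v i))" for k by (simp add: y_def)
      thus ?thesis
        by (simp only: sum_distrib_left, subst sum.swap) (simp add: sum_distrib_left mult_ac)
    qed
    also have "\<dots> = of_real (\<Sum>k<n. c k * (cmod (y v k))\<^sup>2)"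
      unfolding of_real_sum of_real_mult cmod_sq by (simp add: algebra_simps)
    finally show ?thesis .
  qed
  have 2: "herm_form n A v = (\<Sum>k<n. l k * (cmod (y v k))\<^sup>2)" for v
  proof -
    have "herm_form n A v = Re (\<Sum>i<n. cnj (v i) * (\<Sum>j<n. A $$ (i, j) * v j))"
      unfolding herm_form_def Re_sum sum_distrib_left by (simp add: mult.assoc)
    also have "(\<Sum>i<n. cnj (v i) * (\<Sum>j<n. A $$ (i, j) * v j)) =
        (\<Sum>i<n. cnj (v i) * (\<Sum>k<n. U $$ (i, k) * (l k * y v k)))"
      by (intro sum.cong refl) (simp add: Av)
    also have "\<dots> = of_real (\<Sum>k<n. l k * (cmod (y v k))\<^sup>2)" by (rule main)
    also have "Re \<dots> = (\<Sum>k<n. l k * (cmod (y v k))\<^sup>2)" by (rule Re_complex_of_real)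
    finally show ?thesis .
  qed
  have 3: "sq_norm_upto n v = (\<Sum>k<n. (cmod (y v k))\<^sup>2)" for v
  proof -
    have "complex_of_real (sq_norm_upto n v) = (\<Sum>i<n. cnj (v i) * v i)"
      unfolding sq_norm_upto_def of_real_sum cmod_sq by (simp add: mult.commute)
    also have "\<dots> = (\<Sum>i<n. cnj (v i) * (\<Sum>k<n. U $$ (i, k) * (of_real 1 * y v k)))"
      by (intro sum.cong refl) (simp flip: v)
    also have "\<dots> = of_real (\<Sum>k<n. (cmod (y v k))\<^sup>2)"
      using main[of v "\<lambda>_. 1"] by simp
    finally show ?thesis by (simp only: of_real_eq_iff)
  qed
  show ?thesis
    by (rule that[of l "\<lambda>i k. cnj (U $$ (i, k))"]) (use 1 2 3 in \<open>simp_all add: y_def\<close>)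
qed

lemma underdetermined_system:
  fixes f :: "'a \<Rightarrow> nat \<Rightarrow> complex"
  assumes R: "finite R" "card R < n"
  obtains v where "\<exists>i<n. v i \<noteq> 0" "\<And>r. r \<in> R \<Longrightarrow> (\<Sum>i<n. f r i * v i) = 0"
proof -
  obtain e where e: "bij_betw e {0..<card R} R" using ex_bij_betw_nat_finite[OF R(1)] by blast
  \<comment> \<open>the equations are completed by zero rows to a singular square system\<close>
  define c where "c i = vec n (\<lambda>j. f (e i) j)" for i
  define B where "B = mat\<^sub>r n n (\<lambda>i. if i = card R then 0\<^sub>v n else c i)"
  have Bc: "B \<in> carrier_mat n n" by (simp add: B_def)
  have "det B = 0" unfolding B_def using R by (intro det_row_0) (auto simp: c_def)
  then obtain v where v: "v \<in> carrier_vec n" "v \<noteq> 0\<^sub>v n" "B *\<^sub>v v = 0\<^sub>v n"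
    using det_0_iff_vec_prod_zero[OF Bc] by blast
  show ?thesis
  proof
    show "\<exists>i<n. v $ i \<noteq> 0" using v by (metis carrier_vecD eq_vecI index_zero_vec)
    fix r assume "r \<in> R"
    hence "r \<in> e ` {0..<card R}" using e by (simp add: bij_betw_def)
    then obtain i where i: "i < card R" "r = e i" by auto
    have "(B *\<^sub>v v) $ i = 0" using v i R by simp
    thus "(\<Sum>i<n. f r i * v $ i) = 0"
      using i R v by (simp add: B_def c_def scalar_prod_def lessThan_atLeast0)
  qed
qed

text \<open>Dimension count: fewer than \<open>eigenvalue_count A I\<close> linear equations leave a nonzero vector in
  the span of the eigenvectors with eigenvalue in \<open>I\<close>. The weight \<open>c k\<close> is the squared modulus of
  its \<open>k\<close>-th coordinate in an eigenbasis.\<close>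

lemma eigenspace_meets_kernel:
  fixes f :: "'a \<Rightarrow> nat \<Rightarrow> complex"
  assumes A: "hermitian_mat n A" and R: "finite R" "card R < eigenvalue_count A I"
  obtains v and l c :: "nat \<Rightarrow> real"
  where "\<And>r. r \<in> R \<Longrightarrow> (\<Sum>i<n. f r i * v i) = 0" "\<And>k. k < n \<Longrightarrow> c k \<ge> 0"
    "\<And>k. k < n \<Longrightarrow> c k \<noteq> 0 \<Longrightarrow> l k \<in> I" "\<exists>k<n. c k \<noteq> 0"
    "herm_form n A v = (\<Sum>k<n. l k * c k)" "sq_norm_upto n v = (\<Sum>k<n. c k)"
proof -
  obtain U l where U: "\<And>I. eigenvalue_count A I = card {k. k < n \<and> l k \<in> I}"
    "\<And>v. herm_form n A v = (\<Sum>k<n. l k * (cmod (\<Sum>i<n. U i k * v i))\<^sup>2)"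
    "\<And>v. sq_norm_upto n v = (\<Sum>k<n. (cmod (\<Sum>i<n. U i k * v i))\<^sup>2)"
    by (rule hermitian_form_diagonalization[OF A]) blast
  define S where "S = {k. k < n \<and> l k \<in> I}"
  have S: "S \<subseteq> {..<n}" by (auto simp: S_def)
  have cS: "card R < card S" using R(2) U(1)[of I] by (simp add: S_def)
  define R' where "R' = Inl ` R \<union> Inr ` ({..<n} - S)"
  define f' where "f' = (\<lambda>r i. case r of Inl a \<Rightarrow> f a i | Inr k \<Rightarrow> U i k)"
  have "card R' = card R + (n - card S)"
    unfolding R'_def using R S finite_subset[OF S]
    by (subst card_Un_disjoint) (auto simp: card_image card_Diff_subset)
  moreover have "card S \<le> n" using card_mono[OF _ S] by simp
  ultimately have "card R' < n" using cS by simp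
  moreover have "finite R'" using R by (simp add: R'_def)
  ultimately obtain v where v: "\<exists>i<n. v i \<noteq> 0" "\<And>r. r \<in> R' \<Longrightarrow> (\<Sum>i<n. f' r i * v i) = 0"
    using underdetermined_system[of R' n f'] by metis
  have vR: "(\<Sum>i<n. f r i * v i) = 0" if "r \<in> R" for r
    using v(2)[of "Inl r"] that by (simp add: R'_def f'_def)
  have vS: "(\<Sum>i<n. U i k * v i) = 0" if "k < n" "k \<notin> S" for k
    using v(2)[of "Inr k"] that by (simp add: R'_def f'_def)
  have "sq_norm_upto n v > 0"
    unfolding sq_norm_upto_def using v(1) by (auto intro: sum_pos2)
  hence "(\<Sum>k<n. (cmod (\<Sum>i<n. U i k * v i))\<^sup>2) \<noteq> 0" by (simp add: U(3))
  then obtain k where k: "k < n" "(cmod (\<Sum>i<n. U i k * v i))\<^sup>2 \<noteq> 0"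
    by (metis (no_types, lifting) lessThan_iff sum.neutral)
  show ?thesis
  proof (rule that[of v "\<lambda>k. (cmod (\<Sum>i<n. U i k * v i))\<^sup>2" l])
    show "l k \<in> I" if "k < n" "(cmod (\<Sum>i<n. U i k * v i))\<^sup>2 \<noteq> 0" for k
      using vS[of k] that by (auto simp: S_def)
  qed (use vR k U in auto)
qed

text \<open>If \<open>A \<le> t\<close> in the sense of quadratic forms on a subspace of codimension \<open>m\<close>, then at most
  \<open>m\<close> eigenvalues exceed \<open>t\<close>.\<close>

lemma eigenvalue_count_greater_le:
  fixes f :: "'a \<Rightarrow> nat \<Rightarrow> complex"
  assumes A: "hermitian_mat n A" and R: "finite R"
    and le: "\<And>v. (\<And>r. r \<in> R \<Longrightarrow> (\<Sum>i<n. f r i * v i) = 0) \<Longrightarrow> herm_form n A v \<le> t * sq_norm_upto n v"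
  shows "eigenvalue_count A {t<..} \<le> card R"
proof (rule ccontr)
  assume "\<not> ?thesis"
  hence less: "card R < eigenvalue_count A {t<..}" by simp
  obtain v l c where
    v: "\<And>r. r \<in> R \<Longrightarrow> (\<Sum>i<n. f r i * v i) = 0"
    and c: "\<And>k. k < n \<Longrightarrow> c k \<ge> 0" "\<And>k. k < n \<Longrightarrow> c k \<noteq> 0 \<Longrightarrow> l k \<in> {t<..}" "\<exists>k<n. c k \<noteq> 0"
    and form: "herm_form n A v = (\<Sum>k<n. l k * c k)" "sq_norm_upto n v = (\<Sum>k<n. c k)"
    by (rule eigenspace_meets_kernel[OF A R less, of f]) (rule that)
  have "0 < (l k - t) * c k" if "k < n" "c k \<noteq> 0" for k
    using c(1)[OF that(1)] c(2)[OF that] that(2) by simp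
  moreover have "0 \<le> (l k - t) * c k" if "k < n" for k
    using calculation[OF that] by (cases "c k = 0") auto
  ultimately have "0 < (\<Sum>k<n. (l k - t) * c k)" using c(3) by (auto intro: sum_pos2)
  also have "\<dots> = herm_form n A v - t * sq_norm_upto n v"
    unfolding form by (simp add: left_diff_distrib sum_subtractf sum_distrib_left)
  finally show False using le[OF v] by simp
qed

lemma eigenvalue_count_less_le:
  fixes f :: "'a \<Rightarrow> nat \<Rightarrow> complex"
  assumes A: "hermitian_mat n A" and R: "finite R"
    and ge: "\<And>v. (\<And>r. r \<in> R \<Longrightarrow> (\<Sum>i<n. f r i * v i) = 0) \<Longrightarrow> herm_form n A v \<ge> t * sq_norm_upto n v"
  shows "eigenvalue_count A {..<t} \<le> card R"
proof (rule ccontr)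
  assume "\<not> ?thesis"
  hence less: "card R < eigenvalue_count A {..<t}" by simp
  obtain v l c where
    v: "\<And>r. r \<in> R \<Longrightarrow> (\<Sum>i<n. f r i * v i) = 0"
    and c: "\<And>k. k < n \<Longrightarrow> c k \<ge> 0" "\<And>k. k < n \<Longrightarrow> c k \<noteq> 0 \<Longrightarrow> l k \<in> {..<t}" "\<exists>k<n. c k \<noteq> 0"
    and form: "herm_form n A v = (\<Sum>k<n. l k * c k)" "sq_norm_upto n v = (\<Sum>k<n. c k)"
    by (rule eigenspace_meets_kernel[OF A R less, of f]) (rule that)
  have "0 < (t - l k) * c k" if "k < n" "c k \<noteq> 0" for k
    using c(1)[OF that(1)] c(2)[OF that] that(2) by simp
  moreover have "0 \<le> (t - l k) * c k" if "k < n" for k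
    using calculation[OF that] by (cases "c k = 0") auto
  ultimately have "0 < (\<Sum>k<n. (t - l k) * c k)" using c(3) by (auto intro: sum_pos2)
  also have "\<dots> = t * sq_norm_upto n v - herm_form n A v"
    unfolding form by (simp add: left_diff_distrib sum_subtractf sum_distrib_left)
  finally show False using ge[OF v] by simp
qed

lemma eigenvalue_count_split:
  assumes "hermitian_mat n A"
  shows "eigenvalue_count A {..<t} + eigenvalue_count A {t..} = n"
proof -
  obtain U l where U: "\<And>I. eigenvalue_count A I = card {k. k < n \<and> l k \<in> I}"
    by (rule hermitian_form_diagonalization[OF assms]) blast
  have "card {k. k < n \<and> l k \<in> {..<t}} + card {k. k < n \<and> l k \<in> {t..}}
      = card ({k. k < n \<and> l k \<in> {..<t}} \<union> {k. k < n \<and> l k \<in> {t..}})"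
    by (rule card_Un_disjoint[symmetric]) auto
  also have "{k. k < n \<and> l k \<in> {..<t}} \<union> {k. k < n \<and> l k \<in> {t..}} = {..<n}" by auto
  finally show ?thesis by (simp add: U)
qed

section \<open>Perturbation, and matrices dominated by a matching\<close>

text \<open>Schur test: a symmetric nonnegative kernel has norm at most its largest row sum.\<close>

lemma sum_symmetric_kernel_le:
  fixes s :: "nat \<Rightarrow> nat \<Rightarrow> real"
  assumes s0: "\<And>i j. i < n \<Longrightarrow> j < n \<Longrightarrow> 0 \<le> s i j"
    and sym: "\<And>i j. i < n \<Longrightarrow> j < n \<Longrightarrow> s j i = s i j"
    and row: "\<And>i. i < n \<Longrightarrow> (\<Sum>j<n. s i j) \<le> \<delta>"
  shows "(\<Sum>i<n. \<Sum>j<n. s i j * (cmod (v i) * cmod (v j))) \<le> \<delta> * sq_norm_upto n v"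
proof -
  have "(\<Sum>i<n. \<Sum>j<n. s i j * (cmod (v i) * cmod (v j)))
      \<le> (\<Sum>i<n. \<Sum>j<n. s i j * ((cmod (v i))\<^sup>2 / 2) + s i j * ((cmod (v j))\<^sup>2 / 2))"
  proof (intro sum_mono)
    fix i j assume "i \<in> {..<n}" "j \<in> {..<n}"
    hence "0 \<le> s i j" using s0 by auto
    moreover have "cmod (v i) * cmod (v j) \<le> (cmod (v i))\<^sup>2 / 2 + (cmod (v j))\<^sup>2 / 2"
      using sum_squares_bound[of "cmod (v i)" "cmod (v j)"] by simp
    ultimately show "s i j * (cmod (v i) * cmod (v j))
        \<le> s i j * ((cmod (v i))\<^sup>2 / 2) + s i j * ((cmod (v j))\<^sup>2 / 2)"
      by (metis distrib_left mult_left_mono)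
  qed
  also have "\<dots> = (\<Sum>i<n. \<Sum>j<n. s i j * ((cmod (v i))\<^sup>2 / 2)) + (\<Sum>i<n. \<Sum>j<n. s i j * ((cmod (v j))\<^sup>2 / 2))"
    by (simp add: sum.distrib)
  also have "(\<Sum>i<n. \<Sum>j<n. s i j * ((cmod (v j))\<^sup>2 / 2)) = (\<Sum>j<n. \<Sum>i<n. s j i * ((cmod (v j))\<^sup>2 / 2))"
    by (subst sum.swap) (simp add: sym)
  also have "(\<Sum>i<n. \<Sum>j<n. s i j * ((cmod (v i))\<^sup>2 / 2)) + (\<Sum>j<n. \<Sum>i<n. s j i * ((cmod (v j))\<^sup>2 / 2))
      = (\<Sum>i<n. (\<Sum>j<n. s i j) * (cmod (v i))\<^sup>2)"
    by (simp add: sum_distrib_right flip: sum.distrib)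
  also have "\<dots> \<le> (\<Sum>i<n. \<delta> * (cmod (v i))\<^sup>2)"
    by (intro sum_mono mult_right_mono row) auto
  finally show ?thesis by (simp add: sq_norm_upto_def sum_distrib_left)
qed

lemma Re_form_term_le: "\<bar>Re (cnj a * z * b)\<bar> \<le> cmod z * (cmod a * cmod b)"
  using abs_Re_le_cmod[of "cnj a * z * b"] by (simp add: norm_mult mult_ac)

text \<open>A form of Weyl's inequality; \<open>n \<eta>\<close> bounds the norm of \<open>A - C\<close>.\<close>

theorem eigenvalue_count_perturbation:
  assumes A: "hermitian_mat n A" and C: "hermitian_mat n C"
    and close: "\<And>i j. i < n \<Longrightarrow> j < n \<Longrightarrow> cmod (A $$ (i, j) - C $$ (i, j)) \<le> \<eta>"
    and \<eta>: "real n * \<eta> \<le> \<delta>"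
  shows "eigenvalue_count A {t + \<delta><..} \<le> eigenvalue_count C {t<..}"
proof -
  obtain U l where U: "\<And>I. eigenvalue_count C I = card {k. k < n \<and> l k \<in> I}"
    "\<And>v. herm_form n C v = (\<Sum>k<n. l k * (cmod (\<Sum>i<n. U i k * v i))\<^sup>2)"
    "\<And>v. sq_norm_upto n v = (\<Sum>k<n. (cmod (\<Sum>i<n. U i k * v i))\<^sup>2)"
    by (rule hermitian_form_diagonalization[OF C]) blast
  have "eigenvalue_count A {t + \<delta><..} \<le> card {k. k < n \<and> l k > t}"
  proof (rule eigenvalue_count_greater_le[OF A, where f = "\<lambda>k i. U i k"])
    fix v assume v: "\<And>k. k \<in> {k. k < n \<and> l k > t} \<Longrightarrow> (\<Sum>i<n. U i k * v i) = 0"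
    have "herm_form n C v \<le> t * sq_norm_upto n v"
      unfolding U(2,3) sum_distrib_left
    proof (intro sum_mono)
      fix k assume "k \<in> {..<n}"
      thus "l k * (cmod (\<Sum>i<n. U i k * v i))\<^sup>2 \<le> t * (cmod (\<Sum>i<n. U i k * v i))\<^sup>2"
        using v[of k] by (cases "l k > t") (auto intro: mult_right_mono)
    qed
    moreover have "herm_form n A v - herm_form n C v \<le> \<delta> * sq_norm_upto n v"
    proof -
      have "herm_form n A v - herm_form n C v
          = (\<Sum>i<n. \<Sum>j<n. Re (cnj (v i) * (A $$ (i, j) - C $$ (i, j)) * v j))"
        unfolding herm_form_def sum_subtractf[symmetric] by (simp add: algebra_simps)
      also have "\<dots> \<le> (\<Sum>i<n. \<Sum>j<n. \<eta> * (cmod (v i) * cmod (v j)))"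
      proof (intro sum_mono)
        fix i j assume "i \<in> {..<n}" "j \<in> {..<n}"
        hence "cmod (A $$ (i, j) - C $$ (i, j)) * (cmod (v i) * cmod (v j)) \<le> \<eta> * (cmod (v i) * cmod (v j))"
          by (intro mult_right_mono close) auto
        with Re_form_term_le[of "v i" "A $$ (i, j) - C $$ (i, j)" "v j"]
        show "Re (cnj (v i) * (A $$ (i, j) - C $$ (i, j)) * v j) \<le> \<eta> * (cmod (v i) * cmod (v j))"
          by linarith
      qed
      also have "\<dots> \<le> \<delta> * sq_norm_upto n v"
      proof (rule sum_symmetric_kernel_le)
        fix i j assume "i < n" "j < n"
        thus "0 \<le> \<eta>" using close[of i j] norm_ge_zero order_trans by blast
      qed (use \<eta> in auto)
      finally show ?thesis .
    qed
    ultimately show "herm_form n A v \<le> (t + \<delta>) * sq_norm_upto n v"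
      by (simp add: distrib_right)
  qed simp
  thus ?thesis by (simp add: U)
qed

text \<open>A Hermitian matrix whose entries of modulus above \<open>\<epsilon>\<close> form a matching off the diagonal, while
the other entries have absolute row sums at most \<open>\<delta>\<close>. The number \<open>t \<ge> \<epsilon>\<close> is the level above which
eigenvalues and entries are counted.\<close>

locale dominant_matching =
  fixes n :: nat and B :: "complex mat" and \<epsilon> \<delta> t :: real
  assumes herm: "hermitian_mat n B"
    and diag: "\<And>i. i < n \<Longrightarrow> cmod (B $$ (i, i)) \<le> \<epsilon>"
    and matching: "\<And>i j j'. i < n \<Longrightarrow> j < n \<Longrightarrow> j' < n \<Longrightarrow> cmod (B $$ (i, j)) > \<epsilon> \<Longrightarrow>
       cmod (B $$ (i, j')) > \<epsilon> \<Longrightarrow> j = j'"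
    and row: "\<And>i. i < n \<Longrightarrow> (\<Sum>j<n. if cmod (B $$ (i, j)) \<le> \<epsilon> then cmod (B $$ (i, j)) else 0) \<le> \<delta>"
    and t: "0 \<le> \<epsilon>" "\<epsilon> \<le> t"
begin

text \<open>The matching of the entries of modulus above \<open>t\<close>, each represented by its position above the
diagonal.\<close>

definition large_edges :: "(nat \<times> nat) set" where
  "large_edges = {(j, k). j < k \<and> k < n \<and> cmod (B $$ (j, k)) > t}"

text \<open>The contribution of the entries of modulus above \<open>\<epsilon>\<close> to the quadratic form.\<close>

definition large_part :: "(nat \<Rightarrow> complex) \<Rightarrow> real" where
  "large_part v = (\<Sum>i<n. \<Sum>j<n. if cmod (B $$ (i, j)) \<le> \<epsilon> then 0 else Re (cnj (v i) * B $$ (i, j) * v j))"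

lemma B_sym: "i < n \<Longrightarrow> j < n \<Longrightarrow> B $$ (j, i) = cnj (B $$ (i, j))"
  using herm unfolding hermitian_mat_def by blast

lemma cmod_sym: "i < n \<Longrightarrow> j < n \<Longrightarrow> cmod (B $$ (j, i)) = cmod (B $$ (i, j))"
  using B_sym by (metis complex_mod_cnj)

lemma finite_large_edges: "finite large_edges"
  by (rule finite_subset[of _ "{..<n} \<times> {..<n}"]) (auto simp: large_edges_def)

lemma form_close_large_part: "\<bar>herm_form n B v - large_part v\<bar> \<le> \<delta> * sq_norm_upto n v"
proof -
  let ?s = "\<lambda>i j. if cmod (B $$ (i, j)) \<le> \<epsilon> then cmod (B $$ (i, j)) else 0"
  have "herm_form n B v - large_part v = (\<Sum>i<n. \<Sum>j<n. if cmod (B $$ (i, j)) \<le> \<epsilon> then Re (cnj (v i) * B $$ (i, j) * v j) else 0)"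
    unfolding herm_form_def large_part_def sum_subtractf[symmetric]
    by (intro sum.cong refl) auto
  also have "\<bar>\<dots>\<bar> \<le> (\<Sum>i<n. \<Sum>j<n. \<bar>if cmod (B $$ (i, j)) \<le> \<epsilon> then Re (cnj (v i) * B $$ (i, j) * v j) else 0\<bar>)"
    by (intro order_trans[OF sum_abs] sum_mono sum_abs)
  also have "\<dots> \<le> (\<Sum>i<n. \<Sum>j<n. ?s i j * (cmod (v i) * cmod (v j)))"
    using Re_form_term_le by (intro sum_mono) auto
  also have "\<dots> \<le> \<delta> * sq_norm_upto n v"
    by (rule sum_symmetric_kernel_le) (use cmod_sym row in auto)
  finally show ?thesis .
qed

lemma edge_cases:
  assumes ij: "i < n" "j < n" "cmod (B $$ (i, j)) > t"
  shows "(i, j) \<in> large_edges \<or> (j, i) \<in> large_edges"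
proof -
  have "i \<noteq> j" using diag[of i] ij t by auto
  thus ?thesis using ij cmod_sym[OF ij(1,2)] by (cases "i < j") (auto simp: large_edges_def)
qed

text \<open>Let \<open>z\<close> be the entry of the edge \<open>(j, k)\<close>. The hypothesis says that \<open>(v j, v k)\<close> is a multiple of the
eigenvector of the block of \<open>z\<close> for the eigenvalue \<open>c \<bar>z\<bar>\<close>, where \<open>c = \<plusminus>1\<close>.\<close>

lemma edge_term:
  assumes c: "\<bar>c\<bar> = 1" and v: "v j = of_real c * sgn (B $$ (j, k)) * v k"
    and e: "(j, k) \<in> large_edges"
  shows "Re (cnj (v j) * B $$ (j, k) * v k) = c * cmod (B $$ (j, k)) * (cmod (v k))\<^sup>2"
    "Re (cnj (v k) * B $$ (k, j) * v j) = c * cmod (B $$ (j, k)) * (cmod (v k))\<^sup>2"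
    "cmod (v j) = cmod (v k)"
proof -
  have jk: "j < n" "k < n" "cmod (B $$ (j, k)) > 0" using e t by (auto simp: large_edges_def)
  have s: "cnj (sgn z) * z = of_real (cmod z)" for z
  proof -
    have "cnj (sgn z) * z = (z * cnj z) / of_real (cmod z)"
      by (simp add: sgn_eq)
    also have "\<dots> = of_real (cmod z)" by (simp flip: complex_norm_square add: power2_eq_square)
    finally show ?thesis .
  qed
  have "cnj (v j) * B $$ (j, k) * v k = of_real c * (cnj (sgn (B $$ (j, k))) * B $$ (j, k)) * (v k * cnj (v k))"
    by (simp add: v mult_ac)
  also have "\<dots> = of_real (c * cmod (B $$ (j, k)) * (cmod (v k))\<^sup>2)"
    unfolding s of_real_mult cmod_sq ..
  finally have 1: "cnj (v j) * B $$ (j, k) * v k = of_real (c * cmod (B $$ (j, k)) * (cmod (v k))\<^sup>2)" .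
  show "Re (cnj (v j) * B $$ (j, k) * v k) = c * cmod (B $$ (j, k)) * (cmod (v k))\<^sup>2"
    unfolding 1 by (rule Re_complex_of_real)
  have "cnj (v k) * B $$ (k, j) * v j = cnj (cnj (v j) * B $$ (j, k) * v k)"
    using B_sym[OF jk(1,2)] by (simp add: mult_ac)
  thus "Re (cnj (v k) * B $$ (k, j) * v j) = c * cmod (B $$ (j, k)) * (cmod (v k))\<^sup>2"
    unfolding 1 by simp
  have "B $$ (j, k) \<noteq> 0" using jk by auto
  thus "cmod (v j) = cmod (v k)" using c by (simp add: v norm_mult norm_sgn)
qed

text \<open>The linear equation that expresses the hypothesis on \<open>v\<close> in the preceding lemma.\<close>

lemma edge_functional:
  assumes "(j, k) \<in> large_edges"
    and "(\<Sum>i<n. (if i = j then 1 else if i = k then - (of_real c * sgn (B $$ (j, k))) else 0) * v i) = 0"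
  shows "v j = of_real c * sgn (B $$ (j, k)) * v k"
proof -
  have jk: "j < k" "k < n" using assms by (auto simp: large_edges_def)
  have "(\<Sum>i<n. (if i = j then 1 else if i = k then - (of_real c * sgn (B $$ (j, k))) else 0) * v i)
      = (\<Sum>i\<in>{j, k}. (if i = j then 1 else if i = k then - (of_real c * sgn (B $$ (j, k))) else 0) * v i)"
    using jk by (intro sum.mono_neutral_right) auto
  also have "\<dots> = v j - of_real c * sgn (B $$ (j, k)) * v k" using jk by simp
  finally show ?thesis using assms(2) by (metis eq_iff_diff_eq_0)
qed

text \<open>One equation per edge restricts \<open>v\<close> to the orthogonal complement of the eigenvector for \<open>+\<bar>z\<bar>\<close>. There
the large entries contribute at most \<open>t\<close> times the squared norm.\<close>

lemma eigenvalue_count_upper: "eigenvalue_count B {t + \<delta><..} \<le> card large_edges"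
proof (rule eigenvalue_count_greater_le[OF herm finite_large_edges, where
    f = "\<lambda>(j, k) i. if i = j then 1 else if i = k then - (of_real (-1) * sgn (B $$ (j, k))) else 0"])
  fix v assume *: "\<And>r. r \<in> large_edges \<Longrightarrow> (\<Sum>i<n. (case r of (j, k) \<Rightarrow> \<lambda>i.
     if i = j then 1 else if i = k then - (complex_of_real (-1) * sgn (B $$ (j, k))) else 0) i * v i) = 0"
  have v: "v j = of_real (-1) * sgn (B $$ (j, k)) * v k" if "(j, k) \<in> large_edges" for j k
    by (rule edge_functional[OF that]) (use *[OF that] in simp)
  have et: "Re (cnj (v j) * B $$ (j, k) * v k) \<le> 0" "Re (cnj (v k) * B $$ (k, j) * v j) \<le> 0"
    if "(j, k) \<in> large_edges" for j k
    using edge_term(1,2)[of "-1" v j k, OF _ v[OF that] that] by simp_all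
  let ?m = "\<lambda>i j. if cmod (B $$ (i, j)) \<le> \<epsilon> then 0 else 1 :: real"
  have "large_part v \<le> (\<Sum>i<n. \<Sum>j<n. t * (?m i j * (cmod (v i) * cmod (v j))))"
    unfolding large_part_def
  proof (intro sum_mono)
    fix i j assume "i \<in> {..<n}" "j \<in> {..<n}"
    hence ij: "i < n" "j < n" by auto
    show "(if cmod (B $$ (i, j)) \<le> \<epsilon> then 0 else Re (cnj (v i) * B $$ (i, j) * v j))
       \<le> t * (?m i j * (cmod (v i) * cmod (v j)))"
    proof (cases "cmod (B $$ (i, j)) > t")
      case True
      from edge_cases[OF ij True] have "Re (cnj (v i) * B $$ (i, j) * v j) \<le> 0"
        using et by blast
      also have "0 \<le> t * (?m i j * (cmod (v i) * cmod (v j)))" using t by auto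
      finally show ?thesis using t by auto
    next
      case False
      hence "cmod (B $$ (i, j)) * (cmod (v i) * cmod (v j)) \<le> t * (cmod (v i) * cmod (v j))"
        by (intro mult_right_mono) auto
      with Re_form_term_le[of "v i" "B $$ (i, j)" "v j"] t show ?thesis by auto
    qed
  qed
  also have "\<dots> = t * (\<Sum>i<n. \<Sum>j<n. ?m i j * (cmod (v i) * cmod (v j)))"
    by (simp only: sum_distrib_left)
  also have "\<dots> \<le> t * (1 * sq_norm_upto n v)"
  proof (intro mult_left_mono sum_symmetric_kernel_le)
    fix i assume i: "i < n"
    have "(\<Sum>j<n. ?m i j) = (\<Sum>j\<in>{j\<in>{..<n}. cmod (B $$ (i, j)) > \<epsilon>}. 1)"
      by (intro sum.mono_neutral_cong_right) auto
    also have "\<dots> = real (card {j\<in>{..<n}. cmod (B $$ (i, j)) > \<epsilon>})" by simp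
    also have "card {j\<in>{..<n}. cmod (B $$ (i, j)) > \<epsilon>} \<le> Suc 0"
      using matching[OF i] by (subst card_le_Suc0_iff_eq) auto
    finally show "(\<Sum>j<n. ?m i j) \<le> 1" by simp
  qed (use t cmod_sym in auto)
  finally show "herm_form n B v \<le> (t + \<delta>) * sq_norm_upto n v"
    using form_close_large_part[of v] by (simp add: distrib_right)
qed

text \<open>Conversely, the space spanned by the eigenvectors for \<open>+\<bar>z\<bar>\<close> over all edges is cut out by
\<open>n - card large_edges\<close> equations: one per edge, and one for each index outside all edges.\<close>

lemma eigenvalue_count_lower: "card large_edges \<le> eigenvalue_count B {t - \<delta>..}"
proof -
  \<comment> \<open>the indices covered by an edge; by the matching property there are two for each edge\<close>
  define V where "V = fst ` large_edges \<union> snd ` large_edges"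
  have E: "j < k" "k < n" "j < n" "cmod (B $$ (j, k)) > \<epsilon>" "cmod (B $$ (k, j)) > \<epsilon>" "cmod (B $$ (j, k)) > t"
    if "(j, k) \<in> large_edges" for j k
    using that t cmod_sym[of j k] by (auto simp: large_edges_def)
  have "b = b'" if "(a, b) \<in> large_edges" "(a, b') \<in> large_edges" for a b b'
    using matching[of a b b'] E[OF that(1)] E[OF that(2)] by simp
  hence "inj_on fst large_edges" by (auto simp: inj_on_def)
  moreover have "a = a'" if "(a, b) \<in> large_edges" "(a', b) \<in> large_edges" for a a' b
    using matching[of b a a'] E[OF that(1)] E[OF that(2)] by simp
  hence "inj_on snd large_edges" by (auto simp: inj_on_def)
  moreover have "fst ` large_edges \<inter> snd ` large_edges = {}"
  proof -
    have False if "(i, k) \<in> large_edges" "(j, i) \<in> large_edges" for i j k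
      using matching[of i k j] E[OF that(1)] E[OF that(2)] by auto
    thus ?thesis by force
  qed
  ultimately have cV: "card V = 2 * card large_edges"
    unfolding V_def using finite_large_edges by (subst card_Un_disjoint) (auto simp: card_image)
  have Vn: "V \<subseteq> {..<n}" using E by (auto simp: V_def)
  define R where "R = Inl ` large_edges \<union> Inr ` ({..<n} - V)"
  have "finite R" using finite_large_edges by (simp add: R_def)
  have "card R = card large_edges + (n - card V)"
    unfolding R_def using finite_large_edges Vn finite_subset[OF Vn]
    by (subst card_Un_disjoint) (auto simp: card_image card_Diff_subset)
  hence cR: "card R + card large_edges = n"
    using card_mono[OF _ Vn] cV by simp
  define f :: "(nat \<times> nat) + nat \<Rightarrow> nat \<Rightarrow> complex" where
    "f = case_sum (\<lambda>(j, k) i. if i = j then 1 else if i = k then - (of_real 1 * sgn (B $$ (j, k))) else 0)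
       (\<lambda>m i. if i = m then 1 else 0)"
  have "eigenvalue_count B {..<t - \<delta>} \<le> card R"
  proof (rule eigenvalue_count_less_le[OF herm \<open>finite R\<close>, where f = f])
    fix v assume *: "\<And>r. r \<in> R \<Longrightarrow> (\<Sum>i<n. f r i * v i) = 0"
    have v: "v j = of_real 1 * sgn (B $$ (j, k)) * v k" if "(j, k) \<in> large_edges" for j k
      by (rule edge_functional[OF that]) (use *[of "Inl (j, k)"] that in \<open>simp add: R_def f_def\<close>)
    have v0: "v i = 0" if "i < n" "i \<notin> V" for i
    proof -
      have "(\<Sum>j<n. (if j = i then 1 else 0) * v j) = 0"
        using *[of "Inr i"] that by (simp add: R_def f_def)
      thus ?thesis using that by (simp add: mult_delta_left)
    qed
    have et: "Re (cnj (v j) * B $$ (j, k) * v k) = cmod (B $$ (j, k)) * (cmod (v k))\<^sup>2"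
      "Re (cnj (v k) * B $$ (k, j) * v j) = cmod (B $$ (j, k)) * (cmod (v k))\<^sup>2"
      "cmod (v j) = cmod (v k)"
      if "(j, k) \<in> large_edges" for j k
      using edge_term[of 1 v j k, OF _ v[OF that] that] by simp_all
    have "t * sq_norm_upto n v \<le> large_part v"
      unfolding sq_norm_upto_def large_part_def sum_distrib_left
    proof (intro sum_mono)
      fix i assume "i \<in> {..<n}"
      hence i: "i < n" by simp
      let ?g = "\<lambda>j. if cmod (B $$ (i, j)) \<le> \<epsilon> then 0 else Re (cnj (v i) * B $$ (i, j) * v j)"
      show "t * (cmod (v i))\<^sup>2 \<le> (\<Sum>j<n. ?g j)"
      proof (cases "i \<in> V")
        case False
        thus ?thesis using v0[OF i] by (auto intro!: sum_nonneg)
      next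
        case True
        obtain j where j: "j < n" "cmod (B $$ (i, j)) > t" "(i, j) \<in> large_edges \<or> (j, i) \<in> large_edges"
        proof -
          from True consider k where "(i, k) \<in> large_edges" | k where "(k, i) \<in> large_edges"
            by (auto simp: V_def)
          thus ?thesis
          proof cases
            case 1
            thus ?thesis using that[of k] E[OF 1] by simp
          next
            case 2
            thus ?thesis using that[of k] E[OF 2] cmod_sym[of k i] by simp
          qed
        qed
        have "(\<Sum>j<n. ?g j) = (\<Sum>j\<in>{j}. ?g j)"
        proof (rule sum.mono_neutral_right)
          have "cmod (B $$ (i, j')) \<le> \<epsilon>" if "j' < n" "j' \<noteq> j" for j'
            using matching[OF i that(1) j(1)] j(2) t that(2) by (meson not_le order.strict_trans1)
          thus "\<forall>j'\<in>{..<n} - {j}. ?g j' = 0" by simp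
        qed (use j in auto)
        also have "\<dots> = cmod (B $$ (i, j)) * (cmod (v i))\<^sup>2"
          using j t et cmod_sym[OF i j(1)] by auto
        also have "\<dots> \<ge> t * (cmod (v i))\<^sup>2" using j by (intro mult_right_mono) auto
        finally show ?thesis .
      qed
    qed
    thus "(t - \<delta>) * sq_norm_upto n v \<le> herm_form n B v"
      using form_close_large_part[of v] by (simp add: left_diff_distrib)
  qed
  with eigenvalue_count_split[OF herm, of "t - \<delta>"] cR show ?thesis by linarith
qed

end

section \<open>Measurability of eigenvalue counts\<close>

lemma eigenvalue_count_greater_gap:
  assumes "hermitian_mat n A"
  obtains \<delta> where "\<delta> > 0" "\<And>s. s < \<delta> \<Longrightarrow> s \<ge> 0 \<Longrightarrow> eigenvalue_count A {t + s<..} = eigenvalue_count A {t<..}"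
    "\<And>s. s < \<delta> \<Longrightarrow> s > 0 \<Longrightarrow> eigenvalue_count A {t - s<..} = eigenvalue_count A {t..}"
proof -
  obtain U l where U: "\<And>I. eigenvalue_count A I = card {k. k < n \<and> l k \<in> I}"
    by (rule hermitian_form_diagonalization[OF assms]) blast
  define F where "F = insert 1 ((\<lambda>k. \<bar>l k - t\<bar>) ` {k. k < n \<and> l k \<noteq> t})"
  have F: "finite F" "F \<noteq> {}" "\<And>z. z \<in> F \<Longrightarrow> z > 0" by (auto simp: F_def)
  define \<delta> where "\<delta> = Min F"
  have gap: "l k = t \<or> \<bar>l k - t\<bar> \<ge> \<delta>" if "k < n" for k
    using that F unfolding \<delta>_def by (auto simp: F_def intro!: Min_le)
  show ?thesis
  proof
    show "\<delta> > 0" using F by (simp add: \<delta>_def)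
    show "eigenvalue_count A {t + s<..} = eigenvalue_count A {t<..}" if "s < \<delta>" "s \<ge> 0" for s
      unfolding U using gap that by (intro arg_cong[of _ _ card]) force
    show "eigenvalue_count A {t - s<..} = eigenvalue_count A {t..}" if "s < \<delta>" "s > 0" for s
      unfolding U using gap that by (intro arg_cong[of _ _ card]) force
  qed
qed

lemma eigenvalue_count_mono:
  assumes "hermitian_mat n A" "I \<subseteq> J"
  shows "eigenvalue_count A I \<le> eigenvalue_count A J"
proof -
  obtain U l where U: "\<And>I. eigenvalue_count A I = card {k. k < n \<and> l k \<in> I}"
    by (rule hermitian_form_diagonalization[OF assms(1)]) blast
  show ?thesis unfolding U by (rule card_mono) (use assms(2) in auto)
qed

lemma eigenvalue_count_interval:
  assumes "hermitian_mat n A" "x < y"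
  shows "eigenvalue_count A {x<..<y} = eigenvalue_count A {x<..} - eigenvalue_count A {y..}"
proof -
  obtain U l where U: "\<And>I. eigenvalue_count A I = card {k. k < n \<and> l k \<in> I}"
    by (rule hermitian_form_diagonalization[OF assms(1)]) blast
  have "{k. k < n \<and> l k \<in> {x<..<y}} = {k. k < n \<and> l k \<in> {x<..}} - {k. k < n \<and> l k \<in> {y..}}"
    by auto
  also have "card \<dots> = eigenvalue_count A {x<..} - eigenvalue_count A {y..}"
    unfolding U using assms(2) by (subst card_Diff_subset) auto
  finally show ?thesis unfolding U .
qed

text \<open>The Hermitian matrix whose upper triangle is read off from a list of rows of rational real and
imaginary parts. Entries of the list below the diagonal, and imaginary parts on it, are ignored, and
its values outside the expected range are irrelevant. These matrices form a countable set.\<close>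

definition rational_hermitian :: "nat \<Rightarrow> (rat \<times> rat) list list \<Rightarrow> complex mat" where
  "rational_hermitian n q = mat n n (\<lambda>(i, j).
     let z = (\<lambda>i j. Complex (of_rat (fst (q ! i ! j))) (of_rat (snd (q ! i ! j)))) in
     if i < j then z i j else if j < i then cnj (z j i) else of_real (Re (z i i)))"

lemma hermitian_rational_hermitian: "hermitian_mat n (rational_hermitian n q)"
  by (auto simp: hermitian_mat_def rational_hermitian_def Let_def)

lemma rational_hermitian_dense:
  assumes A: "hermitian_mat n A" and \<eta>: "\<eta> > 0"
  obtains q where "\<And>i j. i < n \<Longrightarrow> j < n \<Longrightarrow> cmod (A $$ (i, j) - rational_hermitian n q $$ (i, j)) \<le> \<eta>"
proof -
  have "\<exists>r. \<bar>x - of_rat r\<bar> < \<eta> / 2" for x :: real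
  proof -
    obtain r where "x < of_rat r" "of_rat r < x + \<eta> / 2"
      using of_rat_dense[of x "x + \<eta> / 2"] \<eta> by auto
    thus ?thesis by (intro exI[of _ r]) auto
  qed
  then obtain r where r: "\<And>x. \<bar>x - of_rat (r x)\<bar> < \<eta> / 2" by metis
  define z where "z w = Complex (of_rat (r (Re w))) (of_rat (r (Im w)))" for w
  have z: "cmod (w - z w) \<le> \<eta>" for w
  proof -
    have "cmod (w - z w) \<le> \<bar>Re (w - z w)\<bar> + \<bar>Im (w - z w)\<bar>" by (rule cmod_le)
    also have "\<dots> \<le> \<eta> / 2 + \<eta> / 2"
      using r[of "Re w"] r[of "Im w"] by (intro add_mono) (auto simp: z_def)
    finally show ?thesis by simp
  qed
  have z': "cmod (w - of_real (Re (z w))) \<le> \<eta>" if "Im w = 0" for w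
  proof -
    have "w - of_real (Re (z w)) = of_real (Re w - of_rat (r (Re w)))"
      using that by (simp add: complex_eq_iff z_def)
    thus ?thesis using r[of "Re w"] \<eta> by (simp only: norm_of_real)
  qed
  define q where "q = map (\<lambda>i. map (\<lambda>j. (r (Re (A $$ (i, j))), r (Im (A $$ (i, j))))) [0..<n]) [0..<n]"
  have q: "Complex (of_rat (fst (q ! i ! j))) (of_rat (snd (q ! i ! j))) = z (A $$ (i, j))"
    if "i < n" "j < n" for i j
    using that by (simp add: q_def z_def)
  have As: "A $$ (j, i) = cnj (A $$ (i, j))" if "i < n" "j < n" for i j
    using A that unfolding hermitian_mat_def by blast
  show ?thesis
  proof
    fix i j assume ij: "i < n" "j < n"
    consider "i < j" | "j < i" | "i = j" by linarith
    thus "cmod (A $$ (i, j) - rational_hermitian n q $$ (i, j)) \<le> \<eta>"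
    proof cases
      case 1
      thus ?thesis using ij z by (simp add: rational_hermitian_def q)
    next
      case 2
      have "cmod (A $$ (i, j) - cnj (z (A $$ (j, i)))) = cmod (cnj (A $$ (j, i) - z (A $$ (j, i))))"
        using As[OF ij(2,1)] by simp
      also have "\<dots> \<le> \<eta>" unfolding complex_mod_cnj by (rule z)
      finally show ?thesis using ij 2 by (simp add: rational_hermitian_def q)
    next
      case 3
      have "Im (A $$ (i, i)) = 0" using As[OF ij(1,1)] by (metis complex_cnj_cancel_iff complex_cnj_i add.inverse_neutral cnj.sel(2) equal_neg_zero)
      thus ?thesis using ij 3 z' by (simp add: rational_hermitian_def q)
    qed
  qed
qed

text \<open>Eigenvalue counts depend measurably on the entries of the matrix: exceeding a level is an
  open condition, so it can be tested on a countable dense set of Hermitian matrices.\<close>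

lemma measurable_eigenvalue_count_greater:
  assumes herm: "\<And>\<omega>. \<omega> \<in> space M \<Longrightarrow> hermitian_mat n (A \<omega>)"
    and meas: "\<And>i j. i < n \<Longrightarrow> j < n \<Longrightarrow> (\<lambda>\<omega>. A \<omega> $$ (i, j)) \<in> borel_measurable M"
  shows "{\<omega> \<in> space M. r \<le> eigenvalue_count (A \<omega>) {t<..}} \<in> sets M"
proof -
  define \<eta> :: "nat \<Rightarrow> real" where "\<eta> m = 1 / ((real m + 1) * (real n + 1))" for m
  have \<eta>: "\<eta> m > 0" "real n * \<eta> m \<le> 1 / (real m + 1)" for m
  proof -
    show "\<eta> m > 0" by (simp add: \<eta>_def add_pos_nonneg)
    have "real n * \<eta> m = 1 / (real m + 1) * (real n / (real n + 1))" by (simp add: \<eta>_def)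
    also have "\<dots> \<le> 1 / (real m + 1)" by (intro mult_left_le) auto
    finally show "real n * \<eta> m \<le> 1 / (real m + 1)" .
  qed
  define Q where "Q = {(q, m :: nat). r \<le> eigenvalue_count (rational_hermitian n q) {t + 1 / (real m + 1)<..}}"
  define E where "E = (\<lambda>(q, m). {\<omega> \<in> space M. \<forall>i\<in>{..<n}. \<forall>j\<in>{..<n}.
      cmod (A \<omega> $$ (i, j) - rational_hermitian n q $$ (i, j)) \<le> \<eta> m})"
  have "countable Q" by (rule countableI_type)
  moreover have "E qm \<in> sets M" for qm
    using meas unfolding E_def by (cases qm) (auto intro!: sets.sets_Collect_finite_All')
  ultimately have "(\<Union>qm\<in>Q. E qm) \<in> sets M" by (intro sets.countable_UN') auto
  also have "(\<Union>qm\<in>Q. E qm) = {\<omega> \<in> space M. r \<le> eigenvalue_count (A \<omega>) {t<..}}"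
  proof (intro equalityI subsetI)
    fix \<omega> assume "\<omega> \<in> (\<Union>qm\<in>Q. E qm)"
    then obtain q m where qm: "r \<le> eigenvalue_count (rational_hermitian n q) {t + 1 / (real m + 1)<..}"
      "\<omega> \<in> space M" "\<And>i j. i < n \<Longrightarrow> j < n \<Longrightarrow> cmod (A \<omega> $$ (i, j) - rational_hermitian n q $$ (i, j)) \<le> \<eta> m"
      by (auto simp: Q_def E_def)
    have "eigenvalue_count (rational_hermitian n q) {t + 1 / (real m + 1)<..} \<le> eigenvalue_count (A \<omega>) {t<..}"
      by (rule eigenvalue_count_perturbation[OF hermitian_rational_hermitian herm[OF qm(2)] _ \<eta>(2)])
         (use qm(3) norm_minus_commute in metis)
    with qm show "\<omega> \<in> {\<omega> \<in> space M. r \<le> eigenvalue_count (A \<omega>) {t<..}}" by simp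
  next
    fix \<omega> assume \<omega>: "\<omega> \<in> {\<omega> \<in> space M. r \<le> eigenvalue_count (A \<omega>) {t<..}}"
    hence h: "hermitian_mat n (A \<omega>)" using herm by simp
    obtain \<delta> where \<delta>: "\<delta> > 0" "\<And>s. s < \<delta> \<Longrightarrow> s \<ge> 0 \<Longrightarrow> eigenvalue_count (A \<omega>) {t + s<..} = eigenvalue_count (A \<omega>) {t<..}"
      by (rule eigenvalue_count_greater_gap[OF h]) blast
    \<comment> \<open>room for two shifts: from \<open>A\<close> to the rational matrix and back\<close>
    obtain m where m: "inverse (real (Suc m)) < \<delta> / 2"
      using reals_Archimedean[of "\<delta> / 2"] \<delta>(1) by auto
    define s where "s = 1 / (real m + 1)"
    have s: "s + s < \<delta>" "s \<ge> 0" using m by (auto simp: s_def field_simps)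
    obtain q where q: "\<And>i j. i < n \<Longrightarrow> j < n \<Longrightarrow> cmod (A \<omega> $$ (i, j) - rational_hermitian n q $$ (i, j)) \<le> \<eta> m"
      by (rule rational_hermitian_dense[OF h \<eta>(1)]) blast
    have "r \<le> eigenvalue_count (A \<omega>) {t + s + s<..}"
      using \<omega> \<delta>(2)[of "s + s"] s by (simp add: add.assoc)
    also have "\<dots> \<le> eigenvalue_count (rational_hermitian n q) {t + s<..}"
      by (rule eigenvalue_count_perturbation[OF h hermitian_rational_hermitian q])
         (use \<eta>(2)[of m] in \<open>auto simp: s_def\<close>)
    finally have "(q, m) \<in> Q" by (simp add: Q_def s_def)
    moreover have "\<omega> \<in> E (q, m)" using \<omega> q by (simp add: E_def)
    ultimately show "\<omega> \<in> (\<Union>qm\<in>Q. E qm)" by blast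
  qed
  finally show ?thesis .
qed

lemma measurable_nat_level_sets:
  fixes f :: "'a \<Rightarrow> nat"
  assumes "\<And>r. {\<omega> \<in> space M. r \<le> f \<omega>} \<in> sets M"
  shows "f \<in> measurable M (count_space UNIV)"
proof (subst measurable_count_space_eq2_countable, intro conjI ballI)
  fix r
  have "f -` {r} \<inter> space M = {\<omega> \<in> space M. r \<le> f \<omega>} - {\<omega> \<in> space M. Suc r \<le> f \<omega>}" by auto
  thus "f -` {r} \<inter> space M \<in> sets M" using assms by auto
qed auto

lemma measurable_eigenvalue_count:
  assumes herm: "\<And>\<omega>. \<omega> \<in> space M \<Longrightarrow> hermitian_mat n (A \<omega>)"
    and meas: "\<And>i j. i < n \<Longrightarrow> j < n \<Longrightarrow> (\<lambda>\<omega>. A \<omega> $$ (i, j)) \<in> borel_measurable M"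
  shows "(\<lambda>\<omega>. eigenvalue_count (A \<omega>) {t<..}) \<in> measurable M (count_space UNIV)"
    and "(\<lambda>\<omega>. eigenvalue_count (A \<omega>) {t..}) \<in> measurable M (count_space UNIV)"
proof -
  show "(\<lambda>\<omega>. eigenvalue_count (A \<omega>) {t<..}) \<in> measurable M (count_space UNIV)"
    by (rule measurable_nat_level_sets[OF measurable_eigenvalue_count_greater[OF assms]])
  show "(\<lambda>\<omega>. eigenvalue_count (A \<omega>) {t..}) \<in> measurable M (count_space UNIV)"
  proof (rule measurable_nat_level_sets)
    fix r
    have "{\<omega> \<in> space M. r \<le> eigenvalue_count (A \<omega>) {t..}} =
      (\<Inter>m. {\<omega> \<in> space M. r \<le> eigenvalue_count (A \<omega>) {t - inverse (real (Suc m))<..}})"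
    proof (intro equalityI subsetI)
      fix \<omega> assume \<omega>: "\<omega> \<in> {\<omega> \<in> space M. r \<le> eigenvalue_count (A \<omega>) {t..}}"
      hence h: "hermitian_mat n (A \<omega>)" using herm by simp
      have "{t..} \<subseteq> {t - inverse (real (Suc m))<..}" for m
      proof -
        have "inverse (real (Suc m)) > 0" by simp
        show ?thesis
        proof
          fix x assume "x \<in> {t..}"
          hence "t \<le> x" by simp
          with \<open>inverse (real (Suc m)) > 0\<close> have "t - inverse (real (Suc m)) < x" by linarith
          thus "x \<in> {t - inverse (real (Suc m))<..}" by (simp only: greaterThan_iff)
        qed
      qed
      hence "r \<le> eigenvalue_count (A \<omega>) {t - inverse (real (Suc m))<..}" for m
        using \<omega> order_trans[OF _ eigenvalue_count_mono[OF h]] by blast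
      thus "\<omega> \<in> (\<Inter>m. {\<omega> \<in> space M. r \<le> eigenvalue_count (A \<omega>) {t - inverse (real (Suc m))<..}})"
        using \<omega> by blast
    next
      fix \<omega> assume \<omega>: "\<omega> \<in> (\<Inter>m. {\<omega> \<in> space M. r \<le> eigenvalue_count (A \<omega>) {t - inverse (real (Suc m))<..}})"
      hence h: "hermitian_mat n (A \<omega>)" using herm by simp
      obtain \<delta> where \<delta>: "\<delta> > 0" "\<And>s. s < \<delta> \<Longrightarrow> s > 0 \<Longrightarrow> eigenvalue_count (A \<omega>) {t - s<..} = eigenvalue_count (A \<omega>) {t..}"
        by (rule eigenvalue_count_greater_gap[OF h]) blast
      obtain m where m: "inverse (real (Suc m)) < \<delta>" using reals_Archimedean \<delta>(1) by blast
      have "eigenvalue_count (A \<omega>) {t - inverse (real (Suc m))<..} = eigenvalue_count (A \<omega>) {t..}"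
        by (rule \<delta>(2)[OF m]) simp
      moreover have "r \<le> eigenvalue_count (A \<omega>) {t - inverse (real (Suc m))<..}" "\<omega> \<in> space M"
        using \<omega> by blast+
      ultimately show "\<omega> \<in> {\<omega> \<in> space M. r \<le> eigenvalue_count (A \<omega>) {t..}}" by simp
    qed
    also have "\<dots> \<in> sets M"
      by (rule sets.countable_INT) (use measurable_eigenvalue_count_greater[OF assms] in auto)
    finally show "{\<omega> \<in> space M. r \<le> eigenvalue_count (A \<omega>) {t..}} \<in> sets M" .
  qed
qed

section \<open>Regularly varying tails and truncated moments\<close>

lemma dyadic_scale:
  fixes x x0 :: real
  assumes x0: "x0 > 0" and x: "x \<ge> x0"
  obtains k where "2 ^ k * x0 \<le> x" "x < 2 ^ Suc k * x0"
proof -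
  define k where "k = nat \<lfloor>log 2 (x / x0)\<rfloor>"
  have "log 2 (x / x0) \<ge> 0" using x x0 by simp
  hence k: "real k \<le> log 2 (x / x0)" "log 2 (x / x0) < real (k + 1)"
    unfolding k_def by linarith+
  have k1: "2 ^ k * x0 \<le> x"
  proof -
    have "2 powr real k \<le> x / x0" using k(1) x x0 by (simp add: le_log_iff)
    thus ?thesis using x0 by (simp add: powr_realpow field_simps)
  qed
  have k2: "x < 2 ^ Suc k * x0"
  proof -
    have "x / x0 < 2 powr real (Suc k)" using k(2) x x0 by (subst (asm) log_less_iff) auto
    also have "2 powr real (Suc k) = 2 ^ Suc k" by (rule powr_realpow) simp
    finally show ?thesis using x0 by (simp add: field_simps)
  qed
  show ?thesis using that[OF k1 k2] .
qed

text \<open>A nonincreasing regularly varying tail. Besides positivity, all that is used of slow variation is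
\<open>h (2 x) / h x \<rightarrow> 1\<close>; with monotonicity it yields the power bounds \<open>tail_upper\<close> and \<open>tail_lower\<close> by iteration along the
scales \<open>2\<^sup>k x\<^sub>0\<close>.\<close>

locale regular_tail =
  fixes \<alpha> :: real and h G :: "real \<Rightarrow> real"
  assumes h: "slowly_varying h"
    and G: "\<And>t. t > 0 \<Longrightarrow> G t = h t / t powr \<alpha>"
    and anti: "\<And>s t. 0 < s \<Longrightarrow> s \<le> t \<Longrightarrow> G t \<le> G s"
begin

lemma G_pos: "t > 0 \<Longrightarrow> G t > 0"
  using h by (simp add: G slowly_varying_def)

lemma doubling_limit: "((\<lambda>x. G (2 * x) / G x) \<longlongrightarrow> 2 powr (- \<alpha>)) at_top"
proof -
  have "((\<lambda>x. h (2 * x) / h x * 2 powr (- \<alpha>)) \<longlongrightarrow> 1 * 2 powr (- \<alpha>)) at_top"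
    using h unfolding slowly_varying_def by (intro tendsto_intros) auto
  moreover have "eventually (\<lambda>x. h (2 * x) / h x * 2 powr (- \<alpha>) = G (2 * x) / G x) at_top"
    using eventually_gt_at_top[of 0]
    by eventually_elim (simp add: G powr_mult powr_minus divide_simps)
  ultimately show ?thesis by (simp add: filterlim_cong[OF refl refl])
qed

lemma tail_upper:
  assumes "\<beta> < \<alpha>" "\<beta> > 0"
  obtains C x0 where "C > 0" "x0 > 0" "\<And>x. x \<ge> x0 \<Longrightarrow> G x \<le> C * x powr (- \<beta>)"
proof -
  have "eventually (\<lambda>x. G (2 * x) / G x < 2 powr (- \<beta>)) at_top"
    using order_tendstoD(2)[OF doubling_limit, of "2 powr (- \<beta>)"] assms by simp
  then obtain x1 where x1: "\<And>x. x \<ge> x1 \<Longrightarrow> G (2 * x) / G x < 2 powr (- \<beta>)"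
    by (auto simp: eventually_at_top_linorder)
  define x0 where "x0 = max x1 1"
  have x0: "x0 > 0" by (simp add: x0_def)
  have step: "G (2 * x) \<le> 2 powr (- \<beta>) * G x" if "x \<ge> x0" for x
    using x1[of x] that G_pos[of x] by (simp add: x0_def field_simps)
  have it: "G (2 ^ k * x0) \<le> (2 ^ k) powr (- \<beta>) * G x0" for k
  proof (induction k)
    case (Suc k)
    have "G (2 ^ Suc k * x0) \<le> 2 powr (- \<beta>) * G (2 ^ k * x0)"
      using step[of "2 ^ k * x0"] x0 by (simp add: mult_ac)
    also have "\<dots> \<le> 2 powr (- \<beta>) * ((2 ^ k) powr (- \<beta>) * G x0)"
      by (intro mult_left_mono Suc) auto
    finally show ?case by (simp add: powr_mult mult_ac)
  qed simp
  show ?thesis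
  proof
    show "2 powr \<beta> * x0 powr \<beta> * G x0 > 0" using x0 G_pos by simp
    show "x0 > 0" by fact
    fix x assume x: "x \<ge> x0"
    obtain k where k1: "2 ^ k * x0 \<le> x" and k2: "x < 2 ^ Suc k * x0"
      using dyadic_scale[OF x0 x] by blast
    have "G x \<le> G (2 ^ k * x0)" using k1 x0 by (intro anti) auto
    also have "\<dots> \<le> (2 ^ k) powr (- \<beta>) * G x0" by (rule it)
    also have "(2 ^ k) powr (- \<beta>) = (2 * x0) powr \<beta> * (2 ^ Suc k * x0) powr (- \<beta>)"
      using x0 by (simp add: powr_mult powr_minus field_simps)
    also have "(2 * x0) powr \<beta> * (2 ^ Suc k * x0) powr (- \<beta>) * G x0 \<le> (2 * x0) powr \<beta> * x powr (- \<beta>) * G x0"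
      using k2 x x0 G_pos[of x0] assms
      by (intro mult_right_mono mult_left_mono powr_mono2') auto
    finally show "G x \<le> 2 powr \<beta> * x0 powr \<beta> * G x0 * x powr (- \<beta>)"
      using x0 by (simp add: powr_mult mult_ac)
  qed
qed

lemma tail_lower:
  assumes "\<beta> > \<alpha>" "\<beta> > 0"
  obtains c x0 where "c > 0" "x0 > 0" "\<And>x. x \<ge> x0 \<Longrightarrow> c * x powr (- \<beta>) \<le> G x"
proof -
  have "eventually (\<lambda>x. G (2 * x) / G x > 2 powr (- \<beta>)) at_top"
    using order_tendstoD(1)[OF doubling_limit, of "2 powr (- \<beta>)"] assms by simp
  then obtain x1 where x1: "\<And>x. x \<ge> x1 \<Longrightarrow> G (2 * x) / G x > 2 powr (- \<beta>)"
    by (auto simp: eventually_at_top_linorder)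
  define x0 where "x0 = max x1 1"
  have x0: "x0 > 0" by (simp add: x0_def)
  have step: "G (2 * x) \<ge> 2 powr (- \<beta>) * G x" if "x \<ge> x0" for x
    using x1[of x] that G_pos[of x] by (simp add: x0_def field_simps)
  have it: "G (2 ^ k * x0) \<ge> (2 ^ k) powr (- \<beta>) * G x0" for k
  proof (induction k)
    case (Suc k)
    have "2 powr (- \<beta>) * ((2 ^ k) powr (- \<beta>) * G x0) \<le> 2 powr (- \<beta>) * G (2 ^ k * x0)"
      by (intro mult_left_mono Suc) auto
    also have "\<dots> \<le> G (2 ^ Suc k * x0)"
      using step[of "2 ^ k * x0"] x0 by (simp add: mult_ac)
    finally show ?case by (simp add: powr_mult mult_ac)
  qed simp
  show ?thesis
  proof
    show "2 powr (- \<beta>) * x0 powr \<beta> * G x0 > 0" using x0 G_pos by simp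
    show "x0 > 0" by fact
    fix x assume x: "x \<ge> x0"
    obtain k where k1: "2 ^ k * x0 \<le> x" and k2: "x < 2 ^ Suc k * x0"
      using dyadic_scale[OF x0 x] by blast
    have "2 powr (- \<beta>) * x0 powr \<beta> * G x0 * x powr (- \<beta>) \<le> 2 powr (- \<beta>) * x0 powr \<beta> * G x0 * (2 ^ k * x0) powr (- \<beta>)"
      using k1 x x0 G_pos[of x0] assms
      by (intro mult_left_mono powr_mono2') auto
    also have "\<dots> = (2 ^ Suc k) powr (- \<beta>) * G x0"
      using x0 by (simp add: powr_mult powr_minus field_simps)
    also have "\<dots> \<le> G (2 ^ Suc k * x0)" by (rule it)
    also have "\<dots> \<le> G x" using k2 x x0 by (intro anti) auto
    finally show "2 powr (- \<beta>) * x0 powr \<beta> * G x0 * x powr (- \<beta>) \<le> G x" .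
  qed
qed

end

text \<open>The bound does not depend on the truncation level \<open>R\<close>: it comes from
\<open>Y\<^sup>p \<le> x\<^sub>0\<^sup>p + (\<Sum>k. (2\<^sup>k\<^sup>+\<^sup>1 x\<^sub>0)\<^sup>p 1{Y > 2\<^sup>k x\<^sub>0})\<close> and a geometric series.\<close>

lemma (in prob_space) truncated_moment_le:
  fixes Y :: "'a \<Rightarrow> real"
  assumes Y [measurable]: "Y \<in> borel_measurable M" and Y0: "\<And>\<omega>. Y \<omega> \<ge> 0"
    and C: "C > 0" "x0 > 0" and p: "0 < p" "p < \<beta>"
    and tail: "\<And>t. t \<ge> x0 \<Longrightarrow> prob {\<omega> \<in> space M. Y \<omega> > t} \<le> C * t powr (- \<beta>)"
  shows "expectation (\<lambda>\<omega>. if Y \<omega> \<le> R then Y \<omega> powr p else 0)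
      \<le> x0 powr p + C * 2 powr p * x0 powr (p - \<beta>) / (1 - 2 powr (p - \<beta>))"
proof -
  define K where "K = nat \<lceil>log 2 (max R x0 / x0)\<rceil>"
  have K: "R \<le> 2 ^ K * x0"
  proof -
    have pos: "max R x0 / x0 > 0" using C by (simp add: zero_less_divide_iff)
    have "log 2 (max R x0 / x0) \<le> real K" unfolding K_def by linarith
    hence "max R x0 / x0 \<le> 2 powr real K" using pos by (subst (asm) log_le_iff) auto
    thus ?thesis using C by (simp add: powr_realpow field_simps)
  qed
  have pt: "(if Y \<omega> \<le> R then Y \<omega> powr p else 0)
     \<le> x0 powr p + (\<Sum>k<K. (2 ^ Suc k * x0) powr p * indicator {\<omega> \<in> space M. Y \<omega> > 2 ^ k * x0} \<omega>)"
    if \<omega>: "\<omega> \<in> space M" for \<omega>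
  proof -
    have nn: "0 \<le> (\<Sum>k<K. (2 ^ Suc k * x0) powr p * indicator {\<omega> \<in> space M. Y \<omega> > 2 ^ k * x0} \<omega>)"
      by (intro sum_nonneg) auto
    consider "Y \<omega> > R" | "Y \<omega> \<le> x0" | "Y \<omega> \<le> R" "x0 < Y \<omega>" by linarith
    thus ?thesis
    proof cases
      case 1
      thus ?thesis using nn by simp
    next
      case 2
      hence "Y \<omega> powr p \<le> x0 powr p" using Y0 p by (intro powr_mono2) auto
      thus ?thesis using nn by simp
    next
      case 3
      have "\<exists>k<K. 2 ^ k * x0 < Y \<omega> \<and> Y \<omega> \<le> 2 ^ Suc k * x0"
      proof -
        define k where "k = (LEAST k. Y \<omega> \<le> 2 ^ k * x0)"
        have YK: "Y \<omega> \<le> 2 ^ K * x0" using 3 K by linarith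
        have k: "Y \<omega> \<le> 2 ^ k * x0" unfolding k_def by (rule LeastI[of _ K]) (rule YK)
        have "k \<noteq> 0" using k 3 by (intro notI) simp
        then obtain j where j: "k = Suc j" by (cases k) auto
        have "k \<le> K" unfolding k_def by (rule Least_le) (rule YK)
        moreover have "\<not> Y \<omega> \<le> 2 ^ j * x0"
          using not_less_Least[of j "\<lambda>k. Y \<omega> \<le> 2 ^ k * x0"] j by (simp add: k_def)
        ultimately show ?thesis using k j by (intro exI[of _ j]) auto
      qed
      then obtain k where k: "k < K" "2 ^ k * x0 < Y \<omega>" "Y \<omega> \<le> 2 ^ Suc k * x0" by blast
      have "Y \<omega> powr p \<le> (2 ^ Suc k * x0) powr p" using k(3) Y0 p by (intro powr_mono2) auto
      also have "\<dots> = (2 ^ Suc k * x0) powr p * indicator {\<omega> \<in> space M. Y \<omega> > 2 ^ k * x0} \<omega>"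
        using k \<omega> by simp
      also have "\<dots> \<le> (\<Sum>k<K. (2 ^ Suc k * x0) powr p * indicator {\<omega> \<in> space M. Y \<omega> > 2 ^ k * x0} \<omega>)"
        using k(1) by (intro member_le_sum) auto
      finally show ?thesis using 3 by (simp add: add_increasing)
    qed
  qed
  have "expectation (\<lambda>\<omega>. if Y \<omega> \<le> R then Y \<omega> powr p else 0)
     \<le> expectation (\<lambda>\<omega>. x0 powr p + (\<Sum>k<K. (2 ^ Suc k * x0) powr p * indicator {\<omega> \<in> space M. Y \<omega> > 2 ^ k * x0} \<omega>))"
  proof (rule integral_mono)
    show "integrable M (\<lambda>\<omega>. if Y \<omega> \<le> R then Y \<omega> powr p else 0)"
    proof (rule integrable_const_bound[where B = "\<bar>R\<bar> powr p"])
      show "AE \<omega> in M. norm (if Y \<omega> \<le> R then Y \<omega> powr p else 0) \<le> \<bar>R\<bar> powr p"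
        using Y0 p by (intro AE_I2) (auto intro!: powr_mono2)
    qed measurable
    show "integrable M (\<lambda>\<omega>. x0 powr p + (\<Sum>k<K. (2 ^ Suc k * x0) powr p * indicator {\<omega> \<in> space M. Y \<omega> > 2 ^ k * x0} \<omega>))"
      by (intro Bochner_Integration.integrable_add Bochner_Integration.integrable_sum integrable_mult_right
          integrable_const integrable_real_indicator) (auto simp: emeasure_eq_measure)
  qed (rule pt)
  also have "\<dots> = x0 powr p + (\<Sum>k<K. (2 ^ Suc k * x0) powr p * prob {\<omega> \<in> space M. Y \<omega> > 2 ^ k * x0})"
  proof -
    have int: "integrable M (\<lambda>\<omega>. (2 ^ Suc k * x0) powr p * indicator {\<omega> \<in> space M. Y \<omega> > 2 ^ k * x0} \<omega> :: real)" for k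
      by (intro integrable_mult_right integrable_real_indicator) (auto simp: emeasure_eq_measure)
    have val: "expectation (\<lambda>\<omega>. (2 ^ Suc k * x0) powr p * indicator {\<omega> \<in> space M. Y \<omega> > 2 ^ k * x0} \<omega>)
        = (2 ^ Suc k * x0) powr p * prob {\<omega> \<in> space M. Y \<omega> > 2 ^ k * x0}" for k
    proof -
      have "{\<omega> \<in> space M. Y \<omega> > 2 ^ k * x0} \<inter> space M = {\<omega> \<in> space M. Y \<omega> > 2 ^ k * x0}" by auto
      thus ?thesis by (simp only: integral_mult_right_zero Bochner_Integration.integral_indicator)
    qed
    show ?thesis
      by (subst Bochner_Integration.integral_add, simp, intro Bochner_Integration.integrable_sum int,
          subst Bochner_Integration.integral_sum, rule int) (simp only: val, simp add: prob_space)
  qed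
  also have "(\<Sum>k<K. (2 ^ Suc k * x0) powr p * prob {\<omega> \<in> space M. Y \<omega> > 2 ^ k * x0})
      \<le> (\<Sum>k<K. C * 2 powr p * x0 powr (p - \<beta>) * (2 powr (p - \<beta>)) ^ k)"
  proof (intro sum_mono)
    fix k
    have "prob {\<omega> \<in> space M. Y \<omega> > 2 ^ k * x0} \<le> C * (2 ^ k * x0) powr (- \<beta>)"
      using C by (intro tail) (simp add: mult_le_cancel_right1)
    hence "(2 ^ Suc k * x0) powr p * prob {\<omega> \<in> space M. Y \<omega> > 2 ^ k * x0}
       \<le> (2 ^ Suc k * x0) powr p * (C * (2 ^ k * x0) powr (- \<beta>))" by (intro mult_left_mono) auto
    also have "\<dots> = C * 2 powr p * x0 powr (p - \<beta>) * (2 ^ k) powr (p - \<beta>)"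
      using C by (simp add: powr_mult powr_diff powr_minus divide_simps)
    also have "(2 ^ k :: real) powr (p - \<beta>) = (2 powr (p - \<beta>)) ^ k"
      by (simp add: powr_realpow[symmetric] powr_powr mult.commute)
    finally show "(2 ^ Suc k * x0) powr p * prob {\<omega> \<in> space M. Y \<omega> > 2 ^ k * x0}
       \<le> C * 2 powr p * x0 powr (p - \<beta>) * (2 powr (p - \<beta>)) ^ k" .
  qed
  also have "\<dots> = C * 2 powr p * x0 powr (p - \<beta>) * (\<Sum>k<K. (2 powr (p - \<beta>)) ^ k)"
    by (simp add: sum_distrib_left)
  also have "(\<Sum>k<K. (2 powr (p - \<beta>)) ^ k) \<le> 1 / (1 - 2 powr (p - \<beta>))"
  proof -
    have r: "2 powr (p - \<beta>) < 1" using p by (intro powr_less_one) auto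
    have "(\<Sum>k<K. (2 powr (p - \<beta>)) ^ k) \<le> (\<Sum>k. (2 powr (p - \<beta>)) ^ k)"
      using r by (intro sum_le_suminf summable_geometric) auto
    also have "\<dots> = 1 / (1 - 2 powr (p - \<beta>))" using r by (intro suminf_geometric) auto
    finally show ?thesis .
  qed
  finally show ?thesis using C by (simp add: mult_left_mono)
qed

section \<open>Size of the band and of its rows\<close>

lemma band_dist_comm: "band_dist p n i j = band_dist p n j i"
  by (cases p) (auto simp: abs_minus_commute)

lemma finite_band_indices: "finite (band_indices p n d)"
  by (rule finite_subset[of _ "{..<n} \<times> {..<n}"]) (auto simp: band_indices_def)

lemma card_band_indices_ge:
  assumes "d < n"
  shows "real n * (real d + 1) \<le> 4 * real (card (band_indices p n d))"
proof -
  \<comment> \<open>a rectangle of pairs at distance at most \<open>d div 2\<close> along the diagonal is large enough\<close>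
  define f where "f = (\<lambda>(i :: nat, t :: nat). (i, i + t))"
  have "f ` ({..<n - d div 2} \<times> {..d div 2}) \<subseteq> band_indices p n d"
    using assms by (cases p) (auto simp: f_def band_indices_def)
  hence "card (f ` ({..<n - d div 2} \<times> {..d div 2})) \<le> card (band_indices p n d)"
    by (intro card_mono finite_band_indices)
  moreover have "card (f ` ({..<n - d div 2} \<times> {..d div 2})) = (n - d div 2) * (d div 2 + 1)"
    by (subst card_image) (auto simp: f_def inj_on_def card_cartesian_product)
  ultimately have *: "real (n - d div 2) * real (d div 2 + 1) \<le> real (card (band_indices p n d))"
    by (metis of_nat_le_iff of_nat_mult)
  have "n \<le> 2 * (n - d div 2)" "d + 1 \<le> 2 * (d div 2 + 1)"
    using assms by (linarith, presburger)
  hence "real n \<le> real (2 * (n - d div 2))" "real (d + 1) \<le> real (2 * (d div 2 + 1))"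
    by (simp_all only: of_nat_le_iff)
  hence "real n \<le> 2 * real (n - d div 2)" "real d + 1 \<le> 2 * real (d div 2 + 1)" by simp_all
  hence "real n * (real d + 1) \<le> (2 * real (n - d div 2)) * (2 * real (d div 2 + 1))"
    by (intro mult_mono) auto
  also have "\<dots> = 4 * (real (n - d div 2) * real (d div 2 + 1))" by simp
  finally show ?thesis using * by linarith
qed

text \<open>The independent entries that occur in row \<open>i\<close> of the matrix: \<open>(i, k)\<close> with \<open>i \<le> k\<close>, and \<open>(j, i)\<close> with
\<open>j \<le> i\<close> for the entries left of the diagonal.\<close>

definition row_indices :: "band_type \<Rightarrow> nat \<Rightarrow> nat \<Rightarrow> nat \<Rightarrow> (nat \<times> nat) set" where
  "row_indices p n d i = {e \<in> band_indices p n d. fst e = i \<or> snd e = i}"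

lemma card_row_indices_le: "card (row_indices p n d i) \<le> 4 * (d + 1)"
proof (cases "i < n")
  case False
  hence "row_indices p n d i = {}" by (auto simp: row_indices_def band_indices_def)
  thus ?thesis by simp
next
  case i: True
  \<comment> \<open>the other endpoint of the pair\<close>
  define g where "g = (\<lambda>(j, k). j + k - i :: nat)"
  define T where "T = {i - d..i + d} \<union> ({i + (n - d)..<n} \<union> {..i - (n - d)})"
  have inj: "inj_on g (row_indices p n d i)"
    by (auto simp: inj_on_def g_def row_indices_def band_indices_def)
  have "g ` row_indices p n d i \<subseteq> T"
    by (cases p) (auto simp: T_def g_def row_indices_def band_indices_def)
  hence "card (g ` row_indices p n d i) \<le> card T"
    by (rule card_mono[rotated]) (simp add: T_def)
  also have "card (g ` row_indices p n d i) = card (row_indices p n d i)" by (rule card_image[OF inj])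
  also have "card T \<le> card {i - d..i + d} + (card {i + (n - d)..<n} + card {..i - (n - d)})"
    unfolding T_def by (intro order_trans[OF card_Un_le] add_mono order_refl card_Un_le)
  also have "\<dots> \<le> 4 * (d + 1)" using i by simp
  finally show ?thesis .
qed

section \<open>A Chernoff bound for sums of bounded variables\<close>

lemma exp_le_affine:
  fixes x :: real
  assumes "0 \<le> x" "x \<le> \<epsilon>" "\<epsilon> > 0"
  shows "exp (\<theta> * x) \<le> 1 + x * (exp (\<theta> * \<epsilon>) / \<epsilon>)"
proof -
  have "exp ((1 - x / \<epsilon>) *\<^sub>R 0 + (x / \<epsilon>) *\<^sub>R (\<theta> * \<epsilon>)) \<le> (1 - x / \<epsilon>) * exp 0 + (x / \<epsilon>) * exp (\<theta> * \<epsilon>)"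
    by (rule convex_onD[OF exp_convex]) (use assms in auto)
  also have "\<dots> \<le> 1 + x * (exp (\<theta> * \<epsilon>) / \<epsilon>)" using assms by simp
  also have "(1 - x / \<epsilon>) *\<^sub>R 0 + (x / \<epsilon>) *\<^sub>R (\<theta> * \<epsilon>) = \<theta> * x" using assms by simp
  finally show ?thesis .
qed

lemma (in prob_space) prob_bounded_sum_ge_le:
  fixes X :: "'i \<Rightarrow> 'a \<Rightarrow> real"
  assumes I: "finite I" and ind: "indep_vars (\<lambda>_. borel) X I"
    and X: "\<And>i \<omega>. i \<in> I \<Longrightarrow> \<omega> \<in> space M \<Longrightarrow> 0 \<le> X i \<omega> \<and> X i \<omega> \<le> \<epsilon>"
    and \<epsilon>: "\<epsilon> > 0" and \<theta>: "\<theta> > 0"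
    and m: "\<And>i. i \<in> I \<Longrightarrow> expectation (X i) \<le> m" "m \<ge> 0"
  shows "prob {\<omega> \<in> space M. (\<Sum>i\<in>I. X i \<omega>) \<ge> a} \<le> exp (- \<theta> * a + card I * (m * (exp (\<theta> * \<epsilon>) / \<epsilon>)))"
proof -
  have rv [measurable]: "X i \<in> borel_measurable M" if "i \<in> I" for i
    using ind that by (simp add: indep_vars_def2)
  have intX: "integrable M (X i)" if "i \<in> I" for i
    by (rule integrable_const_bound[where B = \<epsilon>]) (use X[OF that] rv[OF that] in \<open>auto intro!: AE_I2\<close>)
  define Z where "Z i \<omega> = exp (\<theta> * X i \<omega>)" for i \<omega>
  have indZ: "indep_vars (\<lambda>_. borel) Z I"
    unfolding Z_def by (rule indep_vars_compose2[OF ind]) auto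
  have rvZ [measurable]: "Z i \<in> borel_measurable M" if "i \<in> I" for i
    using indZ that by (simp add: indep_vars_def2)
  have intZ: "integrable M (Z i)" if "i \<in> I" for i
    by (rule integrable_const_bound[where B = "exp (\<theta> * \<epsilon>)"])
       (use X[OF that] rvZ[OF that] \<theta> in \<open>auto intro!: AE_I2 simp: Z_def\<close>)
  have EZ: "expectation (Z i) \<le> exp (m * (exp (\<theta> * \<epsilon>) / \<epsilon>))" if i: "i \<in> I" for i
  proof -
    have "expectation (Z i) \<le> expectation (\<lambda>\<omega>. 1 + X i \<omega> * (exp (\<theta> * \<epsilon>) / \<epsilon>))"
      unfolding Z_def
    proof (rule integral_mono)
      show "integrable M (\<lambda>\<omega>. exp (\<theta> * X i \<omega>))" using intZ[OF i] by (simp add: Z_def[abs_def])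
      show "integrable M (\<lambda>\<omega>. 1 + X i \<omega> * (exp (\<theta> * \<epsilon>) / \<epsilon>))" using intX[OF i] by simp
      show "exp (\<theta> * X i \<omega>) \<le> 1 + X i \<omega> * (exp (\<theta> * \<epsilon>) / \<epsilon>)" if "\<omega> \<in> space M" for \<omega>
        by (rule exp_le_affine) (use X[OF i that] \<epsilon> in auto)
    qed
    also have "\<dots> = 1 + expectation (X i) * (exp (\<theta> * \<epsilon>) / \<epsilon>)"
      using intX[OF i] by (simp add: prob_space)
    also have "\<dots> \<le> 1 + m * (exp (\<theta> * \<epsilon>) / \<epsilon>)"
      using m(1)[OF i] \<epsilon> by (intro add_mono mult_right_mono) auto
    also have "\<dots> \<le> exp (m * (exp (\<theta> * \<epsilon>) / \<epsilon>))" by (rule exp_ge_add_one_self)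
    finally show ?thesis .
  qed
  have prodZ: "(\<Prod>i\<in>I. Z i \<omega>) = exp (\<theta> * (\<Sum>i\<in>I. X i \<omega>))" for \<omega>
    by (simp add: Z_def exp_sum[OF I, symmetric] sum_distrib_left)
  have "{\<omega> \<in> space M. (\<Sum>i\<in>I. X i \<omega>) \<ge> a} = {\<omega> \<in> space M. (\<Prod>i\<in>I. Z i \<omega>) \<ge> exp (\<theta> * a)}"
    unfolding prodZ using \<theta> by simp
  also have "prob \<dots> \<le> expectation (\<lambda>\<omega>. \<Prod>i\<in>I. Z i \<omega>) / exp (\<theta> * a)"
  proof (rule integral_Markov_inequality_measure[where A = "{}"])
    show "integrable M (\<lambda>\<omega>. \<Prod>i\<in>I. Z i \<omega>)"
      by (rule indep_vars_integrable[OF I indZ intZ])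
  qed (auto simp: Z_def intro!: prod_nonneg)
  also have "expectation (\<lambda>\<omega>. \<Prod>i\<in>I. Z i \<omega>) = (\<Prod>i\<in>I. expectation (Z i))"
    by (rule indep_vars_lebesgue_integral[OF I indZ intZ])
  also have "\<dots> \<le> (\<Prod>i\<in>I. exp (m * (exp (\<theta> * \<epsilon>) / \<epsilon>)))"
    by (intro prod_mono conjI EZ integral_nonneg_AE) (auto simp: Z_def)
  also have "\<dots> = exp (card I * (m * (exp (\<theta> * \<epsilon>) / \<epsilon>)))"
    by (simp only: prod_constant exp_of_nat_mult)
  finally show ?thesis by (simp add: divide_right_mono exp_diff[symmetric])
qed

section \<open>Multinomial counts and their Poisson limit\<close>

text \<open>Each of independent equally distributed objects \<open>e\<close> has a random colour \<open>c e\<close>. The probability of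
a prescribed multiset \<open>S\<close> of colours is the sum over its arrangements along an enumeration of \<open>J\<close>.\<close>

lemma (in prob_space) prob_colour_counts:
  fixes c :: "'i \<Rightarrow> 'a \<Rightarrow> nat" and q :: "nat \<Rightarrow> real"
  assumes J: "finite J" and ind: "indep_vars (\<lambda>_. count_space UNIV) c J"
    and law: "\<And>e r. e \<in> J \<Longrightarrow> prob {\<omega> \<in> space M. c e \<omega> = r} = q r"
    and S: "size S = card J"
  shows "prob {\<omega> \<in> space M. image_mset (\<lambda>e. c e \<omega>) (mset_set J) = S}
    = card (permutations_of_multiset S) * (\<Prod>r\<in>#S. q r)"
proof -
  obtain es where es: "distinct es" "set es = J" using finite_distinct_list[OF J] by metis
  have len: "length es = card J" using es distinct_card by metis
  have ms: "mset_set J = mset es" using es by (metis mset_set_set)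
  define E where "E l = {\<omega> \<in> space M. map (\<lambda>e. c e \<omega>) es = l}" for l
  have rv: "c e \<in> measurable M (count_space UNIV)" if "e \<in> J" for e
    using ind that by (simp add: indep_vars_def2)
  have Eprob: "E l \<in> sets M \<and> prob (E l) = (\<Prod>r\<leftarrow>l. q r)" if l: "length l = length es" for l
  proof -
    define v where "v e = l ! (THE i. i < length es \<and> es ! i = e)" for e
    have v: "v (es ! i) = l ! i" if "i < length es" for i
    proof -
      have "(THE j. j < length es \<and> es ! j = es ! i) = i"
        using that es(1) by (intro the_equality) (auto simp: nth_eq_iff_index_eq)
      thus ?thesis by (simp add: v_def)
    qed
    have lv: "l = map v es" using l by (intro nth_equalityI) (auto simp: v)
    have E: "E l = {\<omega> \<in> space M. \<forall>e\<in>J. c e \<omega> = v e}"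
      unfolding E_def lv using es by (auto simp: map_eq_conv)
    show ?thesis
    proof (cases "J = {}")
      case True
      hence "es = []" using es by simp
      thus ?thesis using E True l by (simp add: prob_space)
    next
      case False
      have E': "E l = (\<Inter>e\<in>J. c e -` {v e} \<inter> space M)" unfolding E using False by auto
      have "prob (E l) = (\<Prod>e\<in>J. prob (c e -` {v e} \<inter> space M))"
        unfolding E' by (rule indep_varsD_finite[OF ind False J]) auto
      also have "\<dots> = (\<Prod>e\<in>J. q (v e))"
        by (intro prod.cong refl) (simp flip: law add: vimage_def Int_def conj_commute)
      also have "\<dots> = (\<Prod>e\<leftarrow>es. q (v e))" using es by (metis prod.distinct_set_conv_list)
      also have "\<dots> = (\<Prod>r\<leftarrow>l. q r)" unfolding lv by (simp add: o_def)
      finally have "prob (E l) = (\<Prod>r\<leftarrow>l. q r)" .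
      moreover have "E l \<in> sets M"
        unfolding E' by (rule sets.finite_INT[OF J False]) (use rv in \<open>auto intro: measurable_sets\<close>)
      ultimately show ?thesis by simp
    qed
  qed
  have lenl: "length l = length es" if "l \<in> permutations_of_multiset S" for l
    using that S len by (metis permutations_of_multisetD size_mset)
  have "{\<omega> \<in> space M. image_mset (\<lambda>e. c e \<omega>) (mset_set J) = S} = (\<Union>l\<in>permutations_of_multiset S. E l)"
    by (auto simp: ms E_def permutations_of_multiset_def)
  also have "prob \<dots> = (\<Sum>l\<in>permutations_of_multiset S. prob (E l))"
    by (rule finite_measure_finite_Union) (use Eprob lenl in \<open>auto simp: disjoint_family_on_def E_def\<close>)
  also have "\<dots> = (\<Sum>l\<in>permutations_of_multiset S. (\<Prod>r\<in>#S. q r))"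
  proof (intro sum.cong refl)
    fix l assume l: "l \<in> permutations_of_multiset S"
    hence "mset l = S" by (simp add: permutations_of_multiset_def)
    hence "(\<Prod>r\<leftarrow>l. q r) = (\<Prod>r\<in>#S. q r)" by (metis prod_mset_prod_list mset_map)
    thus "prob (E l) = (\<Prod>r\<in>#S. q r)" using Eprob[OF lenl[OF l]] by simp
  qed
  finally show ?thesis by simp
qed

lemma one_minus_power_limit:
  fixes p :: "nat \<Rightarrow> real" and m :: "nat \<Rightarrow> nat"
  assumes p: "p \<longlonglongrightarrow> 0" "\<And>n. p n \<ge> 0" and mp: "(\<lambda>n. real (m n) * p n) \<longlonglongrightarrow> \<mu>"
  shows "(\<lambda>n. (1 - p n) ^ m n) \<longlonglongrightarrow> exp (- \<mu>)"
proof (rule tendsto_sandwich)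
  have ev: "eventually (\<lambda>n. p n < 1) sequentially" using order_tendstoD(2)[OF p(1)] by simp
  show "eventually (\<lambda>n. exp (- (real (m n) * p n / (1 - p n))) \<le> (1 - p n) ^ m n) sequentially"
    using ev
  proof eventually_elim
    case (elim n)
    have "1 / (1 - p n) = 1 + p n / (1 - p n)" using elim by (simp add: field_simps)
    also have "\<dots> \<le> exp (p n / (1 - p n))" by (rule exp_ge_add_one_self)
    finally have "exp (- (p n / (1 - p n))) \<le> 1 - p n"
      using elim by (simp add: exp_minus field_simps)
    hence "exp (- (p n / (1 - p n))) ^ m n \<le> (1 - p n) ^ m n" by (intro power_mono) auto
    thus ?case by (simp flip: exp_of_nat_mult)
  qed
  show "eventually (\<lambda>n. (1 - p n) ^ m n \<le> exp (- (real (m n) * p n))) sequentially"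
    using ev
  proof eventually_elim
    case (elim n)
    have "(1 - p n) ^ m n \<le> exp (- p n) ^ m n"
      using exp_ge_add_one_self[of "- p n"] elim by (intro power_mono) auto
    thus ?case by (simp flip: exp_of_nat_mult)
  qed
  have "(\<lambda>n. exp (- (real (m n) * p n / (1 - p n)))) \<longlonglongrightarrow> exp (- (\<mu> / (1 - 0)))"
    by (intro tendsto_intros mp p) auto
  thus "(\<lambda>n. exp (- (real (m n) * p n / (1 - p n)))) \<longlonglongrightarrow> exp (- \<mu>)" by simp
  show "(\<lambda>n. exp (- (real (m n) * p n))) \<longlonglongrightarrow> exp (- \<mu>)"
    by (intro tendsto_intros mp)
qed

text \<open>The multiset of \<open>N\<close> colours in which \<open>r \<in> {1..k}\<close> occurs \<open>s r\<close> times and all others are \<open>0\<close>. It is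
meant for \<open>N\<close> at least the sum of the \<open>s r\<close>; otherwise the subtraction is truncated.\<close>

definition colour_mset :: "nat \<Rightarrow> (nat \<Rightarrow> nat) \<Rightarrow> nat \<Rightarrow> nat multiset" where
  "colour_mset k s N = (\<Sum>r\<in>{1..k}. replicate_mset (s r) r) + replicate_mset (N - (\<Sum>r\<in>{1..k}. s r)) 0"

lemma count_colour_mset:
  "count (colour_mset k s N) r = (if r = 0 then N - (\<Sum>r\<in>{1..k}. s r) else if r \<le> k then s r else 0)"
proof -
  have "count (\<Sum>r\<in>{1..k}. replicate_mset (s r) r) x = (if 1 \<le> x \<and> x \<le> k then s x else 0)" for x
    by (simp add: count_sum if_distrib cong: if_cong) 
  thus ?thesis by (auto simp: colour_mset_def)
qed

lemma size_colour_mset: "(\<Sum>r\<in>{1..k}. s r) \<le> N \<Longrightarrow> size (colour_mset k s N) = N"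
  by (simp add: colour_mset_def size_multiset_sum)

text \<open>The multinomial probability in a form in which every factor converges.\<close>

lemma multinomial_weight:
  fixes q :: "nat \<Rightarrow> real"
  assumes m: "m = (\<Sum>r\<in>{1..k}. s r)" "m \<le> N" "N > 0"
  shows "real (card (permutations_of_multiset (colour_mset k s N))) * (\<Prod>r\<in>#colour_mset k s N. q r)
     = (\<Prod>i<m. 1 - real i / real N) * (\<Prod>r\<in>{1..k}. (real N * q r) ^ s r / fact (s r)) * q 0 ^ (N - m)"
proof -
  let ?S = "colour_mset k s N"
  have "(\<Prod>r\<in>set_mset ?S. fact (count ?S r)) = (\<Prod>r\<in>{0..k}. fact (count ?S r) :: nat)"
    by (rule prod.mono_neutral_left)
       (auto simp: count_colour_mset not_in_iff simp flip: count_greater_zero_iff split: if_splits)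
  also have "{0..k} = insert 0 {1..k}" by auto
  also have "(\<Prod>r\<in>insert 0 {1..k}. fact (count ?S r) :: nat) = fact (N - m) * (\<Prod>r\<in>{1..k}. fact (s r))"
    by (simp add: count_colour_mset m)
  finally have "card (permutations_of_multiset ?S) * (fact (N - m) * (\<Prod>r\<in>{1..k}. fact (s r))) = fact N"
    using card_permutations_of_multiset_aux[of ?S] size_colour_mset[of s k N] m by simp
  hence "real (card (permutations_of_multiset ?S) * (fact (N - m) * (\<Prod>r\<in>{1..k}. fact (s r)))) = real (fact N)"
    by simp
  hence card: "real (card (permutations_of_multiset ?S)) * (\<Prod>r\<in>{1..k}. fact (s r)) = fact N / fact (N - m)"
    by (simp add: field_simps)
  have "fact N / fact (N - m) = (\<Prod>i<m. real N - real i)"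
    using m(2)
  proof (induction m)
    case (Suc m)
    have "fact (N - m) = (real N - real m) * fact (N - Suc m)"
      using Suc.prems by (subst fact_reduce) (auto simp: of_nat_diff)
    hence "fact N / fact (N - Suc m) = fact N / fact (N - m) * (real N - real m)"
      using Suc.prems by simp
    thus ?case using Suc by simp
  qed simp
  also have "\<dots> = (\<Prod>i<m. real N * (1 - real i / real N))"
    using m(3) by (intro prod.cong refl) (simp add: field_simps)
  also have "\<dots> = real N ^ m * (\<Prod>i<m. 1 - real i / real N)"
    by (simp add: prod.distrib)
  finally have fN: "fact N / fact (N - m) = real N ^ m * (\<Prod>i<m. 1 - real i / real N)" .
  have "(\<Prod>r\<in>#(\<Sum>r\<in>A. replicate_mset (s r) r). q r) = (\<Prod>r\<in>A. q r ^ s r)" if "finite A" for A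
    using that by (induction A rule: finite_induct) auto
  hence w: "(\<Prod>r\<in>#?S. q r) = (\<Prod>r\<in>{1..k}. q r ^ s r) * q 0 ^ (N - m)"
    by (simp add: colour_mset_def m(1))
  have Nm: "real N ^ m = (\<Prod>r\<in>{1..k}. real N ^ s r)" unfolding m(1) by (simp add: power_sum)
  have nz: "(\<Prod>r\<in>{1..k}. fact (s r) :: real) \<noteq> 0" by simp
  have "real (card (permutations_of_multiset ?S)) = real N ^ m * (\<Prod>i<m. 1 - real i / real N) / (\<Prod>r\<in>{1..k}. fact (s r))"
    using card fN nz by (simp add: field_simps)
  thus ?thesis unfolding w Nm
    by (simp add: prod_dividef prod.distrib power_mult_distrib)
qed

lemma multinomial_Poisson_limit:
  fixes N :: "nat \<Rightarrow> nat" and q :: "nat \<Rightarrow> nat \<Rightarrow> real"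
  assumes N: "filterlim N at_top sequentially"
    and q: "\<And>n r. q n r \<ge> 0" "\<And>n. q n 0 = 1 - (\<Sum>r\<in>{1..k}. q n r)"
    and lim: "\<And>r. r \<in> {1..k} \<Longrightarrow> (\<lambda>n. real (N n) * q n r) \<longlonglongrightarrow> \<mu> r"
  shows "(\<lambda>n. real (card (permutations_of_multiset (colour_mset k s (N n)))) * (\<Prod>r\<in>#colour_mset k s (N n). q n r))
     \<longlonglongrightarrow> (\<Prod>r\<in>{1..k}. \<mu> r ^ s r / fact (s r) * exp (- \<mu> r))"
proof -
  define m where "m = (\<Sum>r\<in>{1..k}. s r)"
  define p where "p n = (\<Sum>r\<in>{1..k}. q n r)" for n
  have Nreal: "filterlim (\<lambda>n. real (N n)) at_top sequentially"
    by (rule filterlim_compose[OF filterlim_real_sequentially N])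
  have Ninv: "(\<lambda>n. c / real (N n)) \<longlonglongrightarrow> 0" for c
    by (rule tendsto_divide_0[OF tendsto_const filterlim_at_top_imp_at_infinity[OF Nreal]])
  have N1: "eventually (\<lambda>n. N n \<ge> Suc m) sequentially"
    using N by (simp add: filterlim_at_top)
  have Np: "(\<lambda>n. real (N n) * p n) \<longlonglongrightarrow> (\<Sum>r\<in>{1..k}. \<mu> r)"
    unfolding p_def sum_distrib_left by (intro tendsto_sum lim)
  have p0: "p \<longlonglongrightarrow> 0"
  proof -
    have "(\<lambda>n. real (N n) * p n * (1 / real (N n))) \<longlonglongrightarrow> (\<Sum>r\<in>{1..k}. \<mu> r) * 0"
      by (intro tendsto_intros Np Ninv)
    moreover have "eventually (\<lambda>n. real (N n) * p n * (1 / real (N n)) = p n) sequentially"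
      using N1 by eventually_elim auto
    ultimately show ?thesis by (simp add: filterlim_cong[OF refl refl])
  qed
  have "(\<lambda>n. (real (N n) * p n) - real m * p n) \<longlonglongrightarrow> (\<Sum>r\<in>{1..k}. \<mu> r) - real m * 0"
    by (intro tendsto_intros Np p0)
  moreover have "eventually (\<lambda>n. real (N n) * p n - real m * p n = real (N n - m) * p n) sequentially"
    using N1 by eventually_elim (simp add: of_nat_diff left_diff_distrib)
  ultimately have Nmp: "(\<lambda>n. real (N n - m) * p n) \<longlonglongrightarrow> (\<Sum>r\<in>{1..k}. \<mu> r)"
    by (simp add: filterlim_cong[OF refl refl])
  have "(\<lambda>n. (1 - p n) ^ (N n - m)) \<longlonglongrightarrow> exp (- (\<Sum>r\<in>{1..k}. \<mu> r))"
    by (rule one_minus_power_limit[OF p0 _ Nmp]) (auto simp: p_def intro!: sum_nonneg q)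
  hence "(\<lambda>n. (\<Prod>i<m. 1 - real i / real (N n)) * (\<Prod>r\<in>{1..k}. (real (N n) * q n r) ^ s r / fact (s r)) * (1 - p n) ^ (N n - m))
     \<longlonglongrightarrow> (\<Prod>i<m. 1 - 0) * (\<Prod>r\<in>{1..k}. \<mu> r ^ s r / fact (s r)) * exp (- (\<Sum>r\<in>{1..k}. \<mu> r))"
    by (intro tendsto_intros lim Ninv) auto
  also have "(\<Prod>i<m. 1 - 0) * (\<Prod>r\<in>{1..k}. \<mu> r ^ s r / fact (s r)) * exp (- (\<Sum>r\<in>{1..k}. \<mu> r))
     = (\<Prod>r\<in>{1..k}. \<mu> r ^ s r / fact (s r) * exp (- \<mu> r))"
    by (simp only: sum_negf[symmetric] exp_sum[OF finite_atLeastAtMost] prod.distrib) simp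
  finally show ?thesis
  proof (rule Lim_transform_eventually)
    show "eventually (\<lambda>n. (\<Prod>i<m. 1 - real i / real (N n)) * (\<Prod>r\<in>{1..k}. (real (N n) * q n r) ^ s r / fact (s r)) * (1 - p n) ^ (N n - m)
      = real (card (permutations_of_multiset (colour_mset k s (N n)))) * (\<Prod>r\<in>#colour_mset k s (N n). q n r)) sequentially"
      using N1
    proof eventually_elim
      case (elim n)
      hence "m \<le> N n" "0 < N n" by auto
      from multinomial_weight[OF m_def this, of "q n"] show ?case by (simp add: p_def q(2))
    qed
  qed
qed

section \<open>Band matrices of a fixed size\<close>

text \<open>A random Hermitian band matrix of size \<open>n\<close>, real or complex, reduced to what the argument uses:
the entries with indices in the band are independent, and their moduli have the tail \<open>G\<close>.\<close>

locale band_sample = prob_space M for M :: "'w measure" +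
  fixes p :: band_type and n d :: nat and A :: "'w \<Rightarrow> complex mat" and b :: real and G :: "real \<Rightarrow> real"
  assumes herm: "\<And>\<omega>. \<omega> \<in> space M \<Longrightarrow> hermitian_mat n (A \<omega>)"
    and band: "\<And>\<omega> i j. \<omega> \<in> space M \<Longrightarrow> i < n \<Longrightarrow> j < n \<Longrightarrow> band_dist p n i j > d \<Longrightarrow> A \<omega> $$ (i, j) = 0"
    and ind: "indep_vars (\<lambda>_. borel) (\<lambda>(j, k) \<omega>. A \<omega> $$ (j, k)) (band_indices p n d)"
    and tail: "\<And>e t. e \<in> band_indices p n d \<Longrightarrow> t > 0 \<Longrightarrow> prob {\<omega> \<in> space M. cmod (A \<omega> $$ e) > t} = G t"
    and b: "b > 0"
begin

abbreviation J where "J \<equiv> band_indices p n d"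
abbreviation row where "row \<equiv> row_indices p n d"

text \<open>The rescaled modulus of an entry and the rescaled matrix.\<close>

definition Y :: "nat \<times> nat \<Rightarrow> 'w \<Rightarrow> real" where
  "Y e \<omega> = cmod (A \<omega> $$ e) / b"

definition B :: "'w \<Rightarrow> complex mat" where
  "B \<omega> = complex_of_real (inverse b) \<cdot>\<^sub>m A \<omega>"

lemma finite_J [simp]: "finite J" by (rule finite_band_indices)
lemma finite_row [simp]: "finite (row i)" by (simp add: row_indices_def)
lemma row_subset: "row i \<subseteq> J" by (auto simp: row_indices_def)

lemma Y_nonneg: "Y e \<omega> \<ge> 0" using b by (simp add: Y_def)

lemma indep_Y: "indep_vars (\<lambda>_. borel) Y J"
proof -
  have "indep_vars (\<lambda>_. borel) (\<lambda>e \<omega>. cmod ((\<lambda>(j, k) \<omega>. A \<omega> $$ (j, k)) e \<omega>) / b) J"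
    by (rule indep_vars_compose2[OF ind]) auto
  also have "(\<lambda>e \<omega>. cmod ((\<lambda>(j, k) \<omega>. A \<omega> $$ (j, k)) e \<omega>) / b) = Y"
    by (auto simp: fun_eq_iff Y_def)
  finally show ?thesis .
qed

lemma measurable_Y: "e \<in> J \<Longrightarrow> Y e \<in> borel_measurable M"
  using indep_Y by (simp add: indep_vars_def2)

lemma prob_Y_greater: "e \<in> J \<Longrightarrow> t > 0 \<Longrightarrow> prob {\<omega> \<in> space M. Y e \<omega> > t} = G (b * t)"
  using tail[of e "b * t"] b by (simp add: Y_def field_simps)

lemma sets_Y_greater: "e \<in> J \<Longrightarrow> {\<omega> \<in> space M. Y e \<omega> > t} \<in> sets M"
  using measurable_Y[of e] by measurable

lemma prob_Y_between:
  assumes e: "e \<in> J" and t: "0 < s" "s \<le> t"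
  shows "prob {\<omega> \<in> space M. s < Y e \<omega> \<and> Y e \<omega> \<le> t} = G (b * s) - G (b * t)"
proof -
  have "{\<omega> \<in> space M. s < Y e \<omega> \<and> Y e \<omega> \<le> t} = {\<omega> \<in> space M. Y e \<omega> > s} - {\<omega> \<in> space M. Y e \<omega> > t}"
    by auto
  also have "prob \<dots> = prob {\<omega> \<in> space M. Y e \<omega> > s} - prob {\<omega> \<in> space M. Y e \<omega> > t}"
    by (rule finite_measure_Diff) (use sets_Y_greater[OF e] t in auto)
  finally show ?thesis using prob_Y_greater[OF e] t by simp
qed

lemma A_sym: "\<omega> \<in> space M \<Longrightarrow> i < n \<Longrightarrow> j < n \<Longrightarrow> A \<omega> $$ (j, i) = cnj (A \<omega> $$ (i, j))"
  using herm unfolding hermitian_mat_def by blast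

lemma measurable_entry:
  assumes ij: "i < n" "j < n"
  shows "(\<lambda>\<omega>. A \<omega> $$ (i, j)) \<in> borel_measurable M"
proof -
  have up: "(\<lambda>\<omega>. A \<omega> $$ (i, j)) \<in> borel_measurable M" if "i \<le> j" "i < n" "j < n" for i j
  proof (cases "(i, j) \<in> J")
    case True
    thus ?thesis using ind by (auto simp: indep_vars_def2)
  next
    case False
    hence "band_dist p n i j > d" using that by (auto simp: band_indices_def)
    hence "(\<lambda>\<omega>. A \<omega> $$ (i, j)) \<in> borel_measurable M \<longleftrightarrow> (\<lambda>\<omega>. 0 :: complex) \<in> borel_measurable M"
      using that by (intro measurable_cong) (auto intro: band)
    thus ?thesis by simp
  qed
  show ?thesis
  proof (cases "i \<le> j")
    case False
    hence "(\<lambda>\<omega>. cnj (A \<omega> $$ (j, i))) \<in> borel_measurable M"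
      using up[of j i] ij by (intro borel_measurable_continuous_on[where f = cnj and g = "\<lambda>\<omega>. A \<omega> $$ (j, i)"]) (auto intro: continuous_intros)
    also have "(\<lambda>\<omega>. cnj (A \<omega> $$ (j, i))) \<in> borel_measurable M \<longleftrightarrow> (\<lambda>\<omega>. A \<omega> $$ (i, j)) \<in> borel_measurable M"
      using ij by (intro measurable_cong) (metis A_sym)
    finally show ?thesis .
  qed (use up ij in auto)
qed

lemma A_dim: "\<omega> \<in> space M \<Longrightarrow> A \<omega> \<in> carrier_mat n n"
  using herm by (simp add: hermitian_mat_def)

lemma B_index: "\<omega> \<in> space M \<Longrightarrow> i < n \<Longrightarrow> j < n \<Longrightarrow> B \<omega> $$ (i, j) = of_real (inverse b) * A \<omega> $$ (i, j)"
  using A_dim[of \<omega>] by (auto simp: B_def)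

lemma herm_B: "\<omega> \<in> space M \<Longrightarrow> hermitian_mat n (B \<omega>)"
  unfolding hermitian_mat_def
proof (intro conjI allI impI)
  fix i j assume \<omega>: "\<omega> \<in> space M" and ij: "i < n" "j < n"
  show "B \<omega> $$ (j, i) = cnj (B \<omega> $$ (i, j))"
    unfolding B_index[OF \<omega> ij] B_index[OF \<omega> ij(2,1)] A_sym[OF \<omega> ij] by simp
qed (use A_dim[of \<omega>] in \<open>simp add: B_def\<close>)

lemma measurable_B_entry: "i < n \<Longrightarrow> j < n \<Longrightarrow> (\<lambda>\<omega>. B \<omega> $$ (i, j)) \<in> borel_measurable M"
proof -
  assume ij: "i < n" "j < n"
  have "(\<lambda>\<omega>. of_real (inverse b) * A \<omega> $$ (i, j)) \<in> borel_measurable M"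
    using measurable_entry[OF ij] by measurable
  also have "(\<lambda>\<omega>. of_real (inverse b) * A \<omega> $$ (i, j)) \<in> borel_measurable M \<longleftrightarrow> (\<lambda>\<omega>. B \<omega> $$ (i, j)) \<in> borel_measurable M"
    using ij by (intro measurable_cong) (simp add: B_index)
  finally show ?thesis .
qed

lemma cmod_B:
  assumes "\<omega> \<in> space M" "i < n" "j < n"
  shows "cmod (B \<omega> $$ (i, j)) = (if (min i j, max i j) \<in> J then Y (min i j, max i j) \<omega> else 0)"
proof (cases "i \<le> j")
  case True
  thus ?thesis using assms b band[OF assms] by (auto simp: B_index Y_def norm_mult norm_divide band_indices_def divide_simps)
next
  case False
  have "cmod (A \<omega> $$ (i, j)) = cmod (A \<omega> $$ (j, i))" using A_sym[OF assms] by simp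
  thus ?thesis using False assms b band[OF assms]
    by (auto simp: B_index Y_def norm_mult norm_divide band_indices_def divide_simps band_dist_comm[of p n j i])
qed

lemma row_bij: "i < n \<Longrightarrow> bij_betw (\<lambda>j. (min i j, max i j)) {j \<in> {..<n}. (min i j, max i j) \<in> J} (row i)"
proof (rule bij_betwI[where g = "\<lambda>(a, c). if a = i then c else a"])
  assume "i < n"
  show "(\<lambda>j. (min i j, max i j)) \<in> {j \<in> {..<n}. (min i j, max i j) \<in> J} \<rightarrow> row i"
    by (auto simp: row_indices_def min_def max_def)
  show "(\<lambda>(a, c). if a = i then c else a) \<in> row i \<rightarrow> {j \<in> {..<n}. (min i j, max i j) \<in> J}"
    by (auto simp: row_indices_def band_indices_def min_def max_def)
qed (auto simp: row_indices_def band_indices_def min_def max_def)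

text \<open>The number of independent entries of rescaled modulus above \<open>t\<close>.\<close>

definition large_count :: "real \<Rightarrow> 'w \<Rightarrow> nat" where
  "large_count t \<omega> = card {e \<in> J. Y e \<omega> > t}"

text \<open>The exceptional events: a large diagonal entry, two large entries in one row, a row in which the
small entries have a large sum, and an entry with modulus in a window of half-width \<open>\<eta>\<close> around \<open>t\<close>.\<close>

definition bad_diag :: "real \<Rightarrow> 'w set" where
  "bad_diag \<epsilon> = (\<Union>i\<in>{..<n}. {\<omega> \<in> space M. Y (i, i) \<omega> > \<epsilon>})"

definition bad_pair :: "real \<Rightarrow> 'w set" where
  "bad_pair \<epsilon> = (\<Union>i\<in>{..<n}. \<Union>(e, e')\<in>{(e, e') \<in> row i \<times> row i. e \<noteq> e'}.
     {\<omega> \<in> space M. Y e \<omega> > \<epsilon> \<and> Y e' \<omega> > \<epsilon>})"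

definition bad_row :: "real \<Rightarrow> real \<Rightarrow> 'w set" where
  "bad_row \<epsilon> \<delta> = (\<Union>i\<in>{..<n}. {\<omega> \<in> space M. (\<Sum>e\<in>row i. if Y e \<omega> \<le> \<epsilon> then Y e \<omega> else 0) \<ge> \<delta>})"

definition bad_window :: "real \<Rightarrow> real \<Rightarrow> 'w set" where
  "bad_window t \<eta> = (\<Union>e\<in>J. {\<omega> \<in> space M. t - \<eta> < Y e \<omega> \<and> Y e \<omega> \<le> t + \<eta>})"

lemma good_dominant_matching:
  assumes \<omega>: "\<omega> \<in> space M" "\<omega> \<notin> bad_diag \<epsilon>" "\<omega> \<notin> bad_pair \<epsilon>" "\<omega> \<notin> bad_row \<epsilon> \<delta>"
    and t: "0 \<le> \<epsilon>" "\<epsilon> \<le> t"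
  shows "dominant_matching n (B \<omega>) \<epsilon> \<delta> t"
proof
  show "hermitian_mat n (B \<omega>)" by (rule herm_B[OF \<omega>(1)])
  show "cmod (B \<omega> $$ (i, i)) \<le> \<epsilon>" if "i < n" for i
    using \<omega>(2) cmod_B[OF \<omega>(1) that that] that t \<omega>(1) by (auto simp: bad_diag_def not_less)
  show "j = j'" if "i < n" "j < n" "j' < n" "cmod (B \<omega> $$ (i, j)) > \<epsilon>" "cmod (B \<omega> $$ (i, j')) > \<epsilon>" for i j j'
  proof (rule ccontr)
    assume "j \<noteq> j'"
    define e where "e = (min i j, max i j)"
    define e' where "e' = (min i j', max i j')"
    have "e \<in> J" "Y e \<omega> > \<epsilon>"
      using that cmod_B[OF \<omega>(1) that(1,2)] t by (auto simp: e_def split: if_splits)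
    moreover have "e' \<in> J" "Y e' \<omega> > \<epsilon>"
      using that cmod_B[OF \<omega>(1) that(1,3)] t by (auto simp: e'_def split: if_splits)
    moreover have "e \<noteq> e'" using \<open>j \<noteq> j'\<close> by (auto simp: e_def e'_def min_def max_def split: if_splits)
    moreover have "e \<in> row i" "e' \<in> row i"
      using \<open>e \<in> J\<close> \<open>e' \<in> J\<close> by (auto simp: row_indices_def e_def e'_def min_def max_def)
    ultimately have "\<omega> \<in> bad_pair \<epsilon>"
      unfolding bad_pair_def using that(1) \<omega>(1)
      by (intro UN_I[of i] UN_I[of "(e, e')"]) simp_all
    with \<omega>(3) show False by simp
  qed
  show "(\<Sum>j<n. if cmod (B \<omega> $$ (i, j)) \<le> \<epsilon> then cmod (B \<omega> $$ (i, j)) else 0) \<le> \<delta>" if i: "i < n" for i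
  proof -
    let ?g = "\<lambda>e. if Y e \<omega> \<le> \<epsilon> then Y e \<omega> else 0"
    have "(\<Sum>j<n. if cmod (B \<omega> $$ (i, j)) \<le> \<epsilon> then cmod (B \<omega> $$ (i, j)) else 0)
        = (\<Sum>j\<in>{j \<in> {..<n}. (min i j, max i j) \<in> J}. ?g (min i j, max i j))"
      using t by (intro sum.mono_neutral_cong_right) (auto simp: cmod_B[OF \<omega>(1) i])
    also have "\<dots> = (\<Sum>e\<in>row i. ?g e)"
      by (rule sum.reindex_bij_betw[OF row_bij[OF i]])
    also have "\<dots> \<le> \<delta>" using \<omega>(1,4) i by (force simp: bad_row_def not_le)
    finally show ?thesis .
  qed
qed (use t in auto)

lemma card_large_edges:
  assumes \<omega>: "\<omega> \<in> space M" "\<omega> \<notin> bad_diag \<epsilon>" "\<omega> \<notin> bad_pair \<epsilon>" "\<omega> \<notin> bad_row \<epsilon> \<delta>"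
    and t: "0 \<le> \<epsilon>" "\<epsilon> \<le> t"
  shows "card (dominant_matching.large_edges n (B \<omega>) t) = large_count t \<omega>"
proof -
  have "dominant_matching.large_edges n (B \<omega>) t = {(j, k). j < k \<and> k < n \<and> cmod (B \<omega> $$ (j, k)) > t}"
    by (rule dominant_matching.large_edges_def[OF good_dominant_matching[OF assms]])
  also have "\<dots> = {e \<in> J. Y e \<omega> > t}"
  proof (intro equalityI subsetI)
    fix e assume "e \<in> {(j, k). j < k \<and> k < n \<and> cmod (B \<omega> $$ (j, k)) > t}"
    thus "e \<in> {e \<in> J. Y e \<omega> > t}"
      using t by (auto simp: cmod_B[OF \<omega>(1)] split: if_splits)
  next
    fix e assume e: "e \<in> {e \<in> J. Y e \<omega> > t}"
    obtain j k where jk: "e = (j, k)" by (cases e)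
    have *: "j \<le> k" "k < n" using e by (auto simp: jk band_indices_def)
    have "j \<noteq> k"
    proof
      assume "j = k"
      hence "\<omega> \<in> bad_diag \<epsilon>"
        unfolding bad_diag_def using e t * \<omega>(1) by (intro UN_I[of k]) (auto simp: jk)
      thus False using \<omega>(2) by simp
    qed
    thus "e \<in> {(j, k). j < k \<and> k < n \<and> cmod (B \<omega> $$ (j, k)) > t}"
      using * e by (auto simp: jk cmod_B[OF \<omega>(1)])
  qed
  finally show ?thesis by (simp add: large_count_def)
qed

lemma large_count_window:
  assumes \<omega>: "\<omega> \<in> space M" "\<omega> \<notin> bad_window t \<eta>" and "\<bar>s - t\<bar> \<le> \<eta>"
  shows "large_count s \<omega> = large_count t \<omega>"
proof -
  have "Y e \<omega> \<le> t - \<eta> \<or> Y e \<omega> > t + \<eta>" if "e \<in> J" for e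
    using \<omega> that by (auto simp: bad_window_def not_less)
  hence "{e \<in> J. Y e \<omega> > s} = {e \<in> J. Y e \<omega> > t}" using assms(3) by force
  thus ?thesis by (simp add: large_count_def)
qed

text \<open>Off the exceptional events, eigenvalues and entries above \<open>t\<close> are equally many. The counts of
eigenvalues are compared with the counts of entries at the levels \<open>t \<plusminus> 2 \<delta>\<close>, and no entry lies between these.\<close>

lemma good_eigenvalue_count:
  assumes \<omega>: "\<omega> \<in> space M" "\<omega> \<notin> bad_diag \<epsilon>" "\<omega> \<notin> bad_pair \<epsilon>" "\<omega> \<notin> bad_row \<epsilon> \<delta>" "\<omega> \<notin> bad_window t (2 * \<delta>)"
    and t: "0 \<le> \<epsilon>" "0 < \<delta>" "\<epsilon> + 2 * \<delta> \<le> t"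
  shows "eigenvalue_count (B \<omega>) {t<..} = large_count t \<omega>" "eigenvalue_count (B \<omega>) {t..} = large_count t \<omega>"
proof -
  note h = herm_B[OF \<omega>(1)]
  have up: "eigenvalue_count (B \<omega>) {s + \<delta><..} \<le> large_count s \<omega>"
    and lo: "large_count s \<omega> \<le> eigenvalue_count (B \<omega>) {s - \<delta>..}" if "\<epsilon> \<le> s" for s
    using dominant_matching.eigenvalue_count_upper[OF good_dominant_matching[OF \<omega>(1-4) t(1) that]]
      dominant_matching.eigenvalue_count_lower[OF good_dominant_matching[OF \<omega>(1-4) t(1) that]]
      card_large_edges[OF \<omega>(1-4) t(1) that] by simp_all
  have "eigenvalue_count (B \<omega>) {t..} \<le> eigenvalue_count (B \<omega>) {t - 2 * \<delta> + \<delta><..}"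
    using t by (intro eigenvalue_count_mono[OF h]) auto
  also have "\<dots> \<le> large_count (t - 2 * \<delta>) \<omega>" using t by (intro up) auto
  also have "\<dots> = large_count t \<omega>" using t by (intro large_count_window[OF \<omega>(1,5)]) auto
  finally have 1: "eigenvalue_count (B \<omega>) {t..} \<le> large_count t \<omega>" .
  have "large_count t \<omega> = large_count (t + 2 * \<delta>) \<omega>"
    using t by (intro large_count_window[OF \<omega>(1,5), symmetric]) auto
  also have "\<dots> \<le> eigenvalue_count (B \<omega>) {t + 2 * \<delta> - \<delta>..}" using t by (intro lo) auto
  also have "\<dots> \<le> eigenvalue_count (B \<omega>) {t<..}"
    using t by (intro eigenvalue_count_mono[OF h]) auto
  finally have 2: "large_count t \<omega> \<le> eigenvalue_count (B \<omega>) {t<..}" .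
  have 3: "eigenvalue_count (B \<omega>) {t<..} \<le> eigenvalue_count (B \<omega>) {t..}"
    by (intro eigenvalue_count_mono[OF h]) auto
  show "eigenvalue_count (B \<omega>) {t<..} = large_count t \<omega>" "eigenvalue_count (B \<omega>) {t..} = large_count t \<omega>"
    using 1 2 3 by auto
qed

section \<open>Probabilities of the exceptional events\<close>

lemma diag_in_J: "i < n \<Longrightarrow> (i, i) \<in> J"
  by (cases p) (auto simp: band_indices_def)

lemma sets_bad_diag: "bad_diag \<epsilon> \<in> sets M"
  unfolding bad_diag_def using sets_Y_greater[OF diag_in_J] by (intro sets.finite_UN) auto

lemma prob_bad_diag: "\<epsilon> > 0 \<Longrightarrow> prob (bad_diag \<epsilon>) \<le> real n * G (b * \<epsilon>)"
proof -
  assume "\<epsilon> > 0"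
  have "prob (bad_diag \<epsilon>) \<le> (\<Sum>i\<in>{..<n}. prob {\<omega> \<in> space M. Y (i, i) \<omega> > \<epsilon>})"
    unfolding bad_diag_def using sets_Y_greater[OF diag_in_J] by (intro finite_measure_subadditive_finite) auto
  also have "\<dots> = real n * G (b * \<epsilon>)"
    using prob_Y_greater[OF diag_in_J] \<open>\<epsilon> > 0\<close> by simp
  finally show ?thesis .
qed

lemma prob_two_large:
  assumes e: "e \<in> J" "e' \<in> J" "e \<noteq> e'" and \<epsilon>: "\<epsilon> > 0"
  shows "prob {\<omega> \<in> space M. Y e \<omega> > \<epsilon> \<and> Y e' \<omega> > \<epsilon>} = (G (b * \<epsilon>))\<^sup>2"
proof -
  have "{\<omega> \<in> space M. Y e \<omega> > \<epsilon> \<and> Y e' \<omega> > \<epsilon>} = (\<Inter>a\<in>{e, e'}. Y a -` {\<epsilon><..} \<inter> space M)" by auto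
  also have "prob \<dots> = (\<Prod>a\<in>{e, e'}. prob (Y a -` {\<epsilon><..} \<inter> space M))"
    by (rule indep_varsD[OF indep_Y]) (use e in auto)
  also have "\<dots> = (\<Prod>a\<in>{e, e'}. G (b * \<epsilon>))"
  proof (intro prod.cong refl)
    fix a assume "a \<in> {e, e'}"
    hence "a \<in> J" using e by auto
    moreover have "Y a -` {\<epsilon><..} \<inter> space M = {\<omega> \<in> space M. Y a \<omega> > \<epsilon>}" by auto
    ultimately show "prob (Y a -` {\<epsilon><..} \<inter> space M) = G (b * \<epsilon>)" using prob_Y_greater \<epsilon> by simp
  qed
  finally show ?thesis using e by (simp add: power2_eq_square)
qed

lemma sets_two_large: "e \<in> J \<Longrightarrow> e' \<in> J \<Longrightarrow> {\<omega> \<in> space M. Y e \<omega> > \<epsilon> \<and> Y e' \<omega> > \<epsilon>} \<in> sets M"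
  using measurable_Y[of e] measurable_Y[of e'] by measurable

lemma sets_bad_pair: "bad_pair \<epsilon> \<in> sets M"
  unfolding bad_pair_def using row_subset
  by (intro sets.finite_UN finite_lessThan finite_subset[OF _ finite_cartesian_product[OF finite_row finite_row]])
     (auto intro!: sets_two_large)

lemma prob_bad_pair:
  assumes "\<epsilon> > 0"
  shows "prob (bad_pair \<epsilon>) \<le> real n * ((4 * (real d + 1))\<^sup>2 * (G (b * \<epsilon>))\<^sup>2)"
proof -
  define P where "P i = {(e, e') \<in> row i \<times> row i. e \<noteq> e'}" for i
  have fin: "finite (P i)" for i
    unfolding P_def by (rule finite_subset[OF _ finite_cartesian_product[OF finite_row finite_row]]) auto
  have cP: "real (card (P i)) \<le> (4 * (real d + 1))\<^sup>2" for i
  proof -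
    have "card (P i) \<le> card (row i \<times> row i)" by (rule card_mono) (auto simp: P_def)
    also have "\<dots> \<le> (4 * (d + 1)) * (4 * (d + 1))"
      unfolding card_cartesian_product by (intro mult_mono card_row_indices_le) auto
    finally have "real (card (P i)) \<le> real ((4 * (d + 1)) * (4 * (d + 1)))" by (simp only: of_nat_le_iff)
    thus ?thesis by (simp add: power2_eq_square algebra_simps)
  qed
  define E where "E = (\<lambda>(e, e'). {\<omega> \<in> space M. Y e \<omega> > \<epsilon> \<and> Y e' \<omega> > \<epsilon>})"
  have E: "E x \<in> sets M" "prob (E x) = (G (b * \<epsilon>))\<^sup>2" if "x \<in> P i" for x i
  proof -
    obtain e e' where x: "x = (e, e')" by (cases x)
    have ee: "e \<in> J" "e' \<in> J" "e \<noteq> e'" using that row_subset[of i] by (auto simp: x P_def)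
    show "E x \<in> sets M" "prob (E x) = (G (b * \<epsilon>))\<^sup>2"
      using sets_two_large[OF ee(1,2)] prob_two_large[OF ee assms] by (simp_all add: E_def x)
  qed
  have "prob (bad_pair \<epsilon>) \<le> (\<Sum>i\<in>{..<n}. prob (\<Union>x\<in>P i. E x))"
    unfolding bad_pair_def P_def[symmetric] E_def[symmetric] using E fin
    by (intro finite_measure_subadditive_finite) (auto intro!: sets.finite_UN)
  also have "\<dots> \<le> (\<Sum>i\<in>{..<n}. (4 * (real d + 1))\<^sup>2 * (G (b * \<epsilon>))\<^sup>2)"
  proof (intro sum_mono)
    fix i
    have "prob (\<Union>x\<in>P i. E x) \<le> (\<Sum>x\<in>P i. prob (E x))"
      using E fin by (intro finite_measure_subadditive_finite) auto
    also have "\<dots> = card (P i) * (G (b * \<epsilon>))\<^sup>2" using E by simp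
    also have "\<dots> \<le> (4 * (real d + 1))\<^sup>2 * (G (b * \<epsilon>))\<^sup>2" by (intro mult_right_mono cP) auto
    finally show "prob (\<Union>x\<in>P i. E x) \<le> (4 * (real d + 1))\<^sup>2 * (G (b * \<epsilon>))\<^sup>2" .
  qed
  finally show ?thesis by simp
qed

lemma measurable_small [measurable (raw)]:
  "e \<in> J \<Longrightarrow> (\<lambda>\<omega>. if Y e \<omega> \<le> \<epsilon> then Y e \<omega> else 0) \<in> borel_measurable M"
  using measurable_Y[of e] by measurable

lemma sets_bad_row_one: "{\<omega> \<in> space M. (\<Sum>e\<in>row i. if Y e \<omega> \<le> \<epsilon> then Y e \<omega> else 0) \<ge> \<delta>} \<in> sets M"
proof -
  have "(\<lambda>\<omega>. \<Sum>e\<in>row i. if Y e \<omega> \<le> \<epsilon> then Y e \<omega> else 0) \<in> borel_measurable M"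
    using row_subset[of i] by (intro borel_measurable_sum measurable_small) auto
  thus ?thesis by measurable
qed

lemma sets_bad_row: "bad_row \<epsilon> \<delta> \<in> sets M"
  unfolding bad_row_def by (intro sets.finite_UN sets_bad_row_one) auto

text \<open>Truncation at \<open>\<epsilon> \<le> 1\<close> allows \<open>Y\<close> to be bounded by \<open>Y\<^sup>q\<close> with \<open>q \<le> 1\<close>, so that no first moment of the
entries is needed.\<close>

lemma expectation_small_le:
  assumes e: "e \<in> J" and \<epsilon>: "0 < \<epsilon>" "\<epsilon> \<le> 1" and q: "0 < q" "q \<le> 1" "q < \<beta>" and C: "C > 0" "x0 > 0"
    and G_le: "\<And>x. x \<ge> x0 \<Longrightarrow> G x \<le> C * x powr (- \<beta>)"
    and m: "m = x0 powr q + C * 2 powr q * x0 powr (q - \<beta>) / (1 - 2 powr (q - \<beta>))"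
  shows "expectation (\<lambda>\<omega>. if Y e \<omega> \<le> \<epsilon> then Y e \<omega> else 0) \<le> m * b powr (- q)"
proof -
  define V where "V \<omega> = cmod (A \<omega> $$ e)" for \<omega>
  have V: "V \<omega> = b * Y e \<omega>" for \<omega> using b by (simp add: V_def Y_def)
  have Vm [measurable]: "V \<in> borel_measurable M"
    unfolding V[abs_def] using measurable_Y[OF e] by measurable
  have "expectation (\<lambda>\<omega>. if Y e \<omega> \<le> \<epsilon> then Y e \<omega> else 0)
      \<le> expectation (\<lambda>\<omega>. b powr (- q) * (if V \<omega> \<le> b * \<epsilon> then V \<omega> powr q else 0))"
  proof (rule integral_mono)
    show "integrable M (\<lambda>\<omega>. if Y e \<omega> \<le> \<epsilon> then Y e \<omega> else 0)"
      by (rule integrable_const_bound[where B = \<epsilon>])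
         (use measurable_small[OF e] \<epsilon> Y_nonneg in \<open>auto intro!: AE_I2\<close>)
    show "integrable M (\<lambda>\<omega>. b powr (- q) * (if V \<omega> \<le> b * \<epsilon> then V \<omega> powr q else 0))"
    proof (intro integrable_mult_right integrable_const_bound[where B = "(b * \<epsilon>) powr q"])
      show "AE \<omega> in M. norm (if V \<omega> \<le> b * \<epsilon> then V \<omega> powr q else 0) \<le> (b * \<epsilon>) powr q"
        using q by (intro AE_I2) (auto intro!: powr_mono2 simp: V_def)
    qed measurable
    fix \<omega>
    show "(if Y e \<omega> \<le> \<epsilon> then Y e \<omega> else 0) \<le> b powr (- q) * (if V \<omega> \<le> b * \<epsilon> then V \<omega> powr q else 0)"
    proof (cases "Y e \<omega> \<le> \<epsilon>")
      case True
      have "Y e \<omega> \<le> Y e \<omega> powr q"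
      proof (cases "Y e \<omega> = 0")
        case False
        have "Y e \<omega> powr 1 \<le> Y e \<omega> powr q"
          using True \<epsilon> q Y_nonneg[of e \<omega>] False by (intro powr_mono') auto
        thus ?thesis using False Y_nonneg[of e \<omega>] by simp
      qed simp
      also have "\<dots> = b powr (- q) * V \<omega> powr q"
        using b Y_nonneg[of e \<omega>] by (simp add: V powr_mult powr_minus field_simps)
      finally show ?thesis using True b by (simp add: V)
    qed (use b in \<open>auto simp: V\<close>)
  qed
  also have "\<dots> = b powr (- q) * expectation (\<lambda>\<omega>. if V \<omega> \<le> b * \<epsilon> then V \<omega> powr q else 0)" by simp
  also have "\<dots> \<le> b powr (- q) * m"
    unfolding m
  proof (intro mult_left_mono truncated_moment_le)
    show "prob {\<omega> \<in> space M. t < V \<omega>} \<le> C * t powr (- \<beta>)" if "t \<ge> x0" for t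
      using tail[OF e, of t] G_le[OF that] that C by (simp add: V_def)
  qed (use C q in \<open>auto simp: V_def[symmetric] intro: Vm\<close>, auto simp: V_def)
  finally show ?thesis by (simp add: mult.commute)
qed

lemma prob_bad_row:
  assumes m: "\<And>e. e \<in> J \<Longrightarrow> expectation (\<lambda>\<omega>. if Y e \<omega> \<le> \<epsilon> then Y e \<omega> else 0) \<le> m" "m \<ge> 0"
    and \<epsilon>: "\<epsilon> > 0" and \<theta>: "\<theta> > 0"
  shows "prob (bad_row \<epsilon> \<delta>) \<le> real n * exp (- \<theta> * \<delta> + 4 * (real d + 1) * (m * (exp (\<theta> * \<epsilon>) / \<epsilon>)))"
proof -
  define X where "X e \<omega> = (if Y e \<omega> \<le> \<epsilon> then Y e \<omega> else 0)" for e \<omega>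
  have ind: "indep_vars (\<lambda>_. borel) X (row i)" for i
    unfolding X_def
    by (rule indep_vars_compose2[OF indep_vars_subset[OF indep_Y row_subset], where Y = "\<lambda>_ y. if y \<le> \<epsilon> then y else 0"]) measurable
  have "prob (bad_row \<epsilon> \<delta>) \<le> (\<Sum>i\<in>{..<n}. prob {\<omega> \<in> space M. (\<Sum>e\<in>row i. X e \<omega>) \<ge> \<delta>})"
    unfolding bad_row_def X_def
    by (rule finite_measure_subadditive_finite) (blast intro: sets_bad_row_one finite_lessThan)+
  also have "\<dots> \<le> (\<Sum>i\<in>{..<n}. exp (- \<theta> * \<delta> + 4 * (real d + 1) * (m * (exp (\<theta> * \<epsilon>) / \<epsilon>))))"
  proof (intro sum_mono)
    fix i
    have "prob {\<omega> \<in> space M. (\<Sum>e\<in>row i. X e \<omega>) \<ge> \<delta>} \<le> exp (- \<theta> * \<delta> + card (row i) * (m * (exp (\<theta> * \<epsilon>) / \<epsilon>)))"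
      by (rule prob_bounded_sum_ge_le[OF finite_row ind])
         (use Y_nonneg m row_subset[of i] \<epsilon> \<theta> in \<open>auto simp: X_def[abs_def]\<close>)
    also have "\<dots> \<le> exp (- \<theta> * \<delta> + 4 * (real d + 1) * (m * (exp (\<theta> * \<epsilon>) / \<epsilon>)))"
    proof -
      have "real (card (row i)) \<le> real (4 * (d + 1))" by (simp only: of_nat_le_iff card_row_indices_le)
      hence "real (card (row i)) \<le> 4 * (real d + 1)" by simp
      hence "card (row i) * (m * (exp (\<theta> * \<epsilon>) / \<epsilon>)) \<le> 4 * (real d + 1) * (m * (exp (\<theta> * \<epsilon>) / \<epsilon>))"
        using m \<epsilon> by (intro mult_right_mono) auto
      thus ?thesis by simp
    qed
    finally show "prob {\<omega> \<in> space M. (\<Sum>e\<in>row i. X e \<omega>) \<ge> \<delta>}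
      \<le> exp (- \<theta> * \<delta> + 4 * (real d + 1) * (m * (exp (\<theta> * \<epsilon>) / \<epsilon>)))" .
  qed
  finally show ?thesis by simp
qed

lemma sets_between: "e \<in> J \<Longrightarrow> {\<omega> \<in> space M. s < Y e \<omega> \<and> Y e \<omega> \<le> t} \<in> sets M"
  using measurable_Y[of e] by measurable

lemma sets_bad_window: "bad_window t \<eta> \<in> sets M"
  unfolding bad_window_def using sets_between by (intro sets.finite_UN) auto

lemma prob_bad_window:
  assumes "0 \<le> \<eta>" "\<eta> < t"
  shows "prob (bad_window t \<eta>) \<le> real (card J) * G (b * (t - \<eta>)) - real (card J) * G (b * (t + \<eta>))"
proof -
  have "prob (bad_window t \<eta>) \<le> (\<Sum>e\<in>J. prob {\<omega> \<in> space M. t - \<eta> < Y e \<omega> \<and> Y e \<omega> \<le> t + \<eta>})"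
    unfolding bad_window_def using sets_between by (intro finite_measure_subadditive_finite) auto
  also have "\<dots> = real (card J) * (G (b * (t - \<eta>)) - G (b * (t + \<eta>)))"
    using prob_Y_between[of _ "t - \<eta>" "t + \<eta>"] assms by simp
  finally show ?thesis by (simp add: right_diff_distrib)
qed

end

section \<open>Counts in separated intervals\<close>

lemma power_tail_integral:
  fixes x :: real and y :: ereal
  assumes \<alpha>: "\<alpha> > 0" and x: "0 < x" "ereal x < y"
  shows "(LINT t:{t. x < t \<and> ereal t < y}|lborel. \<alpha> / t powr (1 + \<alpha>))
     = x powr (- \<alpha>) - (if y = \<infinity> then 0 else real_of_ereal y powr (- \<alpha>))"
proof -
  let ?f = "\<lambda>t. \<alpha> / t powr (1 + \<alpha>)" and ?F = "\<lambda>t. - (t powr (- \<alpha>))"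
  let ?B = "if y = \<infinity> then 0 else - (real_of_ereal y powr (- \<alpha>))"
  have lim: "((?F \<circ> real_of_ereal) \<longlongrightarrow> ?B) (at_left y)"
  proof (cases y)
    case (real r)
    have "(?F \<longlongrightarrow> ?F r) (at_left r)" using x real by (intro tendsto_intros) auto
    thus ?thesis using real by (simp add: ereal_tendsto_simps)
  next
    case PInf
    have "(?F \<longlongrightarrow> - 0) at_top"
      using \<alpha> by (intro tendsto_minus tendsto_neg_powr filterlim_ident) auto
    thus ?thesis using PInf by (simp add: ereal_tendsto_simps)
  qed (use x in auto)
  have "(LBINT t=ereal x..y. ?f t) = ?B - ?F x"
  proof (rule interval_integral_FTC_nonneg(2))
    show "ereal x < y" by fact
    fix t assume t: "ereal x < ereal t" "ereal t < y"
    hence t0: "t > 0" using x by simp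
    show "DERIV ?F t :> ?f t"
      using t0 by (auto intro!: derivative_eq_intros simp: powr_minus powr_add powr_diff field_simps)
    show "isCont ?f t" using t0 by (intro continuous_intros) auto
  next
    show "AE t in lborel. ereal x < ereal t \<longrightarrow> ereal t < y \<longrightarrow> 0 \<le> ?f t"
      using \<alpha> by (intro AE_I2) auto
    have "(?F \<longlongrightarrow> ?F x) (at_right x)" using x by (intro tendsto_intros) auto
    thus "((?F \<circ> real_of_ereal) \<longlongrightarrow> ?F x) (at_right (ereal x))"
      by (simp add: ereal_tendsto_simps)
    show "((?F \<circ> real_of_ereal) \<longlongrightarrow> ?B) (at_left y)" by (rule lim)
  qed
  moreover have "einterval (ereal x) y = {t. x < t \<and> ereal t < y}" by (simp add: einterval_def)
  ultimately show ?thesis using x by (simp add: interval_lebesgue_integral_def less_imp_le)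
qed

text \<open>Intervals from \<open>x j\<close> to \<open>y j\<close> for \<open>1 \<le> j \<le> k\<close>, separated and in increasing order. Only the last right
endpoint can be infinite.\<close>

locale separated_intervals =
  fixes k :: nat and x :: "nat \<Rightarrow> real" and y :: "nat \<Rightarrow> ereal"
  assumes x_pos: "0 < x 1"
    and x_less_y: "\<And>j. 1 \<le> j \<Longrightarrow> j \<le> k \<Longrightarrow> ereal (x j) < y j"
    and y_less_x: "\<And>j. 1 \<le> j \<Longrightarrow> j < k \<Longrightarrow> y j < ereal (x (Suc j))"
begin

lemma y_less_x': "1 \<le> i \<Longrightarrow> i < j \<Longrightarrow> j \<le> k \<Longrightarrow> y i < ereal (x j)"
proof (induction j)
  case (Suc j)
  show ?case
  proof (cases "i = j")
    case False
    hence "y i < ereal (x j)" using Suc by simp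
    also have "\<dots> < y j" using Suc False by (intro x_less_y) auto
    also have "\<dots> < ereal (x (Suc j))" using Suc by (intro y_less_x) auto
    finally show ?thesis .
  qed (use Suc y_less_x in auto)
qed simp

lemma x_ge: "1 \<le> j \<Longrightarrow> j \<le> k \<Longrightarrow> x 1 \<le> x j"
proof (cases "j = 1")
  case False
  assume "1 \<le> j" "j \<le> k"
  hence "ereal (x 1) < y 1" "y 1 < ereal (x j)" using False by (auto intro!: x_less_y y_less_x')
  hence "ereal (x 1) < ereal (x j)" by (rule order.strict_trans)
  thus ?thesis by simp
qed simp

text \<open>The index of the half-open interval \<open>x j < v \<le> y j\<close> that contains \<open>v\<close>, and \<open>0\<close> if there is none.\<close>

definition colour :: "real \<Rightarrow> nat" where
  "colour v = (if \<exists>j\<in>{1..k}. x j < v \<and> ereal v \<le> y j then (THE j. j \<in> {1..k} \<and> x j < v \<and> ereal v \<le> y j) else 0)"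

lemma interval_unique:
  assumes "i \<in> {1..k}" "j \<in> {1..k}" "x i < v" "ereal v \<le> y i" "x j < v" "ereal v \<le> y j"
  shows "i = j"
proof -
  have "\<not> i < j" if "i \<in> {1..k}" "j \<in> {1..k}" "ereal v \<le> y i" "x j < v" for i j
  proof
    assume "i < j"
    hence "y i < ereal (x j)" using that by (intro y_less_x') auto
    also have "\<dots> < ereal v" using that by simp
    finally show False using that by simp
  qed
  thus ?thesis using assms by (meson linorder_neqE_nat)
qed

lemma the_interval:
  assumes "j \<in> {1..k}" "x j < v" "ereal v \<le> y j"
  shows "(THE j. j \<in> {1..k} \<and> x j < v \<and> ereal v \<le> y j) = j"
proof (rule the_equality)
  show "i = j" if "i \<in> {1..k} \<and> x i < v \<and> ereal v \<le> y i" for i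
    using that assms interval_unique by blast
qed (use assms in blast)

lemma colour_eq:
  assumes "r \<in> {1..k}"
  shows "colour v = r \<longleftrightarrow> x r < v \<and> ereal v \<le> y r"
proof
  assume "x r < v \<and> ereal v \<le> y r"
  hence "(THE j. j \<in> {1..k} \<and> x j < v \<and> ereal v \<le> y j) = r"
    using assms the_interval by blast
  thus "colour v = r" using assms \<open>x r < v \<and> ereal v \<le> y r\<close> by (auto simp: colour_def)
next
  assume *: "colour v = r"
  hence "\<exists>j\<in>{1..k}. x j < v \<and> ereal v \<le> y j" using assms by (auto simp: colour_def split: if_splits)
  then obtain j where j: "j \<in> {1..k}" "x j < v" "ereal v \<le> y j" by blast
  hence "(THE j. j \<in> {1..k} \<and> x j < v \<and> ereal v \<le> y j) = j"
    using the_interval by blast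
  hence "colour v = j" using j by (auto simp: colour_def)
  thus "x r < v \<and> ereal v \<le> y r" using * j by simp
qed

lemma colour_le: "colour v \<le> k"
proof (cases "colour v = 0")
  case False
  then obtain j where j: "j \<in> {1..k}" "x j < v" "ereal v \<le> y j"
    by (auto simp: colour_def split: if_splits)
  hence "colour v = j" using colour_eq by blast
  thus ?thesis using j by simp
qed simp

lemma measurable_colour: "colour \<in> measurable borel (count_space UNIV)"
proof -
  have pos: "colour -` {r} \<in> sets borel" if "r \<in> {1..k}" for r
  proof -
    have "colour -` {r} = {v. x r < v \<and> ereal v \<le> y r}" using colour_eq[OF that] by auto
    also have "\<dots> \<in> sets borel" by measurable
    finally show ?thesis .
  qed
  have "colour -` {r} \<in> sets borel" for r
  proof -
    consider "r \<in> {1..k}" | "r > k" | "r = 0" by force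
    thus ?thesis
    proof cases
      case 2
      hence "colour -` {r} = {}" using colour_le by (auto simp: not_less[symmetric])
      thus ?thesis by simp
    next
      case 3
      have "colour -` {0} = UNIV - (\<Union>r\<in>{1..k}. colour -` {r})"
        using colour_le by (force simp: Suc_le_eq)
      also have "\<dots> \<in> sets borel" using pos by (intro sets.Diff sets.finite_UN) auto
      finally show ?thesis using 3 by simp
    qed (use pos in auto)
  qed
  thus ?thesis by (subst measurable_count_space_eq2_countable) auto
qed

text \<open>The finite endpoints of the intervals.\<close>

definition endpoints :: "real set" where
  "endpoints = x ` {1..k} \<union> real_of_ereal ` (y ` {1..k} - {\<infinity>})"

lemma finite_endpoints: "finite endpoints" by (simp add: endpoints_def)

lemma y_cases:
  assumes "j \<in> {1..k}"
  obtains "y j = \<infinity>" | r where "y j = ereal r" "x j < r" "r \<in> endpoints"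
proof (cases "y j")
  case (real r)
  have "y j \<in> y ` {1..k} - {\<infinity>}" by (intro DiffI imageI assms) (use real in auto)
  moreover have "r = real_of_ereal (y j)" using real by simp
  ultimately have "r \<in> endpoints" unfolding endpoints_def by blast
  thus ?thesis using that(2)[OF real] real x_less_y[of j] assms by auto
qed (use x_less_y[of j] assms that in auto)

lemma x_endpoint: "j \<in> {1..k} \<Longrightarrow> x j \<in> endpoints"
  by (simp add: endpoints_def)

lemma endpoint_ge: "t \<in> endpoints \<Longrightarrow> x 1 \<le> t"
proof -
  assume "t \<in> endpoints"
  hence "(\<exists>j\<in>{1..k}. t = x j) \<or> (\<exists>j\<in>{1..k}. y j \<noteq> \<infinity> \<and> t = real_of_ereal (y j))"
    unfolding endpoints_def by blast
  then consider j where "j \<in> {1..k}" "t = x j" | j where "j \<in> {1..k}" "y j \<noteq> \<infinity>" "t = real_of_ereal (y j)"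
    by blast
  thus ?thesis
  proof cases
    case 1
    thus ?thesis using x_ge by auto
  next
    case 2
    have "x 1 \<le> x j" using x_ge 2 by auto
    also have "x j \<le> t" using 2(1)
    proof (cases rule: y_cases)
      case (2 z)
      thus ?thesis using \<open>t = real_of_ereal (y j)\<close> by simp
    qed (use 2(2) in simp)
    finally show ?thesis .
  qed
qed

end

locale band_sample_intervals = band_sample M p n d A b G + separated_intervals k x y
  for M :: "'w measure" and p n d A b G k x y
begin

text \<open>The probability that the rescaled modulus of an entry lies in interval \<open>r\<close>.\<close>

definition interval_prob :: "nat \<Rightarrow> real" where
  "interval_prob r = G (b * x r) - (if y r = \<infinity> then 0 else G (b * real_of_ereal (y r)))"

text \<open>The law of the colour of the rescaled modulus of an entry.\<close>

definition colour_prob :: "nat \<Rightarrow> real" where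
  "colour_prob r = (if r = 0 then 1 - (\<Sum>r\<in>{1..k}. interval_prob r) else if r \<le> k then interval_prob r else 0)"

lemma measurable_colour_Y: "e \<in> J \<Longrightarrow> (\<lambda>\<omega>. colour (Y e \<omega>)) \<in> measurable M (count_space UNIV)"
  using measurable_compose[OF measurable_Y measurable_colour] .

lemma sets_colour: "e \<in> J \<Longrightarrow> {\<omega> \<in> space M. colour (Y e \<omega>) = r} \<in> sets M"
  using measurable_colour_Y[of e] by measurable

lemma prob_interval:
  assumes e: "e \<in> J" and r: "r \<in> {1..k}"
  shows "prob {\<omega> \<in> space M. colour (Y e \<omega>) = r} = interval_prob r"
  using r
proof (cases rule: y_cases)
  case 1
  have "prob {\<omega> \<in> space M. colour (Y e \<omega>) = r} = prob {\<omega> \<in> space M. Y e \<omega> > x r}"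
    using 1 by (simp add: colour_eq[OF r])
  also have "\<dots> = interval_prob r"
    using 1 r x_pos x_ge[of r] by (subst prob_Y_greater[OF e]) (auto simp: interval_prob_def)
  finally show ?thesis .
next
  case (2 z)
  have "prob {\<omega> \<in> space M. colour (Y e \<omega>) = r} = prob {\<omega> \<in> space M. x r < Y e \<omega> \<and> Y e \<omega> \<le> z}"
    using 2 by (simp add: colour_eq[OF r])
  also have "\<dots> = interval_prob r"
    using 2 r x_pos x_ge[of r] by (subst prob_Y_between[OF e]) (auto simp: interval_prob_def)
  finally show ?thesis .
qed

lemma prob_colour:
  assumes e: "e \<in> J"
  shows "prob {\<omega> \<in> space M. colour (Y e \<omega>) = r} = colour_prob r"
proof -
  consider "r \<in> {1..k}" | "r > k" | "r = 0" by force
  thus ?thesis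
  proof cases
    case 1
    thus ?thesis using prob_interval[OF e 1] by (simp add: colour_prob_def)
  next
    case 2
    hence empty: "{\<omega> \<in> space M. colour (Y e \<omega>) = r} = {}"
      using colour_le by (auto simp: not_less[symmetric])
    show ?thesis unfolding empty using 2 by (simp add: colour_prob_def)
  next
    case 3
    have "prob (\<Union>r\<in>{0..k}. {\<omega> \<in> space M. colour (Y e \<omega>) = r}) = (\<Sum>r\<in>{0..k}. prob {\<omega> \<in> space M. colour (Y e \<omega>) = r})"
      by (rule finite_measure_finite_Union) (use sets_colour[OF e] in \<open>auto simp: disjoint_family_on_def\<close>)
    also have "(\<Union>r\<in>{0..k}. {\<omega> \<in> space M. colour (Y e \<omega>) = r}) = space M" using colour_le by auto
    also have "(\<Sum>r\<in>{0..k}. prob {\<omega> \<in> space M. colour (Y e \<omega>) = r})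
        = prob {\<omega> \<in> space M. colour (Y e \<omega>) = 0} + (\<Sum>r\<in>{1..k}. interval_prob r)"
      using prob_interval[OF e] by (simp add: sum.atLeast_Suc_atMost)
    finally show ?thesis using 3 by (simp add: colour_prob_def prob_space)
  qed
qed

text \<open>The event that interval \<open>j\<close> contains the rescaled moduli of exactly \<open>s j\<close> entries. The intervals are
closed on the right here; by \<open>bad_window\<close> the endpoints do not matter in the limit.\<close>

definition edge_event :: "(nat \<Rightarrow> nat) \<Rightarrow> 'w set" where
  "edge_event s = {\<omega> \<in> space M. \<forall>j\<in>{1..k}. card {e \<in> J. x j < Y e \<omega> \<and> ereal (Y e \<omega>) \<le> y j} = s j}"

lemma edge_event_colours:
  assumes s: "(\<Sum>r\<in>{1..k}. s r) \<le> card J"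
  shows "edge_event s = {\<omega> \<in> space M. image_mset (\<lambda>e. colour (Y e \<omega>)) (mset_set J) = colour_mset k s (card J)}"
proof -
  have cnt: "count (image_mset (\<lambda>e. colour (Y e \<omega>)) (mset_set J)) r = card {e \<in> J. colour (Y e \<omega>) = r}" for \<omega> r
    by (simp add: count_image_mset Int_def vimage_def conj_commute)
  have "(\<forall>j\<in>{1..k}. card {e \<in> J. x j < Y e \<omega> \<and> ereal (Y e \<omega>) \<le> y j} = s j)
      \<longleftrightarrow> image_mset (\<lambda>e. colour (Y e \<omega>)) (mset_set J) = colour_mset k s (card J)" (is "?L \<longleftrightarrow> ?R") for \<omega>
  proof
    assume ?R
    show ?L
    proof
      fix j assume j: "j \<in> {1..k}"
      have "card {e \<in> J. colour (Y e \<omega>) = j} = count (colour_mset k s (card J)) j"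
        unfolding cnt[symmetric] \<open>?R\<close> ..
      thus "card {e \<in> J. x j < Y e \<omega> \<and> ereal (Y e \<omega>) \<le> y j} = s j"
        using j by (simp add: colour_eq[OF j] count_colour_mset)
    qed
  next
    assume L: ?L
    have Lj: "card {e \<in> J. colour (Y e \<omega>) = j} = s j" if "j \<in> {1..k}" for j
      using L that by (simp add: colour_eq[OF that])
    have "card J = card (\<Union>r\<in>{0..k}. {e \<in> J. colour (Y e \<omega>) = r})"
      using colour_le by (intro arg_cong[of _ _ card]) auto
    also have "\<dots> = (\<Sum>r\<in>{0..k}. card {e \<in> J. colour (Y e \<omega>) = r})"
      by (rule card_UN_disjoint) auto
    also have "\<dots> = card {e \<in> J. colour (Y e \<omega>) = 0} + (\<Sum>r\<in>{1..k}. s r)"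
      using Lj by (simp add: sum.atLeast_Suc_atMost)
    finally have L0: "card {e \<in> J. colour (Y e \<omega>) = 0} = card J - (\<Sum>r\<in>{1..k}. s r)" by simp
    show ?R
    proof (rule multiset_eqI)
      fix r
      consider "r \<in> {1..k}" | "r > k" | "r = 0" by force
      thus "count (image_mset (\<lambda>e. colour (Y e \<omega>)) (mset_set J)) r = count (colour_mset k s (card J)) r"
      proof cases
        case 2
        hence "{e \<in> J. colour (Y e \<omega>) = r} = {}" using colour_le by (auto simp: not_less[symmetric])
        thus ?thesis using 2 by (simp add: cnt count_colour_mset)
      qed (use Lj L0 in \<open>simp_all add: cnt count_colour_mset\<close>)
    qed
  qed
  thus ?thesis by (auto simp: edge_event_def)
qed

lemma sets_edge_event: "edge_event s \<in> sets M"
proof -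
  have "{\<omega> \<in> space M. card {e \<in> J. colour (Y e \<omega>) = j} = s j} \<in> sets M" for j
  proof -
    have "(\<lambda>\<omega>. \<Sum>e\<in>J. indicat_real {\<omega> \<in> space M. colour (Y e \<omega>) = j} \<omega>) \<in> borel_measurable M"
      using sets_colour by (intro borel_measurable_sum borel_measurable_indicator)
    hence "{\<omega> \<in> space M. (\<Sum>e\<in>J. indicat_real {\<omega> \<in> space M. colour (Y e \<omega>) = j} \<omega>) = real (s j)} \<in> sets M"
      by measurable
    also have "{\<omega> \<in> space M. (\<Sum>e\<in>J. indicat_real {\<omega> \<in> space M. colour (Y e \<omega>) = j} \<omega>) = real (s j)}
        = {\<omega> \<in> space M. card {e \<in> J. colour (Y e \<omega>) = j} = s j}"
    proof -
      have "(\<Sum>e\<in>J. indicat_real {\<omega> \<in> space M. colour (Y e \<omega>) = j} \<omega>) = real (card {e \<in> J. colour (Y e \<omega>) = j})"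
        if "\<omega> \<in> space M" for \<omega>
      proof -
        have "(\<Sum>e\<in>J. indicat_real {\<omega> \<in> space M. colour (Y e \<omega>) = j} \<omega>) = (\<Sum>e\<in>{e \<in> J. colour (Y e \<omega>) = j}. 1)"
          using that by (intro sum.mono_neutral_cong_right) (auto simp: indicator_def)
        thus ?thesis by simp
      qed
      thus ?thesis by auto
    qed
    finally show ?thesis .
  qed
  moreover have "edge_event s = {\<omega> \<in> space M. \<forall>j\<in>{1..k}. card {e \<in> J. colour (Y e \<omega>) = j} = s j}"
    by (simp add: edge_event_def colour_eq)
  ultimately show ?thesis by (simp only:) (intro sets.sets_Collect_finite_All, auto)
qed

lemma prob_edge_event:
  assumes s: "(\<Sum>r\<in>{1..k}. s r) \<le> card J"
  shows "prob (edge_event s) = card (permutations_of_multiset (colour_mset k s (card J)))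
     * (\<Prod>r\<in>#colour_mset k s (card J). colour_prob r)"
  unfolding edge_event_colours[OF s]
proof (rule prob_colour_counts)
  show "indep_vars (\<lambda>_. count_space UNIV) (\<lambda>e \<omega>. colour (Y e \<omega>)) J"
    by (rule indep_vars_compose2[OF indep_Y]) (rule measurable_colour)
qed (use prob_colour size_colour_mset[OF s] in auto)

text \<open>The event that interval \<open>j\<close>, now open, contains exactly \<open>s j\<close> eigenvalues of the rescaled matrix.\<close>

definition eigenvalue_event :: "(nat \<Rightarrow> nat) \<Rightarrow> 'w set" where
  "eigenvalue_event s = {\<omega> \<in> space M. \<forall>j\<in>{1..k}. eigenvalue_count (B \<omega>) {t. x j < t \<and> ereal t < y j} = s j}"

lemma interval_count:
  assumes j: "j \<in> {1..k}" and h: "hermitian_mat n C"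
  shows "eigenvalue_count C {t. x j < t \<and> ereal t < y j} = eigenvalue_count C {x j<..}
    - (if y j = \<infinity> then 0 else eigenvalue_count C {real_of_ereal (y j)..})"
  using j
proof (cases rule: y_cases)
  case 1
  have "{t. x j < t \<and> ereal t < y j} = {x j<..}" using 1 by auto
  thus ?thesis using 1 by simp
next
  case (2 z)
  have "{t. x j < t \<and> ereal t < y j} = {x j<..<z}" using 2 by auto
  thus ?thesis using 2 eigenvalue_count_interval[OF h, of "x j" z] by simp
qed

lemma sets_eigenvalue_event: "eigenvalue_event s \<in> sets M"
proof -
  note [measurable] = measurable_eigenvalue_count[OF herm_B measurable_B_entry]
  have "{\<omega> \<in> space M. eigenvalue_count (B \<omega>) {t. x j < t \<and> ereal t < y j} = s j} \<in> sets M" if j: "j \<in> {1..k}" for j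
  proof -
    have "(\<lambda>\<omega>. (eigenvalue_count (B \<omega>) {x j<..}, eigenvalue_count (B \<omega>) {real_of_ereal (y j)..}))
        \<in> measurable M (count_space UNIV \<Otimes>\<^sub>M count_space UNIV)" by measurable
    hence "(\<lambda>\<omega>. (eigenvalue_count (B \<omega>) {x j<..}, eigenvalue_count (B \<omega>) {real_of_ereal (y j)..}))
        \<in> measurable M (count_space UNIV)" by (simp add: pair_measure_countable)
    hence "(\<lambda>\<omega>. (\<lambda>(u, v). u - (if y j = \<infinity> then 0 else v)) (eigenvalue_count (B \<omega>) {x j<..}, eigenvalue_count (B \<omega>) {real_of_ereal (y j)..}))
        \<in> measurable M (count_space UNIV)" by (rule measurable_compose) simp
    hence "{\<omega> \<in> space M. eigenvalue_count (B \<omega>) {x j<..}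
        - (if y j = \<infinity> then 0 else eigenvalue_count (B \<omega>) {real_of_ereal (y j)..}) = s j} \<in> sets M"
      by measurable
    also have "{\<omega> \<in> space M. eigenvalue_count (B \<omega>) {x j<..}
        - (if y j = \<infinity> then 0 else eigenvalue_count (B \<omega>) {real_of_ereal (y j)..}) = s j}
      = {\<omega> \<in> space M. eigenvalue_count (B \<omega>) {t. x j < t \<and> ereal t < y j} = s j}"
      using interval_count[OF j herm_B] by auto
    finally show ?thesis .
  qed
  thus ?thesis unfolding eigenvalue_event_def by (intro sets.sets_Collect_finite_All) auto
qed

lemma good_interval_count:
  assumes \<omega>: "\<omega> \<in> space M" "\<omega> \<notin> bad_diag \<epsilon>" "\<omega> \<notin> bad_pair \<epsilon>" "\<omega> \<notin> bad_row \<epsilon> \<delta>"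
    "\<And>t. t \<in> endpoints \<Longrightarrow> \<omega> \<notin> bad_window t (2 * \<delta>)"
    and t: "0 \<le> \<epsilon>" "0 < \<delta>" "\<epsilon> + 2 * \<delta> \<le> x 1" and j: "j \<in> {1..k}"
  shows "eigenvalue_count (B \<omega>) {t. x j < t \<and> ereal t < y j} = card {e \<in> J. x j < Y e \<omega> \<and> ereal (Y e \<omega>) \<le> y j}"
proof -
  have cnt: "eigenvalue_count (B \<omega>) {t<..} = large_count t \<omega>" "eigenvalue_count (B \<omega>) {t..} = large_count t \<omega>"
    if "t \<in> endpoints" for t
    using good_eigenvalue_count[OF \<omega>(1-4) \<omega>(5)[OF that] t(1,2)] endpoint_ge[OF that] t(3) by auto
  note ic = interval_count[OF j herm_B[OF \<omega>(1)]]
  show ?thesis using j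
  proof (cases rule: y_cases)
    case 1
    thus ?thesis using ic cnt[OF x_endpoint[OF j]] by (simp add: large_count_def)
  next
    case (2 z)
    have "{e \<in> J. x j < Y e \<omega> \<and> Y e \<omega> \<le> z} = {e \<in> J. Y e \<omega> > x j} - {e \<in> J. Y e \<omega> > z}" by auto
    also have "card \<dots> = large_count (x j) \<omega> - large_count z \<omega>"
      unfolding large_count_def using 2 by (intro card_Diff_subset) auto
    finally show ?thesis using ic 2 cnt[OF x_endpoint[OF j]] cnt[OF 2(3)] by simp
  qed
qed

lemma prob_events_close:
  assumes t: "0 < \<epsilon>" "0 < \<delta>" "\<epsilon> + 2 * \<delta> \<le> x 1"
  shows "\<bar>prob (eigenvalue_event s) - prob (edge_event s)\<bar>
    \<le> prob (bad_diag \<epsilon>) + prob (bad_pair \<epsilon>) + prob (bad_row \<epsilon> \<delta>)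
      + (\<Sum>t\<in>endpoints. prob (bad_window t (2 * \<delta>)))"
proof -
  define W where "W = (\<Union>t\<in>endpoints. bad_window t (2 * \<delta>))"
  define Bad where "Bad = bad_diag \<epsilon> \<union> bad_pair \<epsilon> \<union> bad_row \<epsilon> \<delta> \<union> W"
  have W: "W \<in> sets M" unfolding W_def using sets_bad_window finite_endpoints by (intro sets.finite_UN) auto
  note S = sets_bad_diag[of \<epsilon>] sets_bad_pair[of \<epsilon>] sets_bad_row[of \<epsilon> \<delta>] W
    sets_eigenvalue_event[of s] sets_edge_event[of s]
  have Bad: "Bad \<in> sets M" unfolding Bad_def using S by auto
  have iff: "\<omega> \<in> eigenvalue_event s \<longleftrightarrow> \<omega> \<in> edge_event s" if "\<omega> \<in> space M" "\<omega> \<notin> Bad" for \<omega>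
  proof -
    have "\<omega> \<notin> bad_window t (2 * \<delta>)" if "t \<in> endpoints" for t
      using \<open>\<omega> \<notin> Bad\<close> that by (auto simp: Bad_def W_def)
    hence "\<forall>j\<in>{1..k}. eigenvalue_count (B \<omega>) {t. x j < t \<and> ereal t < y j} = card {e \<in> J. x j < Y e \<omega> \<and> ereal (Y e \<omega>) \<le> y j}"
      using that t by (intro ballI good_interval_count[where \<epsilon> = \<epsilon> and \<delta> = \<delta>]) (auto simp: Bad_def)
    thus ?thesis using that by (simp add: eigenvalue_event_def edge_event_def)
  qed
  have "prob (eigenvalue_event s) \<le> prob (edge_event s \<union> Bad)"
    using iff S Bad sets.sets_into_space by (intro finite_measure_mono) blast+
  also have "\<dots> \<le> prob (edge_event s) + prob Bad" using S Bad by (intro measure_Un_le) auto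
  finally have 1: "prob (eigenvalue_event s) \<le> prob (edge_event s) + prob Bad" .
  have "prob (edge_event s) \<le> prob (eigenvalue_event s \<union> Bad)"
    using iff S Bad sets.sets_into_space by (intro finite_measure_mono) blast+
  also have "\<dots> \<le> prob (eigenvalue_event s) + prob Bad" using S Bad by (intro measure_Un_le) auto
  finally have 2: "prob (edge_event s) \<le> prob (eigenvalue_event s) + prob Bad" .
  have "prob Bad \<le> prob (bad_diag \<epsilon>) + prob (bad_pair \<epsilon>) + prob (bad_row \<epsilon> \<delta>) + prob W"
    unfolding Bad_def using S
    by (intro order_trans[OF measure_Un_le] add_mono order_refl) auto
  also have "prob W \<le> (\<Sum>t\<in>endpoints. prob (bad_window t (2 * \<delta>)))"
    unfolding W_def using sets_bad_window finite_endpoints by (intro finite_measure_subadditive_finite) auto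
  finally show ?thesis using 1 2 by linarith
qed

end

section \<open>Asymptotics\<close>

lemma measure_tendsto_0:
  assumes "eventually (\<lambda>n. measure (M n) (E n) \<le> f n) sequentially" "f \<longlonglongrightarrow> (0 :: real)"
  shows "(\<lambda>n. measure (M n) (E n)) \<longlonglongrightarrow> 0"
  by (rule tendsto_sandwich[OF _ assms(1) tendsto_const assms(2)]) auto

text \<open>A sequence of band matrices with a common tail, growing band width, and normalization \<open>b\<close>.\<close>

locale heavy_tailed_band = regular_tail \<alpha> h G
  for \<alpha> :: real and h G :: "real \<Rightarrow> real" +
  fixes p :: band_type and d N :: "nat \<Rightarrow> nat" and b :: "nat \<Rightarrow> real"
    and M :: "nat \<Rightarrow> 'w measure" and A :: "nat \<Rightarrow> 'w \<Rightarrow> complex mat"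
  assumes \<alpha>: "0 < \<alpha>" "\<alpha> < 2"
    and sample: "\<And>n. n \<ge> 1 \<Longrightarrow> band_sample (M n) p n (d n) (A n) (b n) G"
    and width: "\<And>n. n \<ge> 1 \<Longrightarrow> d n \<le> n - 1"
    and width_lim: "filterlim d at_top sequentially"
    and N: "\<And>n. N n = card (band_indices p n (d n))"
    and b_lim: "\<And>t. t > 0 \<Longrightarrow> (\<lambda>n. real (N n) * G (b n * t)) \<longlonglongrightarrow> t powr (- \<alpha>)"
begin

text \<open>Probabilities of the exceptional events for size \<open>n\<close>, and a bound on the truncated means.\<close>

abbreviation diag_prob where
  "diag_prob n \<epsilon> \<equiv> measure (M n) (band_sample.bad_diag (M n) n (A n) (b n) \<epsilon>)"
abbreviation pair_prob where
  "pair_prob n \<epsilon> \<equiv> measure (M n) (band_sample.bad_pair (M n) p n (d n) (A n) (b n) \<epsilon>)"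
abbreviation row_prob where
  "row_prob n \<epsilon> \<delta> \<equiv> measure (M n) (band_sample.bad_row (M n) p n (d n) (A n) (b n) \<epsilon> \<delta>)"
abbreviation window_prob where
  "window_prob n t \<eta> \<equiv> measure (M n) (band_sample.bad_window (M n) p n (d n) (A n) (b n) t \<eta>)"
abbreviation truncated_mean_le where
  "truncated_mean_le n \<epsilon> m \<equiv> \<forall>e\<in>band_indices p n (d n). prob_space.expectation (M n)
     (\<lambda>\<omega>. if band_sample.Y (A n) (b n) e \<omega> \<le> \<epsilon> then band_sample.Y (A n) (b n) e \<omega> else 0) \<le> m"

lemma N_ge: "n \<ge> 1 \<Longrightarrow> real n * (real (d n) + 1) \<le> 4 * real (N n)"
  unfolding N using width[of n] by (intro card_band_indices_ge) auto

lemma b_pos: "n \<ge> 1 \<Longrightarrow> b n > 0"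
  using band_sample.b[OF sample] .

lemma ev_ge_1: "eventually (\<lambda>n. n \<ge> 1) sequentially"
  by (rule eventually_ge_at_top)

lemma G_nonneg: "n \<ge> 1 \<Longrightarrow> t > 0 \<Longrightarrow> G (b n * t) \<ge> 0"
  using G_pos[of "b n * t"] b_pos[of n] by simp

lemma N_at_top: "filterlim N at_top sequentially"
proof -
  have "eventually (\<lambda>n. real n / 4 \<le> real (N n)) sequentially"
    using ev_ge_1
  proof eventually_elim
    case (elim n)
    have "real n * 1 \<le> real n * (real (d n) + 1)" by (intro mult_left_mono) auto
    thus ?case using N_ge[OF elim] by linarith
  qed
  moreover have "filterlim (\<lambda>n. real n / 4) at_top sequentially"
    by (intro filterlim_at_top_mult_tendsto_pos[where c = "1/4" and f = "\<lambda>_. 1/4" and g = real, simplified]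
        filterlim_real_sequentially)
  ultimately have "filterlim (\<lambda>n. real (N n)) at_top sequentially"
    by (rule filterlim_at_top_mono[rotated])
  thus ?thesis unfolding filterlim_sequentially_iff_filterlim_real .
qed

text \<open>This holds because \<open>G (b n) \<rightarrow> 0\<close> while \<open>G\<close> is positive and nonincreasing.\<close>

lemma b_at_top: "filterlim b at_top sequentially"
  unfolding filterlim_at_top
proof
  fix Z :: real
  define X where "X = max Z 1"
  have X: "X > 0" by (simp add: X_def)
  have "(\<lambda>n. real (N n) * G (b n * 1) / real (N n)) \<longlonglongrightarrow> 0"
    by (rule tendsto_divide_0[OF b_lim filterlim_at_top_imp_at_infinity])
       (use filterlim_compose[OF filterlim_real_sequentially N_at_top] in auto)
  hence "eventually (\<lambda>n. real (N n) * G (b n * 1) / real (N n) < G X) sequentially"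
    using G_pos[OF X] by (rule order_tendstoD(2))
  moreover have "eventually (\<lambda>n. N n \<ge> 1) sequentially" using N_at_top by (simp add: filterlim_at_top)
  ultimately show "eventually (\<lambda>n. Z \<le> b n) sequentially"
    using ev_ge_1
  proof eventually_elim
    case (elim n)
    hence *: "G (b n) < G X" by simp
    have "X \<le> b n"
    proof (rule ccontr)
      assume "\<not> X \<le> b n"
      hence "G X \<le> G (b n)" using b_pos[OF elim(3)] by (intro anti) auto
      with * show False by simp
    qed
    thus ?case by (simp add: X_def)
  qed
qed

lemma bad_diag_lim:
  assumes "\<epsilon> > 0"
  shows "(\<lambda>n. diag_prob n \<epsilon>) \<longlonglongrightarrow> 0"
proof (rule measure_tendsto_0)
  have dlim: "filterlim (\<lambda>n. real (d n)) at_top sequentially"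
    by (rule filterlim_compose[OF filterlim_real_sequentially width_lim])
  have "filterlim (\<lambda>n. 1 + real (d n)) at_top sequentially"
    by (rule filterlim_tendsto_add_at_top[OF tendsto_const dlim])
  hence "(\<lambda>n. real (N n) * G (b n * \<epsilon>) / (1 + real (d n))) \<longlonglongrightarrow> 0"
    by (intro tendsto_divide_0[OF b_lim[OF assms]] filterlim_at_top_imp_at_infinity)
  thus "(\<lambda>n. 4 * (real (N n) * G (b n * \<epsilon>) / (1 + real (d n)))) \<longlonglongrightarrow> 0"
    using tendsto_mult_right_zero by blast
  show "eventually (\<lambda>n. diag_prob n \<epsilon>
     \<le> 4 * (real (N n) * G (b n * \<epsilon>) / (1 + real (d n)))) sequentially"
    using ev_ge_1
  proof eventually_elim
    case (elim n)
    have "diag_prob n \<epsilon> \<le> real n * G (b n * \<epsilon>)"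
      by (rule band_sample.prob_bad_diag[OF sample[OF elim] assms])
    also have "real n \<le> 4 * real (N n) / (1 + real (d n))"
      using N_ge[OF elim] by (simp add: field_simps)
    hence "real n * G (b n * \<epsilon>) \<le> 4 * real (N n) / (1 + real (d n)) * G (b n * \<epsilon>)"
      using G_nonneg[OF elim assms] by (intro mult_right_mono) auto
    finally show ?case by simp
  qed
qed

lemma bad_pair_lim:
  assumes "\<epsilon> > 0"
  shows "(\<lambda>n. pair_prob n \<epsilon>) \<longlonglongrightarrow> 0"
proof (rule measure_tendsto_0)
  have "(\<lambda>n. (real (N n) * G (b n * \<epsilon>))\<^sup>2 / real n) \<longlonglongrightarrow> 0"
    by (rule tendsto_divide_0[OF tendsto_power[OF b_lim[OF assms]]])
       (rule filterlim_at_top_imp_at_infinity[OF filterlim_real_sequentially])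
  thus "(\<lambda>n. 256 * ((real (N n) * G (b n * \<epsilon>))\<^sup>2 / real n)) \<longlonglongrightarrow> 0"
    using tendsto_mult_right_zero by blast
  show "eventually (\<lambda>n. pair_prob n \<epsilon>
     \<le> 256 * ((real (N n) * G (b n * \<epsilon>))\<^sup>2 / real n)) sequentially"
    using ev_ge_1
  proof eventually_elim
    case (elim n)
    have "pair_prob n \<epsilon>
        \<le> real n * ((4 * (real (d n) + 1))\<^sup>2 * (G (b n * \<epsilon>))\<^sup>2)"
      by (rule band_sample.prob_bad_pair[OF sample[OF elim] assms])
    also have "\<dots> = 16 * ((real n * (real (d n) + 1))\<^sup>2 * (G (b n * \<epsilon>))\<^sup>2) / real n"
      using elim by (simp add: power2_eq_square field_simps)
    also have "\<dots> \<le> 16 * ((4 * real (N n))\<^sup>2 * (G (b n * \<epsilon>))\<^sup>2) / real n"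
      using N_ge[OF elim] by (intro divide_right_mono mult_left_mono mult_right_mono power_mono) auto
    also have "\<dots> = 256 * ((real (N n) * G (b n * \<epsilon>))\<^sup>2 / real n)"
      by (simp add: power_mult_distrib)
    finally show ?case .
  qed
qed

text \<open>The means of the truncated entries of one row add up to \<open>O(n\<^sup>1\<^sup>-\<^sup>2\<^sup>\<rho>)\<close> with \<open>\<rho> > 1 / 2\<close>; \<open>m'\<close> is a
bound on the mean of one entry, and a row has at most \<open>4 (d n + 1)\<close> entries.\<close>

lemma truncated_mean_bound:
  obtains m \<rho> where "m \<ge> 0" "1 < 2 * \<rho>"
    "\<And>\<epsilon>. 0 < \<epsilon> \<Longrightarrow> \<epsilon> \<le> 1 \<Longrightarrow> eventually (\<lambda>n. \<exists>m'\<ge>0. 4 * (real (d n) + 1) * m' \<le> m * real n powr (1 - 2 * \<rho>) \<and>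
       truncated_mean_le n \<epsilon> m') sequentially"
proof -
  \<comment> \<open>exponents with \<open>\<alpha> / 2 < q < \<beta>' < \<alpha> < \<beta> < 2 q\<close>, possible with \<open>q < 1\<close> since \<open>\<alpha> < 2\<close>\<close>
  define q where "q = (\<alpha> / 2 + min 1 \<alpha>) / 2"
  have q: "\<alpha> / 2 < q" "q < 1" "q < \<alpha>" "q > 0" using \<alpha> by (auto simp: q_def min_def field_simps)
  define \<beta> where "\<beta> = (\<alpha> + 2 * q) / 2"
  have \<beta>: "\<alpha> < \<beta>" "\<beta> < 2 * q" "\<beta> > 0" using q \<alpha> by (auto simp: \<beta>_def)
  define \<beta>' where "\<beta>' = (q + \<alpha>) / 2"
  have \<beta>': "q < \<beta>'" "\<beta>' < \<alpha>" "\<beta>' > 0" using q by (auto simp: \<beta>'_def)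
  obtain C x0 where C: "C > 0" "x0 > 0" "\<And>x. x \<ge> x0 \<Longrightarrow> G x \<le> C * x powr (- \<beta>')"
    using tail_upper[OF \<beta>'(2,3)] by blast
  obtain c x1 where c: "c > 0" "x1 > 0" "\<And>x. x \<ge> x1 \<Longrightarrow> c * x powr (- \<beta>) \<le> G x"
    using tail_lower[OF \<beta>(1,3)] by blast
  define mq where "mq = x0 powr q + C * 2 powr q * x0 powr (q - \<beta>') / (1 - 2 powr (q - \<beta>'))"
  have "2 powr (q - \<beta>') < 1" using \<beta>' by (intro powr_less_one) auto
  hence mq: "mq \<ge> 0" using C by (auto simp: mq_def)
  define \<rho> where "\<rho> = q / \<beta>"
  have \<rho>: "1 < 2 * \<rho>" "\<rho> < 1" "\<rho> > 0" using \<beta> q by (auto simp: \<rho>_def field_simps)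
  define K where "K = (8 / c) powr \<rho>"
  show ?thesis
  proof
    show "4 * mq * K \<ge> 0" using mq by (simp add: K_def)
    show "1 < 2 * \<rho>" by fact
    fix \<epsilon> :: real assume \<epsilon>: "0 < \<epsilon>" "\<epsilon> \<le> 1"
    have "eventually (\<lambda>n. b n \<ge> x1) sequentially" using b_at_top by (simp add: filterlim_at_top)
    moreover have "eventually (\<lambda>n. real (N n) * G (b n * 1) < 2) sequentially"
      using order_tendstoD(2)[OF b_lim[of 1], of 2] by simp
    ultimately show "eventually (\<lambda>n. \<exists>m'\<ge>0. 4 * (real (d n) + 1) * m' \<le> 4 * mq * K * real n powr (1 - 2 * \<rho>) \<and>
       truncated_mean_le n \<epsilon> m') sequentially"
      using ev_ge_1
    proof eventually_elim
      case (elim n)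
      interpret band_sample "M n" p n "d n" "A n" "b n" G by (rule sample[OF elim(3)])
      have n: "real n \<ge> 1" using elim by simp
      have D: "real (d n) + 1 \<le> real n" using width[OF elim(3)] elim(3) by linarith
      have Npos: "real (N n) > 0"
      proof -
        have "0 < real n * (real (d n) + 1)" using n by simp
        thus ?thesis using N_ge[OF elim(3)] by linarith
      qed
      have "c * b n powr (- \<beta>) * real (N n) \<le> G (b n) * real (N n)"
        using c(3)[OF elim(1)] by (intro mult_right_mono) auto
      also have "\<dots> \<le> 2" using elim(2) by (simp add: mult.commute)
      finally have "b n powr (- \<beta>) \<le> 2 / (c * real (N n))"
        using c Npos by (simp add: field_simps)
      also have "\<dots> \<le> 8 / c * (1 / (real n * (real (d n) + 1)))"
      proof -
        have "1 / (4 * real (N n)) \<le> 1 / (real n * (real (d n) + 1))"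
          using N_ge[OF elim(3)] Npos n by (intro frac_le) auto
        hence "8 / c * (1 / (4 * real (N n))) \<le> 8 / c * (1 / (real n * (real (d n) + 1)))"
          using c by (intro mult_left_mono) auto
        moreover have "8 / c * (1 / (4 * real (N n))) = 2 / (c * real (N n))"
          using c Npos by (simp add: field_simps)
        ultimately show ?thesis by (simp only:)
      qed
      \<comment> \<open>the lower bound on \<open>b n\<close> comes from \<open>c (b n)\<^sup>-\<^sup>\<beta> \<le> G (b n) \<le> 2 / N n\<close>\<close>
      finally have "(b n powr (- \<beta>)) powr \<rho> \<le> (8 / c * (1 / (real n * (real (d n) + 1)))) powr \<rho>"
        using \<rho> by (intro powr_mono2) auto
      also have "(b n powr (- \<beta>)) powr \<rho> = b n powr (- q)"
        using \<beta> by (simp add: powr_powr \<rho>_def)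
      also have "(8 / c * (1 / (real n * (real (d n) + 1)))) powr \<rho> = K * (real n powr (- \<rho>) * (real (d n) + 1) powr (- \<rho>))"
        using c n by (simp add: K_def powr_mult powr_divide powr_minus divide_simps)
      finally have bq: "b n powr (- q) \<le> K * (real n powr (- \<rho>) * (real (d n) + 1) powr (- \<rho>))" .
      have "(real (d n) + 1) * b n powr (- q) \<le> (real (d n) + 1) * (K * (real n powr (- \<rho>) * (real (d n) + 1) powr (- \<rho>)))"
        by (intro mult_left_mono bq) auto
      also have "\<dots> = K * real n powr (- \<rho>) * (real (d n) + 1) powr (1 - \<rho>)"
        by (simp add: powr_diff powr_minus divide_simps add_pos_nonneg)
      also have "\<dots> \<le> K * real n powr (- \<rho>) * real n powr (1 - \<rho>)"
        using D \<rho> by (intro mult_left_mono powr_mono2) (auto simp: K_def)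
      also have "\<dots> = K * real n powr (1 - 2 * \<rho>)"
        by (simp add: powr_add[symmetric])
      finally have *: "(real (d n) + 1) * b n powr (- q) \<le> K * real n powr (1 - 2 * \<rho>)" .
      have "4 * (real (d n) + 1) * (mq * b n powr (- q)) = 4 * mq * ((real (d n) + 1) * b n powr (- q))" by simp
      also have "\<dots> \<le> 4 * mq * (K * real n powr (1 - 2 * \<rho>))"
        using mq by (intro mult_left_mono *) auto
      finally have "4 * (real (d n) + 1) * (mq * b n powr (- q)) \<le> 4 * mq * K * real n powr (1 - 2 * \<rho>)" by simp
      moreover have "expectation (\<lambda>\<omega>. if Y e \<omega> \<le> \<epsilon> then Y e \<omega> else 0) \<le> mq * b n powr (- q)" if "e \<in> J" for e
        by (rule expectation_small_le[OF that \<epsilon> q(4) _ \<beta>'(1) C mq_def]) (use q in auto)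
      ultimately show ?case using mq by (intro exI[of _ "mq * b n powr (- q)"]) auto
    qed
  qed
qed

text \<open>With \<open>\<theta> = 2 ln n / \<delta>\<close> the factor \<open>exp (\<theta> \<epsilon>) = n\<^sup>2\<^sup>\<epsilon>\<^sup>/\<^sup>\<delta>\<close> is compensated by the mean of the row as
soon as \<open>2 \<epsilon> / \<delta> \<le> 2 \<rho> - 1\<close>, while \<open>exp (- \<theta> \<delta>) = n\<^sup>-\<^sup>2\<close> beats the number \<open>n\<close> of rows.\<close>

lemma bad_row_lim:
  assumes \<delta>: "\<delta> > 0"
  obtains \<epsilon>0 where "\<epsilon>0 > 0" "\<And>\<epsilon>. 0 < \<epsilon> \<Longrightarrow> \<epsilon> \<le> \<epsilon>0 \<Longrightarrow>
     (\<lambda>n. row_prob n \<epsilon> \<delta>) \<longlonglongrightarrow> 0"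
proof -
  obtain m \<rho> where m: "m \<ge> 0" "1 < 2 * \<rho>" and ev:
    "\<And>\<epsilon>. 0 < \<epsilon> \<Longrightarrow> \<epsilon> \<le> 1 \<Longrightarrow> eventually (\<lambda>n. \<exists>m'\<ge>0. 4 * (real (d n) + 1) * m' \<le> m * real n powr (1 - 2 * \<rho>) \<and>
       truncated_mean_le n \<epsilon> m') sequentially"
    by (rule truncated_mean_bound) (rule that)
  show ?thesis
  proof
    show "min 1 (\<delta> * (2 * \<rho> - 1) / 2) > 0" using m \<delta> by simp
    fix \<epsilon> assume \<epsilon>: "0 < \<epsilon>" "\<epsilon> \<le> min 1 (\<delta> * (2 * \<rho> - 1) / 2)"
    hence \<epsilon>1: "\<epsilon> \<le> 1" by simp
    show "(\<lambda>n. row_prob n \<epsilon> \<delta>) \<longlonglongrightarrow> 0"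
    proof (rule measure_tendsto_0)
      show "(\<lambda>n. exp (m / \<epsilon>) / real n) \<longlonglongrightarrow> 0"
        by (rule tendsto_divide_0[OF tendsto_const filterlim_at_top_imp_at_infinity[OF filterlim_real_sequentially]])
      show "eventually (\<lambda>n. row_prob n \<epsilon> \<delta> \<le> exp (m / \<epsilon>) / real n) sequentially"
        using ev[OF \<epsilon>(1) \<epsilon>1] eventually_ge_at_top[of 2]
      proof eventually_elim
        case 2: (elim n)
        hence n1: "n \<ge> 1" by simp
        interpret band_sample "M n" p n "d n" "A n" "b n" G by (rule sample[OF n1])
        obtain m' where m': "m' \<ge> 0" "4 * (real (d n) + 1) * m' \<le> m * real n powr (1 - 2 * \<rho>)"
          "\<And>e. e \<in> J \<Longrightarrow> expectation (\<lambda>\<omega>. if Y e \<omega> \<le> \<epsilon> then Y e \<omega> else 0) \<le> m'"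
          using 2 by blast
        define \<theta> where "\<theta> = 2 * ln (real n) / \<delta>"
        have ln: "ln (real n) > 0" using 2 by simp
        have \<theta>: "\<theta> > 0" using ln \<delta> by (simp add: \<theta>_def)
        have "\<theta> * \<epsilon> \<le> (2 * \<rho> - 1) * ln (real n)"
        proof -
          have "2 * \<epsilon> / \<delta> \<le> 2 * \<rho> - 1" using \<epsilon> \<delta> by (simp add: field_simps)
          hence "2 * \<epsilon> / \<delta> * ln (real n) \<le> (2 * \<rho> - 1) * ln (real n)" using ln by (intro mult_right_mono) auto
          thus ?thesis by (simp add: \<theta>_def mult_ac)
        qed
        hence "exp (\<theta> * \<epsilon>) \<le> exp ((2 * \<rho> - 1) * ln (real n))" by simp
        also have "\<dots> = real n powr (2 * \<rho> - 1)" using 2 by (simp add: powr_def)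
        finally have e\<theta>: "exp (\<theta> * \<epsilon>) \<le> real n powr (2 * \<rho> - 1)" .
        have "4 * (real (d n) + 1) * (m' * (exp (\<theta> * \<epsilon>) / \<epsilon>)) = 4 * (real (d n) + 1) * m' * exp (\<theta> * \<epsilon>) / \<epsilon>"
          by simp
        also have "\<dots> \<le> m * real n powr (1 - 2 * \<rho>) * real n powr (2 * \<rho> - 1) / \<epsilon>"
          using \<epsilon> m by (intro divide_right_mono mult_mono[OF m'(2) e\<theta>]) auto
        also have "\<dots> = m / \<epsilon>" using 2 by (simp flip: powr_add)
        finally have ex: "4 * (real (d n) + 1) * (m' * (exp (\<theta> * \<epsilon>) / \<epsilon>)) \<le> m / \<epsilon>" .
        have "prob (bad_row \<epsilon> \<delta>) \<le> real n * exp (- \<theta> * \<delta> + 4 * (real (d n) + 1) * (m' * (exp (\<theta> * \<epsilon>) / \<epsilon>)))"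
          by (rule prob_bad_row[OF m'(3,1) \<epsilon>(1) \<theta>])
        also have "\<dots> \<le> real n * exp (- \<theta> * \<delta> + m / \<epsilon>)" using ex by (intro mult_left_mono) auto
        also have "\<dots> = real n * (exp (- (2 * ln (real n))) * exp (m / \<epsilon>))"
          using \<delta> by (simp add: \<theta>_def flip: exp_add)
        also have "exp (- (2 * ln (real n))) = 1 / (real n)\<^sup>2"
          using 2 by (simp add: exp_minus exp_double divide_simps)
        also have "real n * (1 / (real n)\<^sup>2 * exp (m / \<epsilon>)) = exp (m / \<epsilon>) / real n"
          using 2 by (simp add: power2_eq_square)
        finally show ?case .
      qed
    qed
  qed
qed

lemma bad_window_lim:
  assumes "0 \<le> \<eta>" "\<eta> < t" "e > 0"
  shows "eventually (\<lambda>n. window_prob n t \<eta>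
     < (t - \<eta>) powr (- \<alpha>) - (t + \<eta>) powr (- \<alpha>) + e) sequentially"
proof -
  have "(\<lambda>n. real (N n) * G (b n * (t - \<eta>)) - real (N n) * G (b n * (t + \<eta>)))
      \<longlonglongrightarrow> (t - \<eta>) powr (- \<alpha>) - (t + \<eta>) powr (- \<alpha>)"
    using assms by (intro tendsto_diff b_lim) auto
  hence "eventually (\<lambda>n. real (N n) * G (b n * (t - \<eta>)) - real (N n) * G (b n * (t + \<eta>))
     < (t - \<eta>) powr (- \<alpha>) - (t + \<eta>) powr (- \<alpha>) + e) sequentially"
    using assms by (intro order_tendstoD(2)) auto
  thus ?thesis using ev_ge_1
  proof eventually_elim
    case (elim n)
    have "window_prob n t \<eta>
       \<le> real (N n) * G (b n * (t - \<eta>)) - real (N n) * G (b n * (t + \<eta>))"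
      unfolding N by (rule band_sample.prob_bad_window[OF sample[OF elim(2)]]) (use assms in auto)
    thus ?case using elim by simp
  qed
qed

end

locale heavy_tailed_band_intervals =
  heavy_tailed_band \<alpha> h G p d N b M A + separated_intervals k x y
  for \<alpha> h G p d N b and M :: "nat \<Rightarrow> 'w measure" and A k x y
begin

lemma sample_intervals: "n \<ge> 1 \<Longrightarrow> band_sample_intervals (M n) p n (d n) (A n) (b n) G k x y"
  by (rule band_sample_intervals.intro[OF sample separated_intervals_axioms])

text \<open>The probabilities of the counts \<open>s\<close> of large entries and of eigenvalues in the intervals.\<close>

definition edge_prob :: "(nat \<Rightarrow> nat) \<Rightarrow> nat \<Rightarrow> real" where
  "edge_prob s n = measure (M n) (band_sample_intervals.edge_event (M n) p n (d n) (A n) (b n) k x y s)"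
definition eigenvalue_prob :: "(nat \<Rightarrow> nat) \<Rightarrow> nat \<Rightarrow> real" where
  "eigenvalue_prob s n = measure (M n) (band_sample_intervals.eigenvalue_event (M n) (A n) (b n) k x y s)"

text \<open>The mass that the intensity \<open>\<alpha> / t\<^sup>1\<^sup>+\<^sup>\<alpha>\<close> gives to interval \<open>r\<close>.\<close>

definition limit_mean :: "nat \<Rightarrow> real" where
  "limit_mean r = x r powr (- \<alpha>) - (if y r = \<infinity> then 0 else real_of_ereal (y r) powr (- \<alpha>))"

lemma interval_prob_lim:
  assumes r: "r \<in> {1..k}"
  shows "(\<lambda>n. real (N n) * band_sample_intervals.interval_prob (b n) G x y r) \<longlonglongrightarrow> limit_mean r"
proof -
  have x0: "x r > 0" using x_pos x_ge[of r] r by auto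
  have "(\<lambda>n. real (N n) * G (b n * x r) - (if y r = \<infinity> then 0 else real (N n) * G (b n * real_of_ereal (y r))))
     \<longlonglongrightarrow> limit_mean r"
    using r
  proof (cases rule: y_cases)
    case 1
    thus ?thesis using b_lim[OF x0] by (simp add: limit_mean_def)
  next
    case (2 z)
    thus ?thesis using x0 by (auto simp: limit_mean_def intro!: tendsto_diff b_lim)
  qed
  moreover have "eventually (\<lambda>n. real (N n) * G (b n * x r) - (if y r = \<infinity> then 0 else real (N n) * G (b n * real_of_ereal (y r)))
     = real (N n) * band_sample_intervals.interval_prob (b n) G x y r) sequentially"
    using ev_ge_1
    by eventually_elim
       (simp add: band_sample_intervals.interval_prob_def[OF sample_intervals] right_diff_distrib)
  ultimately show ?thesis by (rule Lim_transform_eventually)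
qed

lemma edge_event_lim:
  "edge_prob s
     \<longlonglongrightarrow> (\<Prod>r\<in>{1..k}. limit_mean r ^ s r / fact (s r) * exp (- limit_mean r))"
proof -
  \<comment> \<open>for \<open>n = 0\<close>, where nothing is assumed, an arbitrary probability vector\<close>
  define q where "q n r = (if n = 0 then if r = 0 then 1 else 0
      else band_sample_intervals.colour_prob (b n) G k x y r)" for n r
  have cp: "band_sample_intervals.colour_prob (b n) G k x y r
      = (if r = 0 then 1 - (\<Sum>r\<in>{1..k}. band_sample_intervals.interval_prob (b n) G x y r)
         else if r \<le> k then band_sample_intervals.interval_prob (b n) G x y r else 0)" if "n \<ge> 1" for n r
    by (rule band_sample_intervals.colour_prob_def[OF sample_intervals[OF that]])
  have q0: "q n r \<ge> 0" for n r
  proof (cases "n = 0")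
    case False
    hence n: "n \<ge> 1" by simp
    have "(0, 0) \<in> band_indices p n (d n)" using n by (cases p) (auto simp: band_indices_def)
    from band_sample_intervals.prob_colour[OF sample_intervals[OF n] this, of r, symmetric]
    show ?thesis using False by (simp add: q_def)
  qed (simp add: q_def)
  have q1: "q n 0 = 1 - (\<Sum>r\<in>{1..k}. q n r)" for n
    by (cases "n = 0") (simp_all add: q_def cp)
  have ql: "(\<lambda>n. real (N n) * q n r) \<longlonglongrightarrow> limit_mean r" if r: "r \<in> {1..k}" for r
  proof (rule Lim_transform_eventually[OF interval_prob_lim[OF r]])
    show "eventually (\<lambda>n. real (N n) * band_sample_intervals.interval_prob (b n) G x y r = real (N n) * q n r) sequentially"
      using ev_ge_1 by eventually_elim (use r in \<open>simp add: q_def cp\<close>)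
  qed
  have "eventually (\<lambda>n. (\<Sum>r\<in>{1..k}. s r) \<le> N n) sequentially" using N_at_top by (simp add: filterlim_at_top)
  hence "eventually (\<lambda>n. real (card (permutations_of_multiset (colour_mset k s (N n)))) * (\<Prod>r\<in>#colour_mset k s (N n). q n r)
     = edge_prob s n) sequentially"
    using ev_ge_1
  proof eventually_elim
    case (elim n)
    have "q n = band_sample_intervals.colour_prob (b n) G k x y" using elim by (auto simp: q_def fun_eq_iff)
    thus ?case
      using band_sample_intervals.prob_edge_event[OF sample_intervals[OF elim(2)], of s] elim(1) by (simp add: N edge_prob_def)
  qed
  from Lim_transform_eventually[OF multinomial_Poisson_limit[OF N_at_top q0 q1 ql] this] show ?thesis .
qed

lemma window_small:
  assumes "e > 0"
  obtains \<delta> where "\<delta> > 0" "4 * \<delta> \<le> x 1"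
    "(\<Sum>t\<in>endpoints. (t - 2 * \<delta>) powr (- \<alpha>) - (t + 2 * \<delta>) powr (- \<alpha>)) < e"
proof -
  have "((\<lambda>\<delta>. \<Sum>t\<in>endpoints. (t - 2 * \<delta>) powr (- \<alpha>) - (t + 2 * \<delta>) powr (- \<alpha>))
      \<longlongrightarrow> (\<Sum>t\<in>endpoints. (t - 2 * 0) powr (- \<alpha>) - (t + 2 * 0) powr (- \<alpha>))) (at_right 0)"
  proof (intro tendsto_sum tendsto_diff tendsto_powr tendsto_add tendsto_mult tendsto_const tendsto_ident_at)
    fix t assume "t \<in> endpoints"
    hence "t > 0" using endpoint_ge x_pos by force
    thus "t - 2 * 0 \<noteq> 0" "t + 2 * 0 \<noteq> 0" by auto
  qed
  hence "eventually (\<lambda>\<delta>. (\<Sum>t\<in>endpoints. (t - 2 * \<delta>) powr (- \<alpha>) - (t + 2 * \<delta>) powr (- \<alpha>)) < e) (at_right 0)"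
    using assms by (intro order_tendstoD(2)) auto
  moreover have "eventually (\<lambda>\<delta>. \<delta> \<in> {0<..<x 1 / 4}) (at_right 0)"
    using x_pos by (intro eventually_at_right_real) auto
  ultimately have "eventually (\<lambda>\<delta>. \<delta> \<in> {0<..<x 1 / 4} \<and>
      (\<Sum>t\<in>endpoints. (t - 2 * \<delta>) powr (- \<alpha>) - (t + 2 * \<delta>) powr (- \<alpha>)) < e) (at_right 0)"
    by eventually_elim auto
  from eventually_happens[OF this] obtain \<delta> where "\<delta> \<in> {0<..<x 1 / 4}"
      "(\<Sum>t\<in>endpoints. (t - 2 * \<delta>) powr (- \<alpha>) - (t + 2 * \<delta>) powr (- \<alpha>)) < e"
    by auto
  thus ?thesis using that[of \<delta>] by simp
qed

text \<open>For fixed \<open>\<delta>\<close> the two events differ with a probability whose upper limit is bounded by the intensity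
of the windows of half-width \<open>2 \<delta>\<close> around the endpoints, which is small with \<open>\<delta>\<close>.\<close>

theorem eigenvalue_event_lim:
  "eigenvalue_prob s
     \<longlonglongrightarrow> (\<Prod>r\<in>{1..k}. limit_mean r ^ s r / fact (s r) * exp (- limit_mean r))"
proof -
  have "(\<lambda>n. eigenvalue_prob s n - edge_prob s n) \<longlonglongrightarrow> 0"
  proof (rule tendstoI)
    fix e :: real assume e: "e > 0"
    define c where "c = e / 2 / (real (card endpoints) + 1)"
    have c: "c > 0" using e by (simp add: c_def add_pos_nonneg divide_pos_pos)
    have ce: "(\<Sum>t\<in>endpoints. c) \<le> e / 2"
      using e by (simp add: c_def field_simps)
    obtain \<delta> where \<delta>: "\<delta> > 0" "4 * \<delta> \<le> x 1"
      "(\<Sum>t\<in>endpoints. (t - 2 * \<delta>) powr (- \<alpha>) - (t + 2 * \<delta>) powr (- \<alpha>)) < e / 4"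
      using window_small[of "e / 4"] e by auto
    obtain \<epsilon>0 where \<epsilon>0: "\<epsilon>0 > 0" "\<And>\<epsilon>. 0 < \<epsilon> \<Longrightarrow> \<epsilon> \<le> \<epsilon>0 \<Longrightarrow>
       (\<lambda>n. row_prob n \<epsilon> \<delta>) \<longlonglongrightarrow> 0"
      by (rule bad_row_lim[OF \<delta>(1)]) (rule that)
    define \<epsilon> where "\<epsilon> = min \<epsilon>0 (2 * \<delta>)"
    have \<epsilon>: "\<epsilon> > 0" "\<epsilon> \<le> \<epsilon>0" "\<epsilon> + 2 * \<delta> \<le> x 1" using \<epsilon>0 \<delta> by (auto simp: \<epsilon>_def)
    have "(\<lambda>n. diag_prob n \<epsilon>
        + pair_prob n \<epsilon>
        + row_prob n \<epsilon> \<delta>) \<longlonglongrightarrow> 0 + 0 + 0"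
      by (intro tendsto_add bad_diag_lim bad_pair_lim \<epsilon>0(2) \<epsilon>)
    hence ev1: "eventually (\<lambda>n. diag_prob n \<epsilon>
        + pair_prob n \<epsilon>
        + row_prob n \<epsilon> \<delta> < e / 4) sequentially"
      using e by (intro order_tendstoD(2)) auto
    have ev2: "eventually (\<lambda>n. \<forall>t\<in>endpoints. window_prob n t (2 * \<delta>)
       < (t - 2 * \<delta>) powr (- \<alpha>) - (t + 2 * \<delta>) powr (- \<alpha>) + c) sequentially"
    proof (intro eventually_ball_finite finite_endpoints ballI bad_window_lim c)
      fix t assume "t \<in> endpoints"
      thus "2 * \<delta> < t" using endpoint_ge[of t] \<delta> by linarith
    qed (use \<delta> in auto)
    show "eventually (\<lambda>n. dist (eigenvalue_prob s n - edge_prob s n) 0 < e) sequentially"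
      using ev1 ev2 ev_ge_1
    proof eventually_elim
      case (elim n)
      have "\<bar>eigenvalue_prob s n - edge_prob s n\<bar> \<le> diag_prob n \<epsilon>
        + pair_prob n \<epsilon>
        + row_prob n \<epsilon> \<delta>
        + (\<Sum>t\<in>endpoints. window_prob n t (2 * \<delta>))"
        unfolding edge_prob_def eigenvalue_prob_def
        by (rule band_sample_intervals.prob_events_close[OF sample_intervals[OF elim(3)] \<epsilon>(1) \<delta>(1) \<epsilon>(3)])
      also have "(\<Sum>t\<in>endpoints. window_prob n t (2 * \<delta>))
        \<le> (\<Sum>t\<in>endpoints. ((t - 2 * \<delta>) powr (- \<alpha>) - (t + 2 * \<delta>) powr (- \<alpha>)) + c)"
        using elim(2) by (intro sum_mono less_imp_le) blast
      also have "\<dots> = (\<Sum>t\<in>endpoints. (t - 2 * \<delta>) powr (- \<alpha>) - (t + 2 * \<delta>) powr (- \<alpha>)) + (\<Sum>t\<in>endpoints. c)"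
        by (rule sum.distrib)
      also have "\<dots> < e / 4 + e / 2" using \<delta>(3) ce by (rule add_less_le_mono)
      finally show ?case using elim(1) by simp
    qed
  qed
  from tendsto_add[OF this edge_event_lim[of s]]
  show ?thesis by simp
qed

end

lemma mat_adjoint_index:
  assumes "A \<in> carrier_mat n n" "i < n" "j < n"
  shows "mat_adjoint A $$ (i, j) = cnj (A $$ (j, i))"
  using assms by (simp add: mat_adjoint_def mat_of_rows_def)

text \<open>Both ensembles satisfy the hypotheses above. The law of the entries enters only through its tail.\<close>

lemma band_sample_of_ensemble:
  assumes ens: "real_symmetric_band_ensemble p n d D M A \<or> hermitian_band_ensemble p n d D D0 M A"
    and tail: "\<And>i j t. (i, j) \<in> band_indices p n d \<Longrightarrow> t > 0 \<Longrightarrow>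
        measure M {\<omega> \<in> space M. cmod (A \<omega> $$ (i, j)) > t} = G t"
    and b: "b > 0"
  shows "band_sample M p n d A b G"
proof -
  have M: "prob_space M"
    using ens by (auto simp: real_symmetric_band_ensemble_def hermitian_band_ensemble_def)
  have bm: "band_matrix p n d (A \<omega>)" if "\<omega> \<in> space M" for \<omega>
    using ens that by (auto simp: real_symmetric_band_ensemble_def hermitian_band_ensemble_def)
  have Ac: "A \<omega> \<in> carrier_mat n n" if "\<omega> \<in> space M" for \<omega>
    using bm[OF that] by (simp add: band_matrix_def)
  have sym: "A \<omega> $$ (j, i) = cnj (A \<omega> $$ (i, j))" if \<omega>: "\<omega> \<in> space M" and ij: "i < n" "j < n" for \<omega> i j
    using ens
  proof
    assume "real_symmetric_band_ensemble p n d D M A"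
    hence R: "A \<omega> $$ (i, j) \<in> \<real>" and T: "transpose_mat (A \<omega>) = A \<omega>"
      using \<omega> ij by (auto simp: real_symmetric_band_ensemble_def)
    have "A \<omega> $$ (j, i) = transpose_mat (A \<omega>) $$ (i, j)" using ij Ac[OF \<omega>] by simp
    thus ?thesis using R T by (simp add: Reals_cnj_iff)
  next
    assume "hermitian_band_ensemble p n d D D0 M A"
    hence T: "mat_adjoint (A \<omega>) = A \<omega>" using \<omega> by (auto simp: hermitian_band_ensemble_def)
    show ?thesis using mat_adjoint_index[OF Ac[OF \<omega>] ij(2,1)] T by simp
  qed
  have ind: "prob_space.indep_vars M (\<lambda>_. borel) (\<lambda>(j, k) \<omega>. A \<omega> $$ (j, k)) (band_indices p n d)"
    using ens by (auto simp: real_symmetric_band_ensemble_def hermitian_band_ensemble_def)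
  show ?thesis
  proof (intro band_sample.intro band_sample_axioms.intro M ind b)
    show "hermitian_mat n (A \<omega>)" if "\<omega> \<in> space M" for \<omega>
      using Ac[OF that] sym[OF that] unfolding hermitian_mat_def by blast
    show "A \<omega> $$ (i, j) = 0" if "\<omega> \<in> space M" "i < n" "j < n" "d < band_dist p n i j" for \<omega> i j
      using bm[OF that(1)] that by (simp add: band_matrix_def)
    show "measure M {\<omega> \<in> space M. t < cmod (A \<omega> $$ e)} = G t" if "e \<in> band_indices p n d" "0 < t" for e t
      using tail[of "fst e" "snd e" t] that by simp
  qed
qed

section \<open>The Poisson limit\<close>

theorem theorem1:
  fixes \<alpha> :: real and h G :: "real \<Rightarrow> real"
    and p :: band_type and d N :: "nat \<Rightarrow> nat" and b :: "nat \<Rightarrow> real"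
    and M :: "nat \<Rightarrow> 'w measure" and A :: "nat \<Rightarrow> 'w \<Rightarrow> complex mat"
    and D D\<^sub>0 :: "complex measure"
    and k :: nat and x :: "nat \<Rightarrow> real" and y :: "nat \<Rightarrow> ereal"
    and I :: "nat \<Rightarrow> real set" and \<mu> :: "nat \<Rightarrow> real" and s :: "nat \<Rightarrow> nat"
  assumes alpha: "0 < \<alpha>" "\<alpha> < 2"
    and h: "slowly_varying h"
    and G: "\<And>t. t > 0 \<Longrightarrow> G t = h t / t powr \<alpha>"
    and width: "\<And>n. n \<ge> 1 \<Longrightarrow> d n \<le> n - 1"
    and width_lim: "filterlim d at_top sequentially"
    and ensemble:
      "(\<forall>n\<ge>1. real_symmetric_band_ensemble p n (d n) D (M n) (A n)) \<or>
       (\<forall>n\<ge>1. hermitian_band_ensemble p n (d n) D D\<^sub>0 (M n) (A n))"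
    and tail: "\<And>n i j t. n \<ge> 1 \<Longrightarrow> (i, j) \<in> band_indices p n (d n) \<Longrightarrow> t > 0 \<Longrightarrow>
        measure (M n) {\<omega> \<in> space (M n). cmod (A n \<omega> $$ (i, j)) > t} = G t"
    and N: "\<And>n. N n = card (band_indices p n (d n))"
    and b_pos: "\<And>n. n \<ge> 1 \<Longrightarrow> b n > 0"
    and b_lim: "\<And>t. t > 0 \<Longrightarrow> (\<lambda>n. real (N n) * G (b n * t)) \<longlonglongrightarrow> t powr (- \<alpha>)"
    and k: "k \<ge> 1"
    and x_pos: "0 < x 1"
    and x_less_y: "\<And>j. 1 \<le> j \<Longrightarrow> j \<le> k \<Longrightarrow> ereal (x j) < y j"
    and y_less_x: "\<And>j. 1 \<le> j \<Longrightarrow> j < k \<Longrightarrow> y j < ereal (x (Suc j))"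
    and I: "\<And>j. I j = {t. x j < t \<and> ereal t < y j}"
    and \<mu>: "\<And>j. \<mu> j = (LINT t:I j|lborel. \<alpha> / t powr (1 + \<alpha>))"
  shows "(\<lambda>n. measure (M n) {\<omega> \<in> space (M n). \<forall>j\<in>{1..k}.
            eigenvalue_count (complex_of_real (inverse (b n)) \<cdot>\<^sub>m A n \<omega>) (I j) = s j})
          \<longlonglongrightarrow> (\<Prod>j=1..k. \<mu> j ^ s j / fact (s j) * exp (- \<mu> j))"
proof -
  have ens: "real_symmetric_band_ensemble p n (d n) D (M n) (A n) \<or> hermitian_band_ensemble p n (d n) D D\<^sub>0 (M n) (A n)"
    if "n \<ge> 1" for n using ensemble that by blast
  have sample: "band_sample (M n) p n (d n) (A n) (b n) G" if "n \<ge> 1" for n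
    by (rule band_sample_of_ensemble[OF ens[OF that] tail[OF that] b_pos[OF that]])
  \<comment> \<open>monotonicity of \<open>G\<close> is read off from the tail of the single entry of the \<open>1 \<times> 1\<close> matrix\<close>
  have anti: "G t \<le> G s" if "0 < s" "s \<le> t" for s t
  proof -
    interpret band_sample "M 1" p 1 "d 1" "A 1" "b 1" G by (rule sample) simp
    have J: "(0, 0) \<in> J" by (rule diag_in_J) simp
    have "{\<omega> \<in> space (M 1). cmod (A 1 \<omega> $$ (0, 0)) > s} \<in> sets (M 1)"
      using measurable_entry[of 0 0] by measurable
    hence "prob {\<omega> \<in> space (M 1). cmod (A 1 \<omega> $$ (0, 0)) > t} \<le> prob {\<omega> \<in> space (M 1). cmod (A 1 \<omega> $$ (0, 0)) > s}"
      using that by (intro finite_measure_mono) auto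
    thus ?thesis using tail[OF J, of s] tail[OF J, of t] that by simp
  qed
  interpret heavy_tailed_band_intervals \<alpha> h G p d N b M A k x y
    by (intro heavy_tailed_band_intervals.intro heavy_tailed_band.intro regular_tail.intro
        heavy_tailed_band_axioms.intro separated_intervals.intro)
      (fact h G anti alpha sample width width_lim N b_lim x_pos x_less_y y_less_x)+
  have mean: "limit_mean j = \<mu> j" if "j \<in> {1..k}" for j
  proof -
    have "0 < x j" "ereal (x j) < y j" using that x_ge[of j] x_pos x_less_y by auto
    from power_tail_integral[OF alpha(1) this] show ?thesis by (simp add: \<mu> I limit_mean_def)
  qed
  have "eigenvalue_prob s
     \<longlonglongrightarrow> (\<Prod>j=1..k. \<mu> j ^ s j / fact (s j) * exp (- \<mu> j))"
  proof -
    have "(\<Prod>r\<in>{1..k}. limit_mean r ^ s r / fact (s r) * exp (- limit_mean r))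
        = (\<Prod>j=1..k. \<mu> j ^ s j / fact (s j) * exp (- \<mu> j))"
      by (intro prod.cong refl) (simp only: mean)
    thus ?thesis using eigenvalue_event_lim[of s] by (simp only:)
  qed
  moreover have "eventually (\<lambda>n. eigenvalue_prob s n
     = measure (M n) {\<omega> \<in> space (M n). \<forall>j\<in>{1..k}.
            eigenvalue_count (complex_of_real (inverse (b n)) \<cdot>\<^sub>m A n \<omega>) (I j) = s j}) sequentially"
    using ev_ge_1
  proof eventually_elim
    case (elim n)
    show ?case
      unfolding eigenvalue_prob_def band_sample_intervals.eigenvalue_event_def[OF sample_intervals[OF elim]]
        band_sample.B_def[OF sample[OF elim]] I ..
  qed
  ultimately show ?thesis by (rule Lim_transform_eventually)
qed

end
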